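(* Consider the TAR(1) model with $\gamma=\delta=0$, i.e. $Y_t=\alpha Y_{t-1}+\varepsilon_t$ if $Y_{t-1}>r$ and $Y_t=\beta Y_{t-1}+\varepsilon_t$ if $Y_{t-1}\le r$, $t\ge1$, and assume $\mathbb{E}Y_0^2<\infty$. Suppose that either (i) $\alpha=1$, $\beta<1$ and $r\le 0$; or (ii) $\alpha=1$, $\beta=-1$ and $r\in\mathbb{R}$ is arbitrary. Then, as $n\to\infty$, $$ n(\hat\alpha_n-1)\Rightarrow \frac{B^2(1)-1}{2\int_0^1 B^2(t)\,\mathrm{d}t},$$ where $B$ is a standard Brownian motion.
   Context: Standing assumptions: $\{\varepsilon_t\}_{t\ge1}$ is an i.i.d. sequence of real random variables with $\mathbb{E}\varepsilon_1=0$ and $\mathbb{E}\varepsilon_1^2=\sigma^2\in(0,\infty)$; the initial value $Y_0$ is a random variable independent of $\{\varepsilon_t\}_{t\ge1}$ (and of $n$). The general TAR(1) model is $Y_t=\gamma+\alpha Y_{t-1}+\varepsilon_t$ if $Y_{t-1}>r$ and $Y_t=\delta+\beta Y_{t-1}+\varepsilon_t$ if $Y_{t-1}\le r$, with real parameters $\gamma,\delta,\alpha,\beta$ and threshold $r\in\mathbb{R}$. The least-squares estimator of $\alpha$ (with $\gamma=0$) is $$\hat\alpha_n=\frac{\sum_{t=1}^{n-1}I(Y_t>r)Y_tY_{t+1}}{\sum_{t=1}^{n-1}I(Y_t>r)Y_t^2}$$ (defined when the denominator is nonzero). $\Rightarrow$ denotes convergence in distribution. *)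

theory Defs
  imports "HOL-Probability.Probability"
begin

fun tar_path :: "real \<Rightarrow> real \<Rightarrow> real \<Rightarrow> real \<Rightarrow> (nat \<Rightarrow> real) \<Rightarrow> nat \<Rightarrow> real" where
  "tar_path alpha beta r y0 e 0 = y0"
| "tar_path alpha beta r y0 e (Suc t) =
     (if tar_path alpha beta r y0 e t > r then alpha * tar_path alpha beta r y0 e t
      else beta * tar_path alpha beta r y0 e t) + e (Suc t)"

text \<open>Least-squares estimator of alpha based on Y_1,...,Y_n (with Isabelle's x/0 = 0 convention
  when the denominator vanishes).\<close>
definition alpha_hat :: "real \<Rightarrow> (nat \<Rightarrow> real) \<Rightarrow> nat \<Rightarrow> real" where
  "alpha_hat r Y n =
     (\<Sum>t=1..<n. (if Y t > r then Y t * Y (Suc t) else 0)) /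
     (\<Sum>t=1..<n. (if Y t > r then (Y t)\<^sup>2 else 0))"

definition standard_BM :: "'b measure \<Rightarrow> (real \<Rightarrow> 'b \<Rightarrow> real) \<Rightarrow> bool" where
  "standard_BM N B \<longleftrightarrow>
     prob_space N \<and>
     (\<forall>t\<ge>0. B t \<in> borel_measurable N) \<and>
     (\<forall>\<omega>\<in>space N. B 0 \<omega> = 0) \<and>
     (\<forall>\<omega>\<in>space N. continuous_on {0..} (\<lambda>t. B t \<omega>)) \<and>
     (\<forall>s t. 0 \<le> s \<and> s < t \<longrightarrow>
        distributed N lborel (\<lambda>\<omega>. B t \<omega> - B s \<omega>) (normal_density 0 (sqrt (t - s)))) \<and>
     (\<forall>(ts::nat \<Rightarrow> real) k. 0 \<le> ts 0 \<and> (\<forall>i<k. ts i < ts (Suc i)) \<longrightarrow>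
        prob_space.indep_vars N (\<lambda>_. borel) (\<lambda>i \<omega>. B (ts (Suc i)) \<omega> - B (ts i) \<omega>) {..<k})"

end

theory Submission
  imports Defs "HOL-Real_Asymp.Real_Asymp"
begin

text \<open>
Write \<open>y t = Y t / (\<sigma> sqrt n)\<close>. Squaring the recursion and summing expresses the estimation error through
\<open>A = (y n)\<^sup>2\<close> and \<open>D = (1/n) \<Sum> (y t)\<^sup>2\<close>, up to the law of large numbers for the squared innovations and the
contribution of the times at which \<open>Y t \<le> r\<close>. So it suffices to show that the joint Laplace transform of \<open>(A, D)\<close>
at integer points converges to that of \<open>(B(1)\<^sup>2, \<integral> B\<^sup>2)\<close>: by Stone-Weierstrass on the unit square this gives
convergence of \<open>(exp (-A), exp (-D))\<close> in distribution.

For the Laplace transform, a Lindeberg argument runs backwards in time with the test functions \<open>exp (- a y\<^sup>2 - b)\<close>,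
which a Riccati recursion for \<open>a\<close> maps to each other up to \<open>o(1/n)\<close> per step. These functions are even, hence a step with
\<open>Y t \<le> r\<close> (multiplication by \<open>\<beta>\<close>) changes them only by \<open>O((1 + (Y t)\<^sup>2) / n)\<close>, which is why the limit does not
depend on \<open>\<beta>\<close> or \<open>r\<close>. The same estimate applied to the increments of Brownian motion identifies the limit.

It remains to see that \<open>(1 + (Y t)\<^sup>2) 1{Y t \<le> r}\<close> is negligible on average. The negative parts are uniformly square integrable,
since they satisfy a contractive recursion. The time spent in a bounded set is \<open>O(sqrt n)\<close>, because a Huber function of
\<open>Y t\<close> (plus a linear term if \<open>r \<le> 0\<close>) is a submartingale of linear growth with a strict drift on that set.
\<close>

section \<open>Gaussian test functions\<close>

text \<open>No invariance principle is used: the ratio depends on the path only through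
  \<open>A\<close> and \<open>D\<close>, and Gaussian functions are stable under the dynamics of
  such functionals. For Brownian motion killed at rate mu y^2, the function exp (- a y^2 - b) of the
  state and the remaining time solves the backward equation iff a' = mu - 2 a^2 and b' = a;
  \<open>riccati\<close> and \<open>riccati_sum\<close> are the Euler scheme with step 1/n. It is
  never solved: \<open>exp (- riccati_sum lam mu n n)\<close> is close to both transforms, and the
  Brownian one converges.

  The quotient is continuous only inside the unit square, which suffices since the limit does not
  charge the boundary.

  The case distinction enters twice. For the negative parts the contraction factor is
  \<open>max 0 beta\<close>: a negative \<open>beta\<close> sends a state below the threshold to a
  value of at least \<open>- \<bar>r\<bar>\<close>. For the occupation times a function is needed
  that the regression map does not decrease: if beta = -1 the map keeps absolute values and an even
  one works for every \<open>r\<close>; if \<open>r \<le> 0\<close> and beta < 1 the map only moves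
  to the right and a nondecreasing one works.\<close>

lemma taylor2_remainder_le:
  fixes f f1 f2 f3 :: "real \<Rightarrow> real"
  assumes f1: "\<And>x. (f has_real_derivative f1 x) (at x)"
    and f2: "\<And>x. (f1 has_real_derivative f2 x) (at x)"
    and f3: "\<And>x. (f2 has_real_derivative f3 x) (at x)"
    and C2: "\<And>x. \<bar>f2 x\<bar> \<le> C2" and C3: "\<And>x. \<bar>f3 x\<bar> \<le> C3"
  shows "\<bar>f (y + h) - f y - f1 y * h - f2 y * h\<^sup>2 / 2\<bar> \<le> (C2 + C3) * min (h\<^sup>2) (\<bar>h\<bar> ^ 3)"
proof -
  have C0: "C2 \<ge> 0" "C3 \<ge> 0"
    using C2[of 0] C3[of 0] by auto
  define d where "d m = (if m = 0 then f else if m = 1 then f1 else if m = 2 then f2 else f3)" for m :: nat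
  have dd: "DERIV (\<lambda>t. d m (y + t)) t :> d (Suc m) (y + t)" if "m < 3" for m t
  proof -
    have "m = 0 \<or> m = 1 \<or> m = 2" using that by auto
    then have "(d m has_real_derivative d (Suc m) (y + t)) (at (t + y))"
      using f1[of "y+t"] f2[of "y+t"] f3[of "y+t"] unfolding d_def by (auto simp: add.commute)
    then show ?thesis
      by (simp add: DERIV_shift add.commute)
  qed
  \<comment> \<open>Expansions of order three and of order two, both about \<open>y\<close>: the
    first is good for small \<open>h\<close>, the second for large \<open>h\<close>. The minimum of
    the two bounds is integrable when \<open>h\<close> has only a second moment, unlike
    \<open>\<bar>h\<bar> ^ 3\<close> alone.\<close>
  obtain s where s: "f (y + h) = (\<Sum>m<3. d m (y + 0) / fact m * h ^ m) + d 3 (y + s) / fact 3 * h ^ 3"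
    using Maclaurin_bi_le[of "\<lambda>m t. d m (y + t)" "\<lambda>t. f (y + t)" 3 h] dd by (auto simp: d_def)
  obtain s' where s': "f (y + h) = (\<Sum>m<2. d m (y + 0) / fact m * h ^ m) + d 2 (y + s') / fact 2 * h ^ 2"
    using Maclaurin_bi_le[of "\<lambda>m t. d m (y + t)" "\<lambda>t. f (y + t)" 2 h] dd by (auto simp: d_def)
  let ?R = "f (y + h) - f y - f1 y * h - f2 y * h\<^sup>2 / 2"
  have R3: "?R = f3 (y + s) / 6 * h ^ 3"
    using s by (simp add: d_def eval_nat_numeral fact_numeral)
  have R2: "?R = (f2 (y + s') - f2 y) / 2 * h\<^sup>2"
    using s' by (simp add: d_def eval_nat_numeral fact_numeral algebra_simps)
  have "\<bar>?R\<bar> \<le> C3 * \<bar>h\<bar> ^ 3"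
  proof -
    have "\<bar>?R\<bar> = \<bar>f3 (y + s)\<bar> / 6 * \<bar>h\<bar> ^ 3"
      unfolding R3 by (simp add: abs_mult power_abs)
    also have "\<dots> \<le> C3 * \<bar>h\<bar> ^ 3"
      using C3[of "y + s"] C0 by (intro mult_right_mono) auto
    finally show ?thesis .
  qed
  moreover have "\<bar>?R\<bar> \<le> C2 * h\<^sup>2"
  proof -
    have "\<bar>?R\<bar> = \<bar>(f2 (y + s') - f2 y) / 2\<bar> * h\<^sup>2"
      unfolding R2 by (simp add: abs_mult)
    also have "\<dots> \<le> C2 * h\<^sup>2"
      using C2[of "y + s'"] C2[of y] by (intro mult_right_mono) auto
    finally show ?thesis .
  qed
  moreover have "C2 * h\<^sup>2 \<le> (C2 + C3) * h\<^sup>2" "C3 * \<bar>h\<bar>^3 \<le> (C2 + C3) * \<bar>h\<bar>^3"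
    using C0 by (auto intro!: mult_right_mono)
  ultimately show ?thesis
    by (auto simp: min_def)
qed

definition gauss1 :: "real \<Rightarrow> real \<Rightarrow> real" where
  "gauss1 a x = - 2 * a * x * exp (- a * x\<^sup>2)"

definition gauss2 :: "real \<Rightarrow> real \<Rightarrow> real" where
  "gauss2 a x = (4 * a\<^sup>2 * x\<^sup>2 - 2 * a) * exp (- a * x\<^sup>2)"

lemma gauss1_deriv: "((\<lambda>x. exp (- a * x\<^sup>2)) has_real_derivative gauss1 a x) (at x)"
  unfolding gauss1_def by (auto intro!: derivative_eq_intros)

lemma gauss2_deriv: "(gauss1 a has_real_derivative gauss2 a x) (at x)"
  unfolding gauss1_def[abs_def] gauss2_def
  by (auto intro!: derivative_eq_intros simp: algebra_simps power2_eq_square)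

lemma gauss3_deriv:
  "(gauss2 a has_real_derivative (12 * a\<^sup>2 * x - 8 * a^3 * x^3) * exp (- a * x\<^sup>2)) (at x)"
  unfolding gauss2_def[abs_def]
  by (auto intro!: derivative_eq_intros simp: algebra_simps power2_eq_square power3_eq_cube)

lemma exp_ge_power2_half: "s\<^sup>2 / 2 \<le> exp s" if "s \<ge> 0" for s :: real
  using exp_lower_Taylor_quadratic[OF that] that by linarith

lemma abs_mult_exp_neg_le: "\<bar>s * exp (- s\<^sup>2)\<bar> \<le> (1::real)" 
proof -
  have "\<bar>s\<bar> \<le> 1 + s\<^sup>2"
    using zero_le_power2[of "\<bar>s\<bar> - 1"] abs_ge_zero[of s] by (simp add: power2_diff)
  also have "\<dots> \<le> exp (s\<^sup>2)" by (rule exp_ge_add_one_self)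
  finally show ?thesis
    by (simp add: abs_mult exp_minus field_simps)
qed

lemma mult_exp_neg_le: "s * exp (- s) \<le> (1::real)"
proof -
  have "s \<le> exp s" using exp_ge_add_one_self[of s] by linarith
  then show ?thesis by (simp add: exp_minus field_simps)
qed

lemma power3_exp_neg_le: "\<bar>s ^ 3 * exp (- s\<^sup>2)\<bar> \<le> (4::real)"
proof -
  have "\<bar>s\<bar>^3 \<le> 1 + \<bar>s\<bar>^4"
  proof (cases "\<bar>s\<bar> \<le> 1")
    case True then show ?thesis using power_le_one[of "\<bar>s\<bar>" 3] by (smt (verit) zero_le_power abs_ge_zero)
  next
    case False then show ?thesis using power_increasing[of 3 4 "\<bar>s\<bar>"] by simp
  qed
  also have "\<dots> \<le> 4 * exp (s\<^sup>2)"
  proof -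
    have "\<bar>s\<bar>^4 / 2 \<le> exp (s\<^sup>2)"
      using exp_ge_power2_half[of "s\<^sup>2"] by (simp add: power_mult[symmetric])
    moreover have "1 \<le> exp (s\<^sup>2)" by simp
    ultimately show ?thesis by linarith
  qed
  finally show ?thesis
    by (simp add: abs_mult power_abs exp_minus field_simps)
qed

text \<open>In the variable \<open>s = sqrt a * x\<close> the derivative of order k is a^(k/2) times
  a bounded function of \<open>s\<close> alone, so nothing degenerates as \<open>a\<close> tends to
  0. The assumption \<open>L \<ge> 1\<close> allows \<open>sqrt a \<le> L\<close>, and 44 is 12 + 8
  * 4.\<close>

lemma gauss_bounds:
  assumes a: "0 \<le> a" "a \<le> L" and L: "L \<ge> 1"
  shows "\<bar>gauss1 a x\<bar> \<le> 2 * L" "\<bar>gauss2 a x\<bar> \<le> 6 * L"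
    "\<bar>(12 * a\<^sup>2 * x - 8 * a^3 * x^3) * exp (- a * x\<^sup>2)\<bar> \<le> 44 * L\<^sup>2"
proof -
  define s where "s = sqrt a * x"
  have s2: "s\<^sup>2 = a * x\<^sup>2" using a by (simp add: s_def power_mult_distrib)
  have sa: "sqrt a \<le> L"
  proof (rule real_le_lsqrt)
    show "a \<le> L\<^sup>2" using a L self_le_power[of L 2] by simp
  qed (use a L in auto)
  have g1: "gauss1 a x = - 2 * sqrt a * (s * exp (- s\<^sup>2))"
    using a unfolding gauss1_def s2 unfolding s_def by (simp add: algebra_simps flip: power2_eq_square)
  have "\<bar>gauss1 a x\<bar> = 2 * sqrt a * \<bar>s * exp (- s\<^sup>2)\<bar>"
    unfolding g1 using a by (simp add: abs_mult)
  also have "\<dots> \<le> 2 * L * 1"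
    using sa a L by (intro mult_mono abs_mult_exp_neg_le) auto
  finally show "\<bar>gauss1 a x\<bar> \<le> 2 * L" by simp
  have g2: "gauss2 a x = 4 * a * (s\<^sup>2 * exp (- s\<^sup>2)) - 2 * a * exp (- s\<^sup>2)"
    unfolding gauss2_def s2 by (simp add: algebra_simps power2_eq_square)
  have "\<bar>gauss2 a x\<bar> \<le> 4 * a * (s\<^sup>2 * exp (- s\<^sup>2)) + 2 * a * exp (- s\<^sup>2)"
    unfolding g2 using a by (intro order_trans[OF abs_triangle_ineq4]) simp
  also have "\<dots> \<le> 4 * L * 1 + 2 * L * 1"
    using a L by (intro add_mono mult_mono mult_exp_neg_le) auto
  finally show "\<bar>gauss2 a x\<bar> \<le> 6 * L" by simp
  have e3: "12 * a\<^sup>2 * x - 8 * a^3 * x^3 = a * sqrt a * (12 * s - 8 * s^3)"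
  proof -
    have "sqrt a * s = a * x" using a by (simp add: s_def)
    moreover have "s^3 = a * x\<^sup>2 * s" using s2 by (simp add: power3_eq_cube power2_eq_square)
    moreover have "a * sqrt a * (12 * s - 8 * (a * x\<^sup>2 * s))
        = 12 * a * (sqrt a * s) - 8 * a * (a * x\<^sup>2) * (sqrt a * s)"
      by (simp add: algebra_simps)
    ultimately have "a * sqrt a * (12 * s - 8 * s^3) = 12 * a * (a * x) - 8 * a * (a * x\<^sup>2) * (a * x)"
      by simp
    then show ?thesis by (simp add: power2_eq_square power3_eq_cube mult.assoc mult.left_commute)
  qed
  have "(12 * a\<^sup>2 * x - 8 * a^3 * x^3) * exp (- a * x\<^sup>2)
     = a * sqrt a * (12 * (s * exp (- s\<^sup>2)) - 8 * (s^3 * exp (- s\<^sup>2)))"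
    unfolding e3 using a s2 by (simp add: algebra_simps)
  then have "\<bar>(12 * a\<^sup>2 * x - 8 * a^3 * x^3) * exp (- a * x\<^sup>2)\<bar>
     = a * sqrt a * \<bar>12 * (s * exp (- s\<^sup>2)) - 8 * (s^3 * exp (- s\<^sup>2))\<bar>"
    using a by (simp only: abs_mult) simp
  also have "\<dots> \<le> L * L * (12 * 1 + 8 * 4)"
    using a L sa abs_mult_exp_neg_le[of s] power3_exp_neg_le[of s]
    by (intro mult_mono) (auto simp: abs_le_iff)
  finally show "\<bar>(12 * a\<^sup>2 * x - 8 * a^3 * x^3) * exp (- a * x\<^sup>2)\<bar> \<le> 44 * L\<^sup>2"
    by (simp add: power2_eq_square)
qed

lemma exp_minus_one_minus_le: "\<bar>exp z - 1 - z\<bar> \<le> z\<^sup>2 / 2 * exp \<bar>z\<bar>" for z :: real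
proof -
  obtain t where "\<bar>t\<bar> \<le> \<bar>z\<bar>" "exp z = (\<Sum>m<2. z ^ m / fact m) + exp t / fact 2 * z ^ 2"
    using Maclaurin_exp_le[of z 2] by auto
  then have "\<bar>t\<bar> \<le> \<bar>z\<bar>" "exp z - 1 - z = exp t * z\<^sup>2 / 2"
    by (auto simp: eval_nat_numeral)
  moreover have "exp t * z\<^sup>2 \<le> exp \<bar>z\<bar> * z\<^sup>2"
    using calculation(1) by (intro mult_right_mono) auto
  ultimately show ?thesis
    by (simp only: abs_mult abs_divide) (simp add: mult.commute)
qed

text \<open>With w = a y^2 and z = (2 a^2 y^2 - a) / n, averaging over a step multiplies exp (- w)
  by 1 + z, while the Riccati step multiplies it by exp z, so the difference is of order 1/n^2.
  Since z is unbounded in \<open>y\<close>, the condition \<open>n \<ge> 4 * L\<close> is used to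
  get |z| <= w/2 + 1/4; half of the decay exp (- w) is then left to absorb the factor z^2.\<close>

lemma riccati_step_error:
  fixes a y :: real
  assumes a: "0 \<le> a" "a \<le> L" and mu: "0 \<le> mu" and n: "real n \<ge> 4 * L" and L: "L \<ge> 1"
  shows "\<bar>exp (- mu / n * y\<^sup>2) * (exp (- a * y\<^sup>2) + gauss2 a y / 2 / n)
     - exp (- (a - 2 * a\<^sup>2 / n + mu / n) * y\<^sup>2 - a / n)\<bar> \<le> 66 * L\<^sup>2 / (real n)\<^sup>2"
proof -
  have n0: "real n > 0" using n L by linarith
  define z where "z = (2 * a\<^sup>2 * y\<^sup>2 - a) / n"
  define w where "w = a * y\<^sup>2"
  have w0: "w \<ge> 0" using a by (simp add: w_def)
  have an: "a / n \<le> 1 / 4" using a n n0 by (simp add: field_simps)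
  have zw: "z = (2 * w - 1) * (a / n)" using n0 by (simp add: z_def w_def field_simps power2_eq_square)
  have "\<bar>z\<bar> \<le> (2 * w + 1) * (a / n)"
    unfolding zw using w0 a n0 by (simp add: abs_mult) (intro mult_right_mono divide_right_mono, auto)
  also have "\<dots> \<le> (2 * w + 1) * (1/4)"
    using an w0 by (intro mult_left_mono) auto
  finally have zb: "\<bar>z\<bar> \<le> w / 2 + 1 / 4" by simp
  have "exp (1/4 :: real) \<le> exp (1/2)" by simp
  then have e4: "exp (1/4 :: real) \<le> 2" using exp_half_le2 by linarith
  have z2: "z\<^sup>2 \<le> (8 * w\<^sup>2 + 2) * (L / n)\<^sup>2"
  proof -
    have "(2 * w - 1)\<^sup>2 \<le> 8 * w\<^sup>2 + 2"
      using zero_le_power2[of "2 * w + 1"] by (simp add: power2_eq_square algebra_simps)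
    moreover have "(a / n)\<^sup>2 \<le> (L / n)\<^sup>2"
      using a n0 by (intro power_mono divide_right_mono) auto
    ultimately show ?thesis unfolding zw power_mult_distrib by (intro mult_mono) auto
  qed
  \<comment> \<open>The bound \<open>w\<^sup>2 \<le> 8 * exp (w / 2)\<close> gives 8 * 8 + 2 = 66,
    the constant that stays in all later error terms.\<close>
  have ew: "(8 * w\<^sup>2 + 2) * exp (- (w / 2)) \<le> 66"
  proof -
    have "w\<^sup>2 \<le> 8 * exp (w / 2)"
      using exp_ge_power2_half[of "w/2"] w0 by (simp add: power_divide)
    moreover have "1 \<le> exp (w / 2)" using w0 by simp
    ultimately have "8 * w\<^sup>2 + 2 \<le> 66 * exp (w / 2)" by linarith
    then show ?thesis by (simp add: exp_minus field_simps)
  qed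
  have "\<bar>exp (- mu / n * y\<^sup>2) * (exp (- a * y\<^sup>2) + gauss2 a y / 2 / n)
     - exp (- (a - 2 * a\<^sup>2 / n + mu / n) * y\<^sup>2 - a / n)\<bar>
     = \<bar>exp (- mu / n * y\<^sup>2) * exp (- w) * (1 + z - exp z)\<bar>"
  proof -
    have "exp (- (a - 2 * a\<^sup>2 / n + mu / n) * y\<^sup>2 - a / n) = exp (- mu / n * y\<^sup>2) * exp (- w) * exp z"
      using n0 unfolding exp_add[symmetric] w_def z_def by (intro arg_cong[of _ _ exp]) (simp add: field_simps)
    moreover have "exp (- a * y\<^sup>2) + gauss2 a y / 2 / n = exp (- w) * (1 + z)"
      using n0 unfolding gauss2_def z_def w_def by (simp add: field_simps)
    ultimately show ?thesis by (simp add: algebra_simps)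
  qed
  also have "\<dots> = exp (- mu / n * y\<^sup>2) * exp (- w) * \<bar>exp z - 1 - z\<bar>"
    unfolding abs_mult using abs_minus_commute[of "1 + z" "exp z"] by (simp add: diff_diff_eq)
  also have "\<dots> \<le> 1 * exp (- w) * (z\<^sup>2 / 2 * exp (w / 2 + 1 / 4))"
    using mu n0 zb
    by (intro mult_mono order_trans[OF exp_minus_one_minus_le] mult_left_mono) auto
  also have "\<dots> = z\<^sup>2 * exp (- (w / 2)) * (exp (1/4) / 2)"
    by (simp add: exp_add[symmetric] mult_exp_exp exp_diff)
  also have "\<dots> \<le> ((8 * w\<^sup>2 + 2) * (L / n)\<^sup>2) * exp (- (w / 2)) * 1"
    using z2 e4 by (intro mult_mono) auto
  also have "\<dots> = ((8 * w\<^sup>2 + 2) * exp (- (w / 2))) * (L / n)\<^sup>2" by simp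
  also have "\<dots> \<le> 66 * (L / n)\<^sup>2" using ew by (intro mult_right_mono) auto
  finally show ?thesis by (simp add: power_divide)
qed

lemma exp_minus_diff_le: "\<bar>exp (- s) - exp (- t)\<bar> \<le> \<bar>s - t\<bar>" if "s \<ge> 0" "t \<ge> 0" for s t :: real
proof -
  have *: "exp (- s) - exp (- t) \<le> t - s" if "0 \<le> s" "s \<le> t" for s t :: real
  proof -
    have "exp (- s) - exp (- t) = exp (- s) * (1 - exp (- (t - s)))"
      by (simp add: algebra_simps mult_exp_exp)
    also have "\<dots> \<le> 1 * (t - s)"
    proof (intro mult_mono)
      show "1 - exp (- (t - s)) \<le> t - s"
        using exp_ge_add_one_self[of "- (t - s)"] by linarith
    qed (use that in auto)
    finally show ?thesis by simp
  qed
  show ?thesis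
    using *[of s t] *[of t s] that by (cases "s \<le> t") (auto simp: abs_if)
qed

text \<open>The third subtracted term is linear in \<open>h\<close> and in
  \<open>h\<^sup>2 - 1 / n\<close> with coefficients depending on \<open>y\<close> only. If
  \<open>h\<close> is independent of \<open>y\<close>, centred and of variance 1/n, it has mean
  zero, and only the Taylor remainder and the Riccati error are left.\<close>

lemma gaussian_step_error:
  fixes a y h :: real
  assumes a: "0 \<le> a" "a \<le> L" and mu: "0 \<le> mu" and n: "real n \<ge> 4 * L" and L: "L \<ge> 1"
  shows "\<bar>exp (- mu / n * y\<^sup>2) * exp (- a * (y + h)\<^sup>2)
      - exp (- (a - 2 * a\<^sup>2 / n + mu / n) * y\<^sup>2 - a / n)
      - exp (- mu / n * y\<^sup>2) * (gauss1 a y * h + gauss2 a y / 2 * (h\<^sup>2 - 1 / n))\<bar>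
    \<le> 66 * L\<^sup>2 * (min (h\<^sup>2) (\<bar>h\<bar> ^ 3) + 1 / (real n)\<^sup>2)"
proof -
  let ?e = "exp (- mu / n * y\<^sup>2)"
  let ?R = "exp (- a * (y + h)\<^sup>2) - exp (- a * y\<^sup>2) - gauss1 a y * h - gauss2 a y * h\<^sup>2 / 2"
  let ?Q = "?e * (exp (- a * y\<^sup>2) + gauss2 a y / 2 / n) - exp (- (a - 2 * a\<^sup>2 / n + mu / n) * y\<^sup>2 - a / n)"
  have "L * 1 \<le> L * L" using L by (intro mult_left_mono) auto
  then have "L \<le> L\<^sup>2" by (simp add: power2_eq_square)
  then have LL: "6 * L + 44 * L\<^sup>2 \<le> 66 * L\<^sup>2" using zero_le_power2[of L] by linarith
  have "\<bar>?R\<bar> \<le> (6 * L + 44 * L\<^sup>2) * min (h\<^sup>2) (\<bar>h\<bar> ^ 3)"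
    by (rule taylor2_remainder_le[OF gauss1_deriv gauss2_deriv gauss3_deriv gauss_bounds(2,3)])
      (use a L in auto)
  also have "\<dots> \<le> 66 * L\<^sup>2 * min (h\<^sup>2) (\<bar>h\<bar> ^ 3)"
    using LL by (intro mult_right_mono) auto
  finally have "\<bar>?R\<bar> \<le> 66 * L\<^sup>2 * min (h\<^sup>2) (\<bar>h\<bar> ^ 3)" .
  moreover have "?e \<le> 1" using mu by simp
  ultimately have "?e * \<bar>?R\<bar> \<le> 1 * (66 * L\<^sup>2 * min (h\<^sup>2) (\<bar>h\<bar> ^ 3))"
    by (intro mult_mono) auto
  then have R: "\<bar>?e * ?R\<bar> \<le> 66 * L\<^sup>2 * min (h\<^sup>2) (\<bar>h\<bar> ^ 3)"
    by (simp add: abs_mult)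
  have Q: "\<bar>?Q\<bar> \<le> 66 * L\<^sup>2 / (real n)\<^sup>2"
    using riccati_step_error[OF a mu n L] .
  have "?e * exp (- a * (y + h)\<^sup>2)
      - exp (- (a - 2 * a\<^sup>2 / n + mu / n) * y\<^sup>2 - a / n)
      - ?e * (gauss1 a y * h + gauss2 a y / 2 * (h\<^sup>2 - 1 / n)) = ?e * ?R + ?Q"
    by (simp add: algebra_simps)
  moreover have "\<bar>?e * ?R + ?Q\<bar> \<le> 66 * L\<^sup>2 * (min (h\<^sup>2) (\<bar>h\<bar> ^ 3) + 1 / (real n)\<^sup>2)"
    using R Q by (simp add: distrib_left)
  ultimately show ?thesis by simp
qed

text \<open>No cancellation is sought: both exponents are nonnegative and of size O(y^2 + h^2 +
  1/n), and exp (- x) is 1-Lipschitz on the nonnegative numbers. Such a bound is not o(1/n) per step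
  in general, but it is applied only at times that turn out to be rare.\<close>

lemma reflected_step_error:
  fixes a y h b :: real
  assumes a: "0 \<le> a" "a \<le> L" and a': "0 \<le> a'" "a' \<le> L" and mu: "0 \<le> mu" "mu \<le> L" and n: "real n \<ge> 1"
  shows "\<bar>exp (- mu / n * y\<^sup>2) * exp (- a * (b * y + h)\<^sup>2) - exp (- a' * y\<^sup>2 - a / n)\<bar>
    \<le> 2 * L * (1 + b\<^sup>2) * (y\<^sup>2 + h\<^sup>2 + 1 / n)"
proof -
  let ?s = "mu / n * y\<^sup>2 + a * (b * y + h)\<^sup>2" and ?t = "a' * y\<^sup>2 + a / n"
  have st: "?s \<ge> 0" "?t \<ge> 0" using a a' mu n by auto
  have "(b * y + h)\<^sup>2 \<le> 2 * (b\<^sup>2 * y\<^sup>2) + 2 * h\<^sup>2"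
    using zero_le_power2[of "b * y - h"] by (simp add: power2_eq_square algebra_simps)
  then have "a * (b * y + h)\<^sup>2 \<le> L * (2 * (b\<^sup>2 * y\<^sup>2) + 2 * h\<^sup>2)"
    using a by (intro mult_mono) auto
  moreover have "mu / n \<le> L"
    using mu n frac_le[of L mu 1 "real n"] by simp
  then have "mu / n * y\<^sup>2 \<le> L * y\<^sup>2" by (intro mult_right_mono) auto
  moreover have "a' * y\<^sup>2 \<le> L * y\<^sup>2" using a' by (intro mult_right_mono) auto
  moreover have "a / n \<le> L / n" using a n by (intro divide_right_mono) auto
  moreover have "\<bar>?s - ?t\<bar> \<le> ?s + ?t"
    by (rule order_trans[OF abs_triangle_ineq4]) (simp only: abs_of_nonneg[OF st(1)] abs_of_nonneg[OF st(2)])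
  ultimately have "\<bar>?s - ?t\<bar> \<le> L * (2 * (b\<^sup>2 * y\<^sup>2) + 2 * h\<^sup>2) + L * y\<^sup>2 + L * y\<^sup>2 + L * (1 / n)"
    by simp
  also have "\<dots> = L * (2 * (b\<^sup>2 * y\<^sup>2) + 2 * h\<^sup>2 + y\<^sup>2 + y\<^sup>2 + 1 / n)" by (simp only: distrib_left)
  also have "\<dots> \<le> L * (2 * (1 + b\<^sup>2) * (y\<^sup>2 + h\<^sup>2 + 1 / n))"
  proof (intro mult_left_mono)
    have "2 * (1 + b\<^sup>2) * (y\<^sup>2 + h\<^sup>2 + 1 / n) - (2 * (b\<^sup>2 * y\<^sup>2) + 2 * h\<^sup>2 + y\<^sup>2 + y\<^sup>2 + 1 / n)
       = 1 / n + 2 * b\<^sup>2 * h\<^sup>2 + 2 * b\<^sup>2 * (1 / n)" by (simp add: algebra_simps)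
    also have "\<dots> \<ge> 0" using n by simp
    finally show "2 * (b\<^sup>2 * y\<^sup>2) + 2 * h\<^sup>2 + y\<^sup>2 + y\<^sup>2 + 1 / n \<le> 2 * (1 + b\<^sup>2) * (y\<^sup>2 + h\<^sup>2 + 1 / n)" by simp
  qed (use a in linarith)
  finally have "\<bar>?s - ?t\<bar> \<le> 2 * L * (1 + b\<^sup>2) * (y\<^sup>2 + h\<^sup>2 + 1 / n)" by (simp only: mult_ac)
  moreover have "exp (- mu / n * y\<^sup>2) * exp (- a * (b * y + h)\<^sup>2) = exp (- ?s)"
    by (simp add: mult_exp_exp)
  moreover have "exp (- a' * y\<^sup>2 - a / n) = exp (- ?t)" by simp
  ultimately show ?thesis
    using exp_minus_diff_le[OF st] by simp
qed

section \<open>The Riccati recursion of the exponents\<close>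

primrec riccati :: "real \<Rightarrow> real \<Rightarrow> nat \<Rightarrow> nat \<Rightarrow> real" where
  "riccati lam mu n 0 = lam"
| "riccati lam mu n (Suc k) = riccati lam mu n k - 2 * (riccati lam mu n k)\<^sup>2 / n + mu / n"

definition riccati_sum :: "real \<Rightarrow> real \<Rightarrow> nat \<Rightarrow> nat \<Rightarrow> real" where
  "riccati_sum lam mu n k = (\<Sum>i<k. riccati lam mu n i / n)"

text \<open>The quadratic term only lowers the value, so at most mu/n is gained in each of at most
  \<open>n\<close> steps. This upper bound in turn gives n >= 2 a, hence 2 a^2 / n <= a, which
  preserves nonnegativity.\<close>

lemma riccati_bounds:
  assumes "0 \<le> lam" "0 \<le> mu" "real n \<ge> 2 * (lam + mu)" "n \<ge> 1" "k \<le> n"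
  shows "0 \<le> riccati lam mu n k" "riccati lam mu n k \<le> lam + mu"
proof -
  have "0 \<le> riccati lam mu n k \<and> riccati lam mu n k \<le> lam + k * mu / n"
    using assms(5)
  proof (induction k)
    case (Suc k)
    let ?a = "riccati lam mu n k"
    have IH: "0 \<le> ?a" "?a \<le> lam + k * mu / n" using Suc by auto
    have "k * mu / n \<le> mu"
      using Suc.prems assms by (simp add: field_simps mult_left_mono)
    then have "?a \<le> lam + mu" using order_trans[OF IH(2)] by simp
    then have "2 * ?a \<le> n" using assms(3) by simp
    then have "2 * ?a * ?a \<le> n * ?a" using IH by (intro mult_right_mono) auto
    then have "2 * ?a\<^sup>2 / n \<le> ?a" using assms by (simp add: field_simps power2_eq_square)
    moreover have "2 * ?a\<^sup>2 / n \<ge> 0" "mu / n \<ge> 0" using assms by auto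
    moreover have "lam + Suc k * mu / n = lam + k * mu / n + mu / n"
      by (simp add: add_divide_distrib algebra_simps)
    ultimately show ?case unfolding riccati.simps using IH by linarith
  qed (use assms in auto)
  moreover have "k * mu / n \<le> mu"
    using assms by (simp add: field_simps mult_left_mono)
  ultimately show "0 \<le> riccati lam mu n k" "riccati lam mu n k \<le> lam + mu" by auto
qed

lemma riccati_sum_nonneg:
  assumes "0 \<le> lam" "0 \<le> mu" "real n \<ge> 2 * (lam + mu)" "n \<ge> 1" "k \<le> n"
  shows "0 \<le> riccati_sum lam mu n k"
  unfolding riccati_sum_def using assms by (intro sum_nonneg divide_nonneg_nonneg riccati_bounds) auto

section \<open>Laplace transforms of quadratic functionals\<close>

lemma gauss_measurable [measurable]:
  "gauss1 a \<in> borel_measurable borel" "gauss2 a \<in> borel_measurable borel"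
  unfolding gauss1_def[abs_def] gauss2_def[abs_def] by measurable

lemma (in prob_space) expectation_indep_mult:
  fixes X h :: "'a \<Rightarrow> real" and g :: "real \<Rightarrow> real"
  assumes ind: "indep_var borel X borel h" and g: "g \<in> borel_measurable borel"
    and "integrable M X" "integrable M (\<lambda>\<omega>. g (h \<omega>))"
  shows "integrable M (\<lambda>\<omega>. X \<omega> * g (h \<omega>))"
    and "expectation (\<lambda>\<omega>. X \<omega> * g (h \<omega>)) = expectation X * expectation (\<lambda>\<omega>. g (h \<omega>))"
proof -
  have "indep_var borel ((\<lambda>x. x) \<circ> X) borel (g \<circ> h)"
    by (rule indep_var_compose[OF ind _ g]) simp
  then show "integrable M (\<lambda>\<omega>. X \<omega> * g (h \<omega>))"
    "expectation (\<lambda>\<omega>. X \<omega> * g (h \<omega>)) = expectation X * expectation (\<lambda>\<omega>. g (h \<omega>))"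
    using indep_var_integrable[of X "g \<circ> h"] indep_var_lebesgue_integral[of X "g \<circ> h"] assms(3,4)
    by (auto simp: comp_def)
qed

lemma (in prob_space) integrable_of_square:
  fixes h :: "'a \<Rightarrow> real"
  assumes [measurable]: "h \<in> borel_measurable M" and "integrable M (\<lambda>\<omega>. (h \<omega>)\<^sup>2)"
  shows "integrable M h"
  by (rule square_integrable_imp_integrable) (use assms in auto)

text \<open>\<open>W\<close> is the weight contributed by the past; all that matters is that it lies
  in [0, 1]. Independence of \<open>h\<close> is asked for all measurable functions of the pair
  \<open>(W, y)\<close> because the mean-zero correction to be subtracted has such functions as
  coefficients.\<close>

lemma (in prob_space) laplace_one_step:
  fixes y y' h W :: "'a \<Rightarrow> real" and Bd :: "real set"
  assumes ind: "\<And>f. f \<in> borel_measurable (borel \<Otimes>\<^sub>M borel) \<Longrightarrow> indep_var borel (\<lambda>\<omega>. f (W \<omega>, y \<omega>)) borel h"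
    and Bd [measurable]: "Bd \<in> sets borel"
    and W: "\<And>\<omega>. \<omega> \<in> space M \<Longrightarrow> 0 \<le> W \<omega> \<and> W \<omega> \<le> 1"
    and y2: "integrable M (\<lambda>\<omega>. (y \<omega>)\<^sup>2)" and h2: "integrable M (\<lambda>\<omega>. (h \<omega>)\<^sup>2)"
    and Eh: "expectation h = 0" and Eh2: "expectation (\<lambda>\<omega>. (h \<omega>)\<^sup>2) = 1 / n"
    and eta: "expectation (\<lambda>\<omega>. min ((h \<omega>)\<^sup>2) (\<bar>h \<omega>\<bar> ^ 3)) \<le> eta"
    and y': "\<And>\<omega>. \<omega> \<in> space M \<Longrightarrow> y' \<omega> = (if y \<omega> \<in> Bd then b * y \<omega> else y \<omega>) + h \<omega>"
    and a: "0 \<le> a" "a \<le> L" and a': "a' = a - 2 * a\<^sup>2 / n + mu / n" "0 \<le> a'" "a' \<le> L"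
    and mu: "0 \<le> mu" "mu \<le> L" and n: "real n \<ge> 4 * L" and L: "L \<ge> 1"
  shows "\<bar>expectation (\<lambda>\<omega>. W \<omega> * exp (- mu / n * (y \<omega>)\<^sup>2) * exp (- a * (y' \<omega>)\<^sup>2))
      - expectation (\<lambda>\<omega>. W \<omega> * exp (- a' * (y \<omega>)\<^sup>2 - a / n))\<bar>
    \<le> 66 * L\<^sup>2 * (eta + 1 / (real n)\<^sup>2)
      + 4 * L * (1 + b\<^sup>2) * expectation (\<lambda>\<omega>. indicat_real Bd (y \<omega>) * ((y \<omega>)\<^sup>2 + 1 / n))"
proof -
  have n1: "real n \<ge> 1" using n L by linarith
  have [measurable]: "W \<in> borel_measurable M" "y \<in> borel_measurable M"
    using indep_var_rv1[OF ind[of fst]] indep_var_rv1[OF ind[of snd]] by auto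
  have hm [measurable]: "h \<in> borel_measurable M"
    using indep_var_rv2[OF ind[of fst]] by auto
  have [measurable]: "y' \<in> borel_measurable M"
    by (subst measurable_cong[OF y']) measurable
  \<comment> \<open>On \<open>Bd\<close> the chain moves to \<open>b * y + h\<close>, so the
    expansion about \<open>y\<close> does not apply there. \<open>G\<close> switches the correction
    off on that set; being a function of \<open>y\<close>, it does not disturb the vanishing
    mean.\<close>
  define G where "G x = 1 - indicat_real Bd x" for x
  have [measurable]: "G \<in> borel_measurable borel" unfolding G_def[abs_def] by measurable
  have G01: "\<bar>G x\<bar> \<le> 1" for x by (auto simp: G_def indicator_def)
  define e where "e x = exp (- mu / n * x\<^sup>2)" for x
  have [measurable]: "e \<in> borel_measurable borel" unfolding e_def[abs_def] by measurable
  have e01: "0 \<le> e x" "e x \<le> 1" for x using mu by (auto simp: e_def)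
  define F1 where "F1 z = fst z * G (snd z) * e (snd z) * gauss1 a (snd z)" for z :: "real \<times> real"
  define F2 where "F2 z = fst z * G (snd z) * e (snd z) * (gauss2 a (snd z) / 2)" for z :: "real \<times> real"
  have Fm [measurable]: "F1 \<in> borel_measurable (borel \<Otimes>\<^sub>M borel)" "F2 \<in> borel_measurable (borel \<Otimes>\<^sub>M borel)"
    unfolding F1_def[abs_def] F2_def[abs_def] by measurable
  have WGe: "\<bar>W \<omega> * G (y \<omega>) * e (y \<omega>)\<bar> \<le> 1" if "\<omega> \<in> space M" for \<omega>
    using W[OF that] G01[of "y \<omega>"] e01[of "y \<omega>"] by (auto simp: abs_mult intro!: mult_le_one)
  have F1b: "\<bar>F1 (W \<omega>, y \<omega>)\<bar> \<le> 1 * (2 * L)" if "\<omega> \<in> space M" for \<omega>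
    unfolding F1_def fst_conv snd_conv abs_mult[of _ "gauss1 _ _"]
    by (intro mult_mono WGe that gauss_bounds a L) auto
  have F2b: "\<bar>F2 (W \<omega>, y \<omega>)\<bar> \<le> 1 * (3 * L)" if "\<omega> \<in> space M" for \<omega>
    unfolding F2_def fst_conv snd_conv abs_mult[of _ "gauss2 _ _ / 2"]
    using gauss_bounds(2)[OF a L, of "y \<omega>"] by (intro mult_mono WGe that) auto
  have iF: "integrable M (\<lambda>\<omega>. F1 (W \<omega>, y \<omega>))" "integrable M (\<lambda>\<omega>. F2 (W \<omega>, y \<omega>))"
    using F1b F2b by (auto intro!: integrable_const_bound[of _ "3 * L"] AE_I2) (smt (verit) L)
  have ih: "integrable M h" by (rule integrable_of_square[OF hm h2])
  have ih2: "integrable M (\<lambda>\<omega>. (h \<omega>)\<^sup>2 - 1 / n)" using h2 by simp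
  note P1 = expectation_indep_mult[OF ind[OF Fm(1)] measurable_ident iF(1), unfolded id_def, OF ih]
  note P2 = expectation_indep_mult[OF ind[OF Fm(2)] _ iF(2) ih2]
  have EP1: "expectation (\<lambda>\<omega>. F1 (W \<omega>, y \<omega>) * h \<omega>) = 0" and iP1: "integrable M (\<lambda>\<omega>. F1 (W \<omega>, y \<omega>) * h \<omega>)"
    using P1 Eh by simp_all
  have EP2: "expectation (\<lambda>\<omega>. F2 (W \<omega>, y \<omega>) * ((h \<omega>)\<^sup>2 - 1 / n)) = 0"
    using P2(2) h2 Eh2 by (simp add: prob_space)
  have iP2: "integrable M (\<lambda>\<omega>. F2 (W \<omega>, y \<omega>) * ((h \<omega>)\<^sup>2 - 1 / n))"
    by (rule P2(1)) simp
  \<comment> \<open>\<open>P\<close> has expectation 0. It has to be subtracted before absolute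
    values are taken, since its own size is that of \<open>h\<close> and not of smaller order than
    1/n.\<close>
  define P where "P \<omega> = F1 (W \<omega>, y \<omega>) * h \<omega> + F2 (W \<omega>, y \<omega>) * ((h \<omega>)\<^sup>2 - 1 / n)" for \<omega>
  have iP: "integrable M P" and EP: "expectation P = 0"
    unfolding P_def[abs_def] using iP1 iP2 EP1 EP2 by auto
  let ?i = "\<lambda>\<omega>. indicat_real Bd (y \<omega>)"
  have iB: "integrable M (\<lambda>\<omega>. ?i \<omega> * (y \<omega>)\<^sup>2)"
    by (rule Bochner_Integration.integrable_bound[OF y2]) (auto simp: indicator_def)
  have iB0: "integrable M (\<lambda>\<omega>. ?i \<omega>)"
    by (auto intro!: integrable_const_bound[of _ 1])
  \<comment> \<open>By independence \<open>h\<^sup>2\<close> counts as 1/n on \<open>Bd\<close> as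
    well. The two terms with 1/n are merged below, which turns the factor 2 into 4.\<close>
  have EB: "expectation (\<lambda>\<omega>. ?i \<omega> * (h \<omega>)\<^sup>2) = expectation (\<lambda>\<omega>. ?i \<omega>) * (1 / n)"
    and iBh: "integrable M (\<lambda>\<omega>. ?i \<omega> * (h \<omega>)\<^sup>2)"
    using expectation_indep_mult[OF ind[of "\<lambda>z. indicat_real Bd (snd z)"] _ _ h2] iB0 Eh2 by simp_all
  have imin: "integrable M (\<lambda>\<omega>. min ((h \<omega>)\<^sup>2) (\<bar>h \<omega>\<bar> ^ 3))"
    by (rule Bochner_Integration.integrable_bound[OF h2]) auto
  let ?X = "\<lambda>\<omega>. W \<omega> * exp (- mu / n * (y \<omega>)\<^sup>2) * exp (- a * (y' \<omega>)\<^sup>2)"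
  let ?Z = "\<lambda>\<omega>. W \<omega> * exp (- a' * (y \<omega>)\<^sup>2 - a / n)"
  have iX: "integrable M ?X"
    using W a mu by (auto intro!: integrable_const_bound[of _ 1] AE_I2 mult_le_one simp: abs_mult)
  have "- (a' * x\<^sup>2) \<le> a / n" for x
    using a'(2) a(1) by (smt (verit) divide_nonneg_nonneg mult_nonneg_nonneg of_nat_0_le_iff zero_le_power2)
  then have iZ: "integrable M ?Z"
    using W by (auto intro!: integrable_const_bound[of _ 1] AE_I2 mult_le_one simp: abs_mult)
  let ?B = "\<lambda>\<omega>. 66 * L\<^sup>2 * (min ((h \<omega>)\<^sup>2) (\<bar>h \<omega>\<bar> ^ 3) + 1 / (real n)\<^sup>2)
      + 2 * L * (1 + b\<^sup>2) * (?i \<omega> * (y \<omega>)\<^sup>2 + ?i \<omega> * (h \<omega>)\<^sup>2 + ?i \<omega> * (1 / n))"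
  have pw: "\<bar>?X \<omega> - ?Z \<omega> - P \<omega>\<bar> \<le> ?B \<omega>" if w: "\<omega> \<in> space M" for \<omega>
  proof (cases "y \<omega> \<in> Bd")
    case False
    let ?u = "exp (- mu / n * (y \<omega>)\<^sup>2) * exp (- a * (y \<omega> + h \<omega>)\<^sup>2)
      - exp (- (a - 2 * a\<^sup>2 / n + mu / n) * (y \<omega>)\<^sup>2 - a / n)
      - exp (- mu / n * (y \<omega>)\<^sup>2) * (gauss1 a (y \<omega>) * h \<omega> + gauss2 a (y \<omega>) / 2 * ((h \<omega>)\<^sup>2 - 1 / n))"
    have "P \<omega> = W \<omega> * (e (y \<omega>) * (gauss1 a (y \<omega>) * h \<omega> + gauss2 a (y \<omega>) / 2 * ((h \<omega>)\<^sup>2 - 1 / n)))"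
      using False unfolding P_def F1_def F2_def G_def by (simp only: fst_conv snd_conv distrib_left mult.assoc) simp
    then have "?X \<omega> - ?Z \<omega> - P \<omega> = W \<omega> * ?u"
      using y'[OF w] False unfolding e_def a'(1) by (simp only: right_diff_distrib mult.assoc if_False)
    then have "\<bar>?X \<omega> - ?Z \<omega> - P \<omega>\<bar> = W \<omega> * \<bar>?u\<bar>"
      using W[OF w] by (simp only: abs_mult) simp
    also have "\<dots> \<le> 1 * (66 * L\<^sup>2 * (min ((h \<omega>)\<^sup>2) (\<bar>h \<omega>\<bar> ^ 3) + 1 / (real n)\<^sup>2))"
      using W[OF w] by (intro mult_mono gaussian_step_error a mu n L) auto
    finally show ?thesis using False by simp
  next
    case True
    let ?u = "exp (- mu / n * (y \<omega>)\<^sup>2) * exp (- a * (b * y \<omega> + h \<omega>)\<^sup>2)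
      - exp (- a' * (y \<omega>)\<^sup>2 - a / n)"
    have "?X \<omega> - ?Z \<omega> - P \<omega> = W \<omega> * ?u"
      using y'[OF w] True unfolding P_def F1_def F2_def G_def by (simp add: algebra_simps)
    then have "\<bar>?X \<omega> - ?Z \<omega> - P \<omega>\<bar> = W \<omega> * \<bar>?u\<bar>"
      using W[OF w] by (simp only: abs_mult) simp
    also have "\<dots> \<le> 1 * (2 * L * (1 + b\<^sup>2) * ((y \<omega>)\<^sup>2 + (h \<omega>)\<^sup>2 + 1 / n))"
      using W[OF w] by (intro mult_mono reflected_step_error a a' mu n1) auto
    also have "\<dots> \<le> ?B \<omega>" using True by simp
    finally show ?thesis .
  qed
  have iBall: "integrable M ?B"
    using imin iB iBh iB0 by (intro Bochner_Integration.integrable_add integrable_mult_right) auto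
  have "\<bar>expectation ?X - expectation ?Z\<bar> = \<bar>expectation (\<lambda>\<omega>. ?X \<omega> - ?Z \<omega> - P \<omega>)\<bar>"
    using iX iZ iP EP by simp
  also have "\<dots> \<le> expectation (\<lambda>\<omega>. \<bar>?X \<omega> - ?Z \<omega> - P \<omega>\<bar>)"
    by (rule integral_abs_bound)
  also have "\<dots> \<le> expectation ?B"
    using iX iZ iP iBall pw by (intro integral_mono) auto
  also have "\<dots> = 66 * L\<^sup>2 * (expectation (\<lambda>\<omega>. min ((h \<omega>)\<^sup>2) (\<bar>h \<omega>\<bar> ^ 3)) + 1 / (real n)\<^sup>2)
      + 2 * L * (1 + b\<^sup>2) * (expectation (\<lambda>\<omega>. ?i \<omega> * (y \<omega>)\<^sup>2)
         + expectation (\<lambda>\<omega>. ?i \<omega>) * (1/n) + expectation (\<lambda>\<omega>. ?i \<omega>) * (1 / n))"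
    using imin iB iBh iB0 EB by (simp add: prob_space)
  also have "\<dots> \<le> 66 * L\<^sup>2 * (eta + 1 / (real n)\<^sup>2)
      + 4 * L * (1 + b\<^sup>2) * (expectation (\<lambda>\<omega>. ?i \<omega> * (y \<omega>)\<^sup>2) + expectation (\<lambda>\<omega>. ?i \<omega>) * (1 / n))"
  proof (intro add_mono mult_left_mono)
    let ?u = "expectation (\<lambda>\<omega>. ?i \<omega> * (y \<omega>)\<^sup>2)" and ?v = "expectation (\<lambda>\<omega>. ?i \<omega>) * (1 / n)"
    have "?u \<ge> 0" by (intro Bochner_Integration.integral_nonneg) (auto simp: indicator_def)
    then have "2 * L * (1 + b\<^sup>2) * (?u + ?v + ?v) \<le> 2 * L * (1 + b\<^sup>2) * (2 * (?u + ?v))"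
      using L by (intro mult_left_mono) auto
    also have "\<dots> = 4 * L * (1 + b\<^sup>2) * (?u + ?v)" by simp
    finally show "2 * L * (1 + b\<^sup>2) * (?u + ?v + ?v) \<le> 4 * L * (1 + b\<^sup>2) * (?u + ?v)" .
  qed (use eta in auto)
  also have "expectation (\<lambda>\<omega>. ?i \<omega> * (y \<omega>)\<^sup>2) + expectation (\<lambda>\<omega>. ?i \<omega>) * (1 / n)
    = expectation (\<lambda>\<omega>. ?i \<omega> * ((y \<omega>)\<^sup>2 + 1 / n))"
    using iB iB0 by (simp add: distrib_left)
  finally show ?thesis .
qed


text \<open>The future after time \<open>t\<close> is replaced by its Gaussian value, and the
  changes are telescoped over \<open>t\<close>. The chain is abstract because it serves twice: for
  the rescaled autoregression, with \<open>Bd\<close> the half-line below the rescaled threshold,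
  and for Brownian motion on a grid, with \<open>Bd\<close> empty.\<close>

theorem (in prob_space) laplace_quadratic_functional_error:
  fixes y h :: "nat \<Rightarrow> 'a \<Rightarrow> real" and Bd :: "real set"
  assumes ind: "\<And>t f. t < n \<Longrightarrow> f \<in> borel_measurable (Pi\<^sub>M {..t} (\<lambda>_. borel)) \<Longrightarrow>
      indep_var borel (\<lambda>\<omega>. f (\<lambda>i\<in>{..t}. y i \<omega>)) borel (h t)"
    and Bd: "Bd \<in> sets borel"
    and ym [measurable]: "\<And>t. t \<le> n \<Longrightarrow> y t \<in> borel_measurable M"
    and y2: "\<And>t. t < n \<Longrightarrow> integrable M (\<lambda>\<omega>. (y t \<omega>)\<^sup>2)"
    and h2: "\<And>t. t < n \<Longrightarrow> integrable M (\<lambda>\<omega>. (h t \<omega>)\<^sup>2)"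
    and Eh: "\<And>t. t < n \<Longrightarrow> expectation (h t) = 0"
    and Eh2: "\<And>t. t < n \<Longrightarrow> expectation (\<lambda>\<omega>. (h t \<omega>)\<^sup>2) = 1 / n"
    and eta: "\<And>t. t < n \<Longrightarrow> expectation (\<lambda>\<omega>. min ((h t \<omega>)\<^sup>2) (\<bar>h t \<omega>\<bar> ^ 3)) \<le> eta"
    and ystep: "\<And>t \<omega>. t < n \<Longrightarrow> \<omega> \<in> space M \<Longrightarrow>
      y (Suc t) \<omega> = (if y t \<omega> \<in> Bd then b * y t \<omega> else y t \<omega>) + h t \<omega>"
    and lam: "0 \<le> lam" and mu: "0 \<le> mu" and L: "L = lam + mu + 1" and n: "real n \<ge> 4 * L"
  shows "\<bar>expectation (\<lambda>\<omega>. exp (- lam * (y n \<omega>)\<^sup>2 - mu / n * (\<Sum>t<n. (y t \<omega>)\<^sup>2))) - exp (- riccati_sum lam mu n n)\<bar>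
    \<le> L * expectation (\<lambda>\<omega>. (y 0 \<omega>)\<^sup>2) + 66 * L\<^sup>2 * (n * eta + 1 / n)
      + 4 * L * (1 + b\<^sup>2) * (\<Sum>t<n. expectation (\<lambda>\<omega>. indicat_real Bd (y t \<omega>) * ((y t \<omega>)\<^sup>2 + 1 / n)))"
proof -
  have L1: "L \<ge> 1" and nL: "real n \<ge> 2 * (lam + mu)" and n1: "n \<ge> 1"
    using L lam mu n by auto
  define A where "A = riccati lam mu n"
  define Bs where "Bs = riccati_sum lam mu n"
  have A: "0 \<le> A k" "A k \<le> L" if "k \<le> n" for k
    using riccati_bounds[OF lam mu nL n1 that] by (auto simp: A_def L)
  have Bs: "0 \<le> Bs k" if "k \<le> n" for k
    using riccati_sum_nonneg[OF lam mu nL n1 that] by (simp add: Bs_def)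
  define W where "W t \<omega> = exp (- mu / n * (\<Sum>s<t. (y s \<omega>)\<^sup>2))" for t \<omega>
  \<comment> \<open>\<open>Q n\<close> is the transform itself and \<open>Q 0\<close> involves only
    the initial value. The exponents are indexed by the number \<open>n - t\<close> of steps still
    to go.\<close>
  define Q where "Q t = expectation (\<lambda>\<omega>. W t \<omega> * exp (- A (n - t) * (y t \<omega>)\<^sup>2 - Bs (n - t)))" for t
  define d where "d t = 66 * L\<^sup>2 * (eta + 1 / (real n)\<^sup>2)
      + 4 * L * (1 + b\<^sup>2) * expectation (\<lambda>\<omega>. indicat_real Bd (y t \<omega>) * ((y t \<omega>)\<^sup>2 + 1 / n))" for t
  have step: "\<bar>Q (Suc t) - Q t\<bar> \<le> d t" if t: "t < n" for t
  proof -
    define k where "k = n - Suc t"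
    have k: "n - t = Suc k" "n - Suc t = k" "Suc k \<le> n" using t by (auto simp: k_def)
    let ?U = "expectation (\<lambda>\<omega>. W t \<omega> * exp (- mu / n * (y t \<omega>)\<^sup>2) * exp (- A k * (y (Suc t) \<omega>)\<^sup>2))"
    let ?V = "expectation (\<lambda>\<omega>. W t \<omega> * exp (- A (Suc k) * (y t \<omega>)\<^sup>2 - A k / n))"
    have "\<bar>?U
      - ?V\<bar> \<le> d t"
      unfolding d_def
    proof (rule laplace_one_step[where h = "h t" and Bd = Bd])
      fix f :: "real \<times> real \<Rightarrow> real" assume [measurable]: "f \<in> borel_measurable (borel \<Otimes>\<^sub>M borel)"
      have "(\<lambda>p. f (exp (- mu / n * (\<Sum>s<t. (p s)\<^sup>2)), p t)) \<in> borel_measurable (Pi\<^sub>M {..t} (\<lambda>_. borel))"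
        by measurable
      from ind[OF t this] show "indep_var borel (\<lambda>\<omega>. f (W t \<omega>, y t \<omega>)) borel (h t)"
        by (simp add: W_def)
    next
      show "0 \<le> W t \<omega> \<and> W t \<omega> \<le> 1" for \<omega>
        using mu by (auto simp: W_def intro!: mult_nonneg_nonneg sum_nonneg divide_nonneg_nonneg)
      show "y (Suc t) \<omega> = (if y t \<omega> \<in> Bd then b * y t \<omega> else y t \<omega>) + h t \<omega>" if "\<omega> \<in> space M" for \<omega>
        by (rule ystep[OF t that])
      show "A (Suc k) = A k - 2 * (A k)\<^sup>2 / n + mu / n" by (simp add: A_def)
      show "0 \<le> A k" "A k \<le> L" "0 \<le> A (Suc k)" "A (Suc k) \<le> L" using k A by auto
      show "mu \<le> L" using lam L by simp
    qed (fact Bd mu L1 n y2[OF t] h2[OF t] Eh[OF t] Eh2[OF t] eta[OF t])+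
    moreover have "Q (Suc t) = exp (- Bs k) * ?U"
      unfolding Q_def k W_def
      by (subst integral_mult_right_zero[symmetric], intro Bochner_Integration.integral_cong)
        (simp_all add: mult_exp_exp algebra_simps)
    moreover have "Q t = exp (- Bs k) * ?V"
    proof -
      have "Bs (Suc k) = Bs k + A k / n" by (simp add: Bs_def A_def riccati_sum_def)
      then show ?thesis unfolding Q_def k W_def
        by (subst integral_mult_right_zero[symmetric], intro Bochner_Integration.integral_cong)
          (simp_all add: mult_exp_exp algebra_simps)
    qed
    ultimately have "\<bar>Q (Suc t) - Q t\<bar> = exp (- Bs k) * \<bar>?U
      - ?V\<bar>" 
      by (simp only: right_diff_distrib[symmetric] abs_mult) simp
    also have "\<dots> \<le> 1 * d t"
      using Bs[of k] k \<open>_ \<le> d t\<close> by (intro mult_mono) auto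
    finally show ?thesis by simp
  qed
  have "\<bar>Q n - Q 0\<bar> = \<bar>\<Sum>t<n. Q (Suc t) - Q t\<bar>"
    by (simp add: sum_lessThan_telescope)
  also have "\<dots> \<le> (\<Sum>t<n. d t)"
    by (rule order_trans[OF sum_abs]) (intro sum_mono step, simp)
  also have "\<dots> = n * (66 * L\<^sup>2 * (eta + 1 / (real n)\<^sup>2)) + 4 * L * (1 + b\<^sup>2) * (\<Sum>t<n. expectation (\<lambda>\<omega>. indicat_real Bd (y t \<omega>) * ((y t \<omega>)\<^sup>2 + 1 / n)))"
    unfolding d_def by (simp add: sum.distrib sum_distrib_left)
  also have "n * (66 * L\<^sup>2 * (eta + 1 / (real n)\<^sup>2)) = 66 * L\<^sup>2 * (n * eta + 1 / n)"
    using n1 by (simp add: field_simps power2_eq_square)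
  finally have 1: "\<bar>Q n - Q 0\<bar> \<le> 66 * L\<^sup>2 * (n * eta + 1 / n) + 4 * L * (1 + b\<^sup>2) * (\<Sum>t<n. expectation (\<lambda>\<omega>. indicat_real Bd (y t \<omega>) * ((y t \<omega>)\<^sup>2 + 1 / n)))" .
  have Qn: "Q n = expectation (\<lambda>\<omega>. exp (- lam * (y n \<omega>)\<^sup>2 - mu / n * (\<Sum>t<n. (y t \<omega>)\<^sup>2)))"
    unfolding Q_def W_def by (simp add: A_def Bs_def riccati_sum_def mult_exp_exp algebra_simps)
  \<comment> \<open>The chain need not start at 0: for the autoregression \<open>y 0\<close> is Y0
    divided by sqrt (n var). The Lipschitz bound for the exponential turns this into the term with
    \<open>(y 0 \<omega>)\<^sup>2\<close>.\<close>
  have Q0: "\<bar>Q 0 - exp (- Bs n)\<bar> \<le> L * expectation (\<lambda>\<omega>. (y 0 \<omega>)\<^sup>2)"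
  proof -
    have i0: "integrable M (\<lambda>\<omega>. exp (- A n * (y 0 \<omega>)\<^sup>2 - Bs n))"
      using A[of n] Bs[of n] by (auto intro!: integrable_const_bound[of _ 1] AE_I2 simp: add_nonneg_nonneg diff_le_eq)
         (smt (verit) mult_nonneg_nonneg zero_le_power2)
    have "\<bar>Q 0 - exp (- Bs n)\<bar> = \<bar>expectation (\<lambda>\<omega>. exp (- A n * (y 0 \<omega>)\<^sup>2 - Bs n) - exp (- Bs n))\<bar>"
      using i0 by (simp add: Q_def W_def prob_space)
    also have "\<dots> \<le> expectation (\<lambda>\<omega>. \<bar>exp (- A n * (y 0 \<omega>)\<^sup>2 - Bs n) - exp (- Bs n)\<bar>)"
      by (rule integral_abs_bound)
    also have "\<dots> \<le> expectation (\<lambda>\<omega>. L * (y 0 \<omega>)\<^sup>2)"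
    proof (intro integral_mono)
      show "integrable M (\<lambda>\<omega>. \<bar>exp (- A n * (y 0 \<omega>)\<^sup>2 - Bs n) - exp (- Bs n)\<bar>)" using i0 by simp
      show "integrable M (\<lambda>\<omega>. L * (y 0 \<omega>)\<^sup>2)" using y2[of 0] n1 by simp
      fix \<omega> assume "\<omega> \<in> space M"
      have "\<bar>exp (- (A n * (y 0 \<omega>)\<^sup>2 + Bs n)) - exp (- Bs n)\<bar> \<le> \<bar>A n * (y 0 \<omega>)\<^sup>2 + Bs n - Bs n\<bar>"
        using A[of n] Bs[of n] by (intro exp_minus_diff_le) auto
      also have "\<dots> \<le> L * (y 0 \<omega>)\<^sup>2"
        using A[of n] by (simp add: mult_right_mono)
      finally show "\<bar>exp (- A n * (y 0 \<omega>)\<^sup>2 - Bs n) - exp (- Bs n)\<bar> \<le> L * (y 0 \<omega>)\<^sup>2" by simp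
    qed
    finally show ?thesis by simp
  qed
  show ?thesis using 1 Q0 unfolding Qn Bs_def by linarith
qed

section \<open>Weak convergence from mixed moments\<close>

text \<open>There is no closure rule for products: an induction then meets only monomials and sums,
  the two cases in which convergence of mixed moments passes to expectations. Products are handled
  once, by \<open>bipoly_mult\<close>.\<close>

inductive bipoly :: "(real \<times> real \<Rightarrow> real) \<Rightarrow> bool" where
  monom: "bipoly (\<lambda>z. c * (fst z ^ i * snd z ^ j))"
| add: "bipoly f \<Longrightarrow> bipoly g \<Longrightarrow> bipoly (\<lambda>z. f z + g z)"

lemma bipoly_monom_mult: "bipoly g \<Longrightarrow> bipoly (\<lambda>z. c * (fst z ^ i * snd z ^ j) * g z)"
proof (induction rule: bipoly.induct)
  case (monom d k l)
  have "(\<lambda>z::real \<times> real. c * (fst z ^ i * snd z ^ j) * (d * (fst z ^ k * snd z ^ l)))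
     = (\<lambda>z. (c * d) * (fst z ^ (i + k) * snd z ^ (j + l)))"
    by (simp add: fun_eq_iff power_add mult_ac)
  then show ?case by (simp only: bipoly.monom)
next
  case (add f g)
  then show ?case by (simp add: distrib_left bipoly.add)
qed

lemma bipoly_mult: "bipoly f \<Longrightarrow> bipoly g \<Longrightarrow> bipoly (\<lambda>z. f z * g z)"
proof (induction rule: bipoly.induct)
  case (monom c i j)
  then show ?case by (rule bipoly_monom_mult)
next
  case (add f1 f2)
  then show ?case by (simp add: distrib_right bipoly.add)
qed

lemma real_polynomial_function_imp_bipoly:
  fixes f :: "real \<times> real \<Rightarrow> real"
  shows "real_polynomial_function f \<Longrightarrow> bipoly f"
proof (induction rule: real_polynomial_function.induct)
  case (linear f)
  interpret bounded_linear f by fact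
  have expand: "f z = f (1, 0) * (fst z ^ 1 * snd z ^ 0) + f (0, 1) * (fst z ^ 0 * snd z ^ 1)" for z
  proof -
    have "f z = f (fst z *\<^sub>R (1, 0) + snd z *\<^sub>R (0, 1))" by (cases z) simp
    also have "\<dots> = fst z * f (1, 0) + snd z * f (0, 1)" by (simp only: add scaleR) simp
    finally show ?thesis by simp
  qed
  have eq: "(\<lambda>z. f (1, 0) * (fst z ^ 1 * snd z ^ 0) + f (0, 1) * (fst z ^ 0 * snd z ^ 1)) = f"
    by (rule ext) (rule expand[symmetric])
  have "bipoly (\<lambda>z. f (1, 0) * (fst z ^ 1 * snd z ^ 0) + f (0, 1) * (fst z ^ 0 * snd z ^ 1))"
    by (intro bipoly.add bipoly.monom)
  then show ?case unfolding eq .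
next
  case (const c)
  show ?case using bipoly.monom[of c 0 0] by simp
qed (auto intro: bipoly.add bipoly_mult)

lemma bipoly_continuous_on: "bipoly f \<Longrightarrow> continuous_on UNIV f"
  by (induction rule: bipoly.induct) (auto intro!: continuous_intros)

lemma (in prob_space) integrable_continuous_unit_square:
  fixes F :: "real \<times> real \<Rightarrow> real"
  assumes [measurable]: "p \<in> borel_measurable M" "q \<in> borel_measurable M"
    and pq: "\<And>\<omega>. \<omega> \<in> space M \<Longrightarrow> (p \<omega>, q \<omega>) \<in> {0..1} \<times> {0..1}"
    and F: "continuous_on UNIV F"
  shows "integrable M (\<lambda>\<omega>. F (p \<omega>, q \<omega>))"
proof -
  have [measurable]: "F \<in> borel_measurable (borel \<Otimes>\<^sub>M borel)"
    using borel_measurable_continuous_onI[OF F] by (simp add: borel_prod)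
  have "compact (F ` ({0..1} \<times> {0..1}))"
    by (intro compact_continuous_image continuous_on_subset[OF F] compact_Times) auto
  then obtain C where "\<And>z. z \<in> {0..1} \<times> {0..1} \<Longrightarrow> \<bar>F z\<bar> \<le> C"
    by (metis bounded_real compact_imp_bounded imageI)
  then show ?thesis
    using pq by (intro integrable_const_bound[of _ C]) auto
qed

lemma (in prob_space) expectation_diff_le:
  fixes X X' :: "'a \<Rightarrow> real"
  assumes "integrable M X" "integrable M X'" "\<And>\<omega>. \<omega> \<in> space M \<Longrightarrow> \<bar>X \<omega> - X' \<omega>\<bar> \<le> e"
  shows "\<bar>expectation X - expectation X'\<bar> \<le> e"
proof -
  have "\<bar>expectation X - expectation X'\<bar> = \<bar>expectation (\<lambda>\<omega>. X \<omega> - X' \<omega>)\<bar>" using assms by simp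
  also have "\<dots> \<le> expectation (\<lambda>\<omega>. \<bar>X \<omega> - X' \<omega>\<bar>)" by (rule integral_abs_bound)
  also have "\<dots> \<le> expectation (\<lambda>\<omega>. e)" using assms by (intro integral_mono) auto
  finally show ?thesis by (simp add: prob_space)
qed

text \<open>Stone-Weierstrass supplies a polynomial within r/3 of \<open>F\<close> on the whole
  compact square, so the error of the replacement does not depend on \<open>n\<close>, and for the
  polynomial the convergence is that of finitely many mixed moments.\<close>

lemma moments_imp_continuous_conv:
  fixes p q :: "nat \<Rightarrow> 'a \<Rightarrow> real" and P Q :: "'b \<Rightarrow> real" and F :: "real \<times> real \<Rightarrow> real"
  assumes "prob_space M" "prob_space N"
    and [measurable]: "\<And>n. p n \<in> borel_measurable M" "\<And>n. q n \<in> borel_measurable M"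
      "P \<in> borel_measurable N" "Q \<in> borel_measurable N"
    and pq: "\<And>n \<omega>. \<omega> \<in> space M \<Longrightarrow> (p n \<omega>, q n \<omega>) \<in> {0..1} \<times> {0..1}"
    and PQ: "\<And>\<omega>. \<omega> \<in> space N \<Longrightarrow> (P \<omega>, Q \<omega>) \<in> {0..1} \<times> {0..1}"
    and conv: "\<And>i j. (\<lambda>n. \<integral>\<omega>. p n \<omega> ^ i * q n \<omega> ^ j \<partial>M) \<longlonglongrightarrow> (\<integral>\<omega>. P \<omega> ^ i * Q \<omega> ^ j \<partial>N)"
    and F: "continuous_on UNIV F"
  shows "(\<lambda>n. \<integral>\<omega>. F (p n \<omega>, q n \<omega>) \<partial>M) \<longlonglongrightarrow> (\<integral>\<omega>. F (P \<omega>, Q \<omega>) \<partial>N)"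
proof -
  interpret M: prob_space M by fact
  interpret N: prob_space N by fact
  have iM: "integrable M (\<lambda>\<omega>. G (p n \<omega>, q n \<omega>))" if "continuous_on UNIV G" for G :: "real \<times> real \<Rightarrow> real" and n
    using that pq by (intro M.integrable_continuous_unit_square) auto
  have iN: "integrable N (\<lambda>\<omega>. G (P \<omega>, Q \<omega>))" if "continuous_on UNIV G" for G :: "real \<times> real \<Rightarrow> real"
    using that PQ by (intro N.integrable_continuous_unit_square) auto
  have poly: "(\<lambda>n. \<integral>\<omega>. G (p n \<omega>, q n \<omega>) \<partial>M) \<longlonglongrightarrow> (\<integral>\<omega>. G (P \<omega>, Q \<omega>) \<partial>N)" if "bipoly G" for G
    using that
  proof (induction rule: bipoly.induct)
    case (monom c i j)
    then show ?case by (simp add: tendsto_mult_left[OF conv])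
  next
    case (add f g)
    then show ?case
      using iM[OF bipoly_continuous_on[OF add(1)]] iM[OF bipoly_continuous_on[OF add(2)]]
        iN[OF bipoly_continuous_on[OF add(1)]] iN[OF bipoly_continuous_on[OF add(2)]]
      by (simp add: tendsto_add)
  qed
  show ?thesis
  proof (rule LIMSEQ_I)
    fix r :: real assume r: "r > 0"
    obtain G where G: "real_polynomial_function G" "\<And>z. z \<in> {0..1} \<times> {0..1} \<Longrightarrow> \<bar>F z - G z\<bar> < r / 3"
      using Stone_Weierstrass_real_polynomial_function[of "{0..1} \<times> {0..1} :: (real \<times> real) set" F "r / 3"]
        continuous_on_subset[OF F] r by (auto intro: compact_Times)
    have bG: "bipoly G" by (rule real_polynomial_function_imp_bipoly[OF G(1)])
    note cG = bipoly_continuous_on[OF bG]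
    have dM: "\<bar>(\<integral>\<omega>. F (p n \<omega>, q n \<omega>) \<partial>M) - (\<integral>\<omega>. G (p n \<omega>, q n \<omega>) \<partial>M)\<bar> \<le> r / 3" for n
      by (rule M.expectation_diff_le[OF iM[OF F] iM[OF cG] less_imp_le[OF G(2)[OF pq]]])
    have dN: "\<bar>(\<integral>\<omega>. F (P \<omega>, Q \<omega>) \<partial>N) - (\<integral>\<omega>. G (P \<omega>, Q \<omega>) \<partial>N)\<bar> \<le> r / 3"
      by (rule N.expectation_diff_le[OF iN[OF F] iN[OF cG] less_imp_le[OF G(2)[OF PQ]]])
    obtain m where m: "\<And>n. n \<ge> m \<Longrightarrow> \<bar>(\<integral>\<omega>. G (p n \<omega>, q n \<omega>) \<partial>M) - (\<integral>\<omega>. G (P \<omega>, Q \<omega>) \<partial>N)\<bar> < r / 3"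
      using LIMSEQ_D[OF poly[OF bG], of "r / 3"] r unfolding real_norm_def by (meson divide_pos_pos zero_less_numeral)
    show "\<exists>no. \<forall>n\<ge>no. norm ((\<integral>\<omega>. F (p n \<omega>, q n \<omega>) \<partial>M) - (\<integral>\<omega>. F (P \<omega>, Q \<omega>) \<partial>N)) < r"
    proof (intro exI[of _ m] allI impI)
      fix n assume "n \<ge> m"
      from m[OF this] dM[of n] dN
      show "norm ((\<integral>\<omega>. F (p n \<omega>, q n \<omega>) \<partial>M) - (\<integral>\<omega>. F (P \<omega>, Q \<omega>) \<partial>N)) < r"
        unfolding real_norm_def by linarith
    qed
  qed
qed

text \<open>A piecewise linear cutoff on the line: it vanishes outside the interval from 1/k to 1 -
  1/k and equals 1 between 2/k and 1 - 2/k. A product of two such functions cuts off the boundary of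
  the unit square.\<close>

definition tent :: "nat \<Rightarrow> real \<Rightarrow> real" where
  "tent k x = max 0 (min 1 (min (real k * x - 1) (real k * (1 - x) - 1)))"

lemma tent_continuous: "continuous_on S (tent k)"
  unfolding tent_def[abs_def] by (intro continuous_intros)

lemma tent_bounds: "0 \<le> tent k x" "tent k x \<le> 1"
  by (auto simp: tent_def)

lemma tent_nonzero:
  assumes "tent k x \<noteq> 0"
  shows "0 < k" "1 / k < x" "x < 1 - 1 / k"
proof -
  have "real k * x > 1" "real k * (1 - x) > 1"
    using assms unfolding tent_def by linarith+
  moreover from this show "0 < k" by (cases "k = 0") auto
  ultimately have "1 / k < x" "1 / k < 1 - x"
    by (auto simp only: pos_divide_less_eq of_nat_0_less_iff mult.commute)
  then show "1 / k < x" "x < 1 - 1 / k" by auto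
qed

lemma tent_tendsto_1: "(\<lambda>k. tent k x) \<longlonglongrightarrow> 1" if "0 < x" "x < 1"
proof (rule tendsto_eventually)
  have "\<forall>\<^sub>F k in sequentially. real k \<ge> 2 / x" "\<forall>\<^sub>F k in sequentially. real k \<ge> 2 / (1 - x)"
    using eventually_ge_at_top[of "nat \<lceil>2 / x\<rceil>"] eventually_ge_at_top[of "nat \<lceil>2 / (1-x)\<rceil>"]
    by (auto elim!: eventually_mono)
  then show "\<forall>\<^sub>F k in sequentially. tent k x = 1"
  proof eventually_elim
    case (elim k)
    then have "real k * x \<ge> 2" "real k * (1 - x) \<ge> 2" using that by (auto simp: pos_divide_le_eq)
    then show ?case by (simp add: tent_def)
  qed
qed

lemma (in prob_space) expectation_cutoff_le:
  fixes X c :: "'a \<Rightarrow> real"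
  assumes [measurable]: "X \<in> borel_measurable M" "c \<in> borel_measurable M"
    and X: "\<And>\<omega>. \<bar>X \<omega>\<bar> \<le> 1" and c: "\<And>\<omega>. 0 \<le> c \<omega>" "\<And>\<omega>. c \<omega> \<le> 1"
  shows "\<bar>expectation X - expectation (\<lambda>\<omega>. X \<omega> * c \<omega>)\<bar> \<le> expectation (\<lambda>\<omega>. 1 - c \<omega>)"
proof -
  have iX: "integrable M X" using X by (intro integrable_const_bound[of _ 1]) auto
  have ic: "integrable M c" using c by (intro integrable_const_bound[of _ 1]) auto
  have iXc: "integrable M (\<lambda>\<omega>. X \<omega> * c \<omega>)"
    using X c by (intro integrable_const_bound[of _ 1]) (auto simp: abs_mult intro!: mult_le_one)
  have pw: "\<bar>X \<omega> - X \<omega> * c \<omega>\<bar> \<le> 1 - c \<omega>" for \<omega>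
  proof -
    have "X \<omega> - X \<omega> * c \<omega> = X \<omega> * (1 - c \<omega>)" by (simp add: right_diff_distrib)
    then have "\<bar>X \<omega> - X \<omega> * c \<omega>\<bar> = \<bar>X \<omega>\<bar> * (1 - c \<omega>)" using c by (simp add: abs_mult)
    also have "\<dots> \<le> 1 * (1 - c \<omega>)" using X c by (intro mult_right_mono) auto
    finally show ?thesis by simp
  qed
  have "\<bar>expectation X - expectation (\<lambda>\<omega>. X \<omega> * c \<omega>)\<bar> = \<bar>expectation (\<lambda>\<omega>. X \<omega> - X \<omega> * c \<omega>)\<bar>"
    using iX iXc by simp
  also have "\<dots> \<le> expectation (\<lambda>\<omega>. \<bar>X \<omega> - X \<omega> * c \<omega>\<bar>)" by (rule integral_abs_bound)
  also have "\<dots> \<le> expectation (\<lambda>\<omega>. 1 - c \<omega>)"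
    using iX iXc ic pw by (intro integral_mono) auto
  finally show ?thesis .
qed

text \<open>A continuous mapping theorem for a statistic that is a continuous function
  \<open>g\<close> only inside the square; on the boundary \<open>T n\<close> is arbitrary, which
  leaves room for default values of a quotient. The mass of \<open>(p n, q n)\<close> near the
  boundary needs no separate estimate: it is bounded by the expectation of a continuous function of
  the pair, which converges to a quantity that is small because the limit lies inside almost
  surely.\<close>

lemma weak_conv_of_moments:
  fixes p q T :: "nat \<Rightarrow> 'a \<Rightarrow> real" and P Q T' :: "'b \<Rightarrow> real" and g :: "real \<times> real \<Rightarrow> real"
  assumes M: "prob_space M" and N: "prob_space N"
    and pqm [measurable]: "\<And>n. p n \<in> borel_measurable M" "\<And>n. q n \<in> borel_measurable M"
      "P \<in> borel_measurable N" "Q \<in> borel_measurable N"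
    and [measurable]: "\<And>n. T n \<in> borel_measurable M" "T' \<in> borel_measurable N"
    and pq: "\<And>n \<omega>. \<omega> \<in> space M \<Longrightarrow> (p n \<omega>, q n \<omega>) \<in> {0..1} \<times> {0..1}"
    and PQ: "\<And>\<omega>. \<omega> \<in> space N \<Longrightarrow> (P \<omega>, Q \<omega>) \<in> {0..1} \<times> {0..1}"
    and PQ_AE: "AE \<omega> in N. 0 < P \<omega> \<and> P \<omega> < 1 \<and> 0 < Q \<omega> \<and> Q \<omega> < 1"
    and conv: "\<And>i j. (\<lambda>n. \<integral>\<omega>. p n \<omega> ^ i * q n \<omega> ^ j \<partial>M) \<longlonglongrightarrow> (\<integral>\<omega>. P \<omega> ^ i * Q \<omega> ^ j \<partial>N)"
    and g: "continuous_on ({0<..<1} \<times> {0<..<1}) g"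
    and T: "\<And>n \<omega>. \<omega> \<in> space M \<Longrightarrow> 0 < p n \<omega> \<Longrightarrow> p n \<omega> < 1 \<Longrightarrow> 0 < q n \<omega> \<Longrightarrow> q n \<omega> < 1 \<Longrightarrow> T n \<omega> = g (p n \<omega>, q n \<omega>)"
    and T': "\<And>\<omega>. \<omega> \<in> space N \<Longrightarrow> 0 < P \<omega> \<Longrightarrow> P \<omega> < 1 \<Longrightarrow> 0 < Q \<omega> \<Longrightarrow> Q \<omega> < 1 \<Longrightarrow> T' \<omega> = g (P \<omega>, Q \<omega>)"
  shows "weak_conv_m (\<lambda>n. distr M borel (T n)) (distr N borel T')"
proof -
  interpret M: prob_space M by fact
  interpret N: prob_space N by fact
  have mc: "(\<lambda>n. \<integral>\<omega>. G (p n \<omega>, q n \<omega>) \<partial>M) \<longlonglongrightarrow> (\<integral>\<omega>. G (P \<omega>, Q \<omega>) \<partial>N)"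
    if "continuous_on UNIV G" for G :: "real \<times> real \<Rightarrow> real"
    by (rule moments_imp_continuous_conv[OF M N pqm _ _ conv that]) (use pq PQ in auto)
  show ?thesis
  proof (rule integral_bdd_continuous_conv_imp_weak_conv)
    show "real_distribution (distr M borel (T n))" for n by (intro M.real_distribution_distr) simp
    show "real_distribution (distr N borel T')" by (intro N.real_distribution_distr) simp
  next
    fix f :: "real \<Rightarrow> real"
    assume fc: "\<And>x. isCont f x" and fb: "\<And>x. \<bar>f x\<bar> \<le> 1"
    have fcon: "continuous_on UNIV f" using fc by (simp add: continuous_at_imp_continuous_on)
    then have [measurable]: "f \<in> borel_measurable borel" by (rule borel_measurable_continuous_onI)
    define ch where "ch k z = tent k (fst z) * tent k (snd z)" for k and z :: "real \<times> real"
    have ch_cont: "continuous_on S (ch k)" for k S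
      unfolding ch_def[abs_def]
      by (intro continuous_intros continuous_on_compose2[OF tent_continuous[of UNIV]]) auto
    have [measurable]: "ch k \<in> borel_measurable (borel \<Otimes>\<^sub>M borel)" for k
      using borel_measurable_continuous_onI[OF ch_cont] by (simp add: borel_prod)
    have ch01: "0 \<le> ch k z" "ch k z \<le> 1" for k z
      using tent_bounds by (auto simp: ch_def intro!: mult_le_one)
    \<comment> \<open>The cutoff vanishes near the boundary, so extending
      \<open>f (g z) * ch k z\<close> by 0 gives a function continuous on the whole plane, to which
      \<open>mc\<close> applies.\<close>
    define F where "F k z = (if z \<in> {0<..<1} \<times> {0<..<1} then f (g z) * ch k z else 0)" for k z
    have F_cont: "continuous_on UNIV (F k)" for k
    proof -
      \<comment> \<open>Two open sets cover the plane: the open unit square, where \<open>g\<close>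
        is continuous, and the complement of \<open>?C\<close>, where the cutoff is 0.\<close>
      let ?C = "{1/real k..1 - 1/real k} \<times> {1/real k..1 - 1/real k}"
      have out: "ch k z = 0" if "z \<notin> ?C" for z
      proof (rule ccontr)
        assume "ch k z \<noteq> 0"
        then have "tent k (fst z) \<noteq> 0" "tent k (snd z) \<noteq> 0" by (auto simp: ch_def)
        from tent_nonzero(2,3)[OF this(1)] tent_nonzero(2,3)[OF this(2)] that show False
          by (cases z) auto
      qed
      show ?thesis
      proof (cases "k = 0")
        case True
        then have "F k = (\<lambda>_. 0)" by (simp add: F_def fun_eq_iff ch_def tent_def)
        then show ?thesis by simp
      next
        case False
        have "continuous_on ({0<..<1} \<times> {0<..<1}) (F k)"
        proof (subst continuous_on_cong[OF refl])
          show "F k z = f (g z) * ch k z" if "z \<in> {0<..<1} \<times> {0<..<1}" for z using that by (simp add: F_def)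
          show "continuous_on ({0<..<1} \<times> {0<..<1}) (\<lambda>z. f (g z) * ch k z)"
            by (intro continuous_intros continuous_on_compose2[OF fcon g] ch_cont) auto
        qed
        moreover have "continuous_on (- ?C) (F k)"
          by (subst continuous_on_cong[OF refl, of _ _ "\<lambda>_. 0"]) (auto simp: F_def out)
        moreover have "open (- ?C)" by (intro open_Compl closed_Times) auto
        moreover have "open ({0<..<1} \<times> {0<..<1} :: (real \<times> real) set)" by (intro open_Times) auto
        ultimately have "continuous_on ({0<..<1} \<times> {0<..<1} \<union> - ?C) (F k)"
          by (intro continuous_on_open_Un) auto
        moreover have "{0<..<1} \<times> {0<..<1} \<union> - ?C = (UNIV :: (real \<times> real) set)"
        proof -
          define e where "e = 1 / real k"
          have "e > 0" using False by (simp add: e_def)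
          then have "?C \<subseteq> {0<..<1} \<times> {0<..<1}" unfolding e_def[symmetric] by auto
          then show ?thesis by blast
        qed
        ultimately show ?thesis by simp
      qed
    qed
    have F_eq: "f (T n \<omega>) * ch k (p n \<omega>, q n \<omega>) = F k (p n \<omega>, q n \<omega>)" if "\<omega> \<in> space M" for k n \<omega>
    proof (cases "(p n \<omega>, q n \<omega>) \<in> {0<..<1} \<times> {0<..<1}")
      case True then show ?thesis using T[OF that, of n] by (simp add: F_def)
    next
      case False
      then have "ch k (p n \<omega>, q n \<omega>) = 0"
      proof (rule contrapos_np)
        assume "ch k (p n \<omega>, q n \<omega>) \<noteq> 0"
        then have "tent k (p n \<omega>) \<noteq> 0" "tent k (q n \<omega>) \<noteq> 0" by (auto simp: ch_def)
        note tent_nonzero(2,3)[OF this(1)] tent_nonzero(2,3)[OF this(2)]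
        moreover have "0 \<le> 1 / real k" by simp
        ultimately have "0 < p n \<omega>" "p n \<omega> < 1" "0 < q n \<omega>" "q n \<omega> < 1" by linarith+
        then show "(p n \<omega>, q n \<omega>) \<in> {0<..<1} \<times> {0<..<1}" by simp
      qed
      then show ?thesis using False by (simp only: F_def if_False)
    qed
    have F_eq': "AE \<omega> in N. f (T' \<omega>) * ch k (P \<omega>, Q \<omega>) = F k (P \<omega>, Q \<omega>)" for k
      using PQ_AE AE_space by eventually_elim (simp add: F_def T')
    have ch_lim: "(\<lambda>k. \<integral>\<omega>. 1 - ch k (P \<omega>, Q \<omega>) \<partial>N) \<longlonglongrightarrow> (\<integral>\<omega>. 0 \<partial>N)"
    proof (rule integral_dominated_convergence[where w = "\<lambda>_. 1"])
      show "AE \<omega> in N. (\<lambda>k. 1 - ch k (P \<omega>, Q \<omega>)) \<longlonglongrightarrow> 0"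
        using PQ_AE
      proof (rule AE_mp, intro AE_I2 impI)
        fix \<omega> assume "0 < P \<omega> \<and> P \<omega> < 1 \<and> 0 < Q \<omega> \<and> Q \<omega> < 1"
        then have "(\<lambda>k. 1 - ch k (P \<omega>, Q \<omega>)) \<longlonglongrightarrow> 1 - 1 * 1"
          unfolding ch_def by (intro tendsto_intros) (auto intro!: tent_tendsto_1)
        then show "(\<lambda>k. 1 - ch k (P \<omega>, Q \<omega>)) \<longlonglongrightarrow> 0" by simp
      qed
      show "AE \<omega> in N. norm (1 - ch k (P \<omega>, Q \<omega>)) \<le> 1" for k using ch01 by auto
    qed auto
    have dM: "\<bar>(\<integral>\<omega>. f (T n \<omega>) \<partial>M) - (\<integral>\<omega>. F k (p n \<omega>, q n \<omega>) \<partial>M)\<bar> \<le> (\<integral>\<omega>. 1 - ch k (p n \<omega>, q n \<omega>) \<partial>M)" for k n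
    proof -
      have "(\<integral>\<omega>. F k (p n \<omega>, q n \<omega>) \<partial>M) = (\<integral>\<omega>. f (T n \<omega>) * ch k (p n \<omega>, q n \<omega>) \<partial>M)"
        by (intro Bochner_Integration.integral_cong) (auto simp: F_eq)
      then show ?thesis
        using M.expectation_cutoff_le[of "\<lambda>\<omega>. f (T n \<omega>)" "\<lambda>\<omega>. ch k (p n \<omega>, q n \<omega>)"] fb ch01 by simp
    qed
    have dN: "\<bar>(\<integral>\<omega>. f (T' \<omega>) \<partial>N) - (\<integral>\<omega>. F k (P \<omega>, Q \<omega>) \<partial>N)\<bar> \<le> (\<integral>\<omega>. 1 - ch k (P \<omega>, Q \<omega>) \<partial>N)" for k
    proof -
      have "(\<integral>\<omega>. F k (P \<omega>, Q \<omega>) \<partial>N) = (\<integral>\<omega>. f (T' \<omega>) * ch k (P \<omega>, Q \<omega>) \<partial>N)"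
        using F_eq'[of k] borel_measurable_continuous_onI[OF F_cont[of k]]
        by (intro integral_cong_AE) (auto simp: borel_prod[symmetric])
      then show ?thesis
        using N.expectation_cutoff_le[of "\<lambda>\<omega>. f (T' \<omega>)" "\<lambda>\<omega>. ch k (P \<omega>, Q \<omega>)"] fb ch01 by simp
    qed
    have "(\<lambda>n. \<integral>\<omega>. f (T n \<omega>) \<partial>M) \<longlonglongrightarrow> (\<integral>\<omega>. f (T' \<omega>) \<partial>N)"
    proof (rule LIMSEQ_I)
      fix r :: real assume r: "r > 0"
      \<comment> \<open>The cutoff costs at most two fifths on the side of \<open>M\<close> (its
        limit and the distance to it) and one fifth on the side of \<open>N\<close>; the convergence
        of \<open>F k\<close> takes another.\<close>
      have r5: "r / 5 > 0" using r by simp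
      obtain k where "norm ((\<integral>\<omega>. 1 - ch k (P \<omega>, Q \<omega>) \<partial>N) - (\<integral>\<omega>. 0 \<partial>N)) < r / 5"
        using LIMSEQ_D[OF ch_lim r5] by blast
      then have k: "\<bar>\<integral>\<omega>. 1 - ch k (P \<omega>, Q \<omega>) \<partial>N\<bar> < r / 5" by simp
      obtain m1 where m1: "\<And>n. n \<ge> m1 \<Longrightarrow> \<bar>(\<integral>\<omega>. F k (p n \<omega>, q n \<omega>) \<partial>M) - (\<integral>\<omega>. F k (P \<omega>, Q \<omega>) \<partial>N)\<bar> < r / 5"
        using LIMSEQ_D[OF mc[OF F_cont[of k]] r5] unfolding real_norm_def by blast
      have "continuous_on UNIV (\<lambda>z. 1 - ch k z)" by (intro continuous_intros ch_cont)
      from LIMSEQ_D[OF mc[OF this] r5]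
      obtain m2 where m2: "\<And>n. n \<ge> m2 \<Longrightarrow> \<bar>(\<integral>\<omega>. 1 - ch k (p n \<omega>, q n \<omega>) \<partial>M) - (\<integral>\<omega>. 1 - ch k (P \<omega>, Q \<omega>) \<partial>N)\<bar> < r / 5"
        unfolding real_norm_def by blast
      show "\<exists>no. \<forall>n\<ge>no. norm ((\<integral>\<omega>. f (T n \<omega>) \<partial>M) - (\<integral>\<omega>. f (T' \<omega>) \<partial>N)) < r"
      proof (intro exI[of _ "max m1 m2"] allI impI)
        fix n assume "n \<ge> max m1 m2"
        then have "n \<ge> m1" "n \<ge> m2" by auto
        from m1[OF this(1)] m2[OF this(2)] dM[of n k] dN[of k] k r
        show "norm ((\<integral>\<omega>. f (T n \<omega>) \<partial>M) - (\<integral>\<omega>. f (T' \<omega>) \<partial>N)) < r"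
          unfolding real_norm_def by linarith
      qed
    qed
    then show "(\<lambda>n. integral\<^sup>L (distr M borel (T n)) f) \<longlonglongrightarrow> integral\<^sup>L (distr N borel T') f"
      by (simp add: integral_distr)
  qed
qed

section \<open>Occupation times of the threshold autoregression\<close>

text \<open>Uniform square integrability is measured by this function instead of x^2 on {x > K}: it
  is comparable at level 2K, and being nondecreasing and convex it passes through a recursion with
  convex weights.\<close>

definition excess :: "real \<Rightarrow> real \<Rightarrow> real" where
  "excess K x = (max 0 (x - K))\<^sup>2"

lemma excess_measurable [measurable]: "excess K \<in> borel_measurable borel"
  unfolding excess_def[abs_def] by measurable

lemma excess_nonneg: "0 \<le> excess K x"
  by (simp add: excess_def)

lemma excess_mono: "x \<le> y \<Longrightarrow> excess K x \<le> excess K y"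
  unfolding excess_def by (intro power_mono) auto

lemma excess_le_square: "0 \<le> K \<Longrightarrow> excess K x \<le> x\<^sup>2"
  unfolding excess_def by (cases "x \<le> K") (auto simp: max_def intro!: power_mono)

lemma excess_convex:
  assumes "0 \<le> u" "u \<le> 1"
  shows "excess K (u * x + (1 - u) * y) \<le> u * excess K x + (1 - u) * excess K y"
proof -
  let ?a = "max 0 (x - K)" and ?b = "max 0 (y - K)"
  have "u * (x - K) + (1 - u) * (y - K) \<le> u * ?a + (1 - u) * ?b"
    using assms by (intro add_mono mult_left_mono) auto
  moreover have "0 \<le> u * ?a + (1 - u) * ?b"
    using assms by (intro add_nonneg_nonneg mult_nonneg_nonneg) auto
  moreover have "u * x + (1 - u) * y - K = u * (x - K) + (1 - u) * (y - K)" by (simp add: algebra_simps)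
  ultimately have "excess K (u * x + (1 - u) * y) \<le> (u * ?a + (1 - u) * ?b)\<^sup>2"
    unfolding excess_def by (intro power_mono) auto
  also have "\<dots> = u * ?a\<^sup>2 + (1 - u) * ?b\<^sup>2 - u * (1 - u) * (?a - ?b)\<^sup>2"
    by (simp add: power2_eq_square algebra_simps)
  also have "\<dots> \<le> u * ?a\<^sup>2 + (1 - u) * ?b\<^sup>2"
    using assms by simp
  finally show ?thesis by (simp add: excess_def)
qed

lemma (in prob_space) excess_tendsto_0:
  fixes X :: "'a \<Rightarrow> real"
  assumes [measurable]: "X \<in> borel_measurable M" and "integrable M (\<lambda>\<omega>. (X \<omega>)\<^sup>2)"
  shows "(\<lambda>k. expectation (\<lambda>\<omega>. excess (real k) (X \<omega>))) \<longlonglongrightarrow> 0"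
proof -
  have "(\<lambda>k. expectation (\<lambda>\<omega>. excess (real k) (X \<omega>))) \<longlonglongrightarrow> expectation (\<lambda>\<omega>. 0)"
  proof (rule integral_dominated_convergence[OF _ _ assms(2)])
    show "AE \<omega> in M. (\<lambda>k. excess (real k) (X \<omega>)) \<longlonglongrightarrow> 0"
    proof (intro AE_I2 tendsto_eventually)
      fix \<omega>
      show "\<forall>\<^sub>F k in sequentially. excess (real k) (X \<omega>) = 0"
        using eventually_ge_at_top[of "nat \<lceil>X \<omega>\<rceil>"]
      proof eventually_elim
        case (elim k)
        then have "X \<omega> \<le> real k" by linarith
        then show ?case by (simp add: excess_def)
      qed
    qed
    show "AE \<omega> in M. norm (excess (real k) (X \<omega>)) \<le> (X \<omega>)\<^sup>2" for k
      using excess_le_square[of k] excess_nonneg by (intro AE_I2) simp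
  qed auto
  then show ?thesis by simp
qed

text \<open>Inside [-2K, 2K] the weight is bounded and the occupation indicator pays for it. Below
  -2K, at least half of - y lies above \<open>K\<close>, so y^2 is at most 4 times the excess, and 1
  <= y^2 doubles this to 8. Values above 2K exceed \<open>r\<close>, where the left side is
  0.\<close>

lemma bad_region_le:
  fixes y r K :: real
  assumes "K \<ge> 1" "2 * K \<ge> \<bar>r\<bar>"
  shows "indicat_real {..r} y * (1 + y\<^sup>2) \<le> (1 + 4 * K\<^sup>2) * indicat_real {-(2*K)..2*K} y + 8 * excess K (max 0 (- y))"
proof (cases "y \<in> {-(2*K)..2*K}")
  case True
  then have "\<bar>y\<bar> \<le> \<bar>2 * K\<bar>" using assms by auto
  then have "y\<^sup>2 \<le> (2 * K)\<^sup>2" by (simp only: abs_le_square_iff)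
  then have "indicat_real {..r} y * (1 + y\<^sup>2) \<le> 1 + 4 * K\<^sup>2"
    by (auto simp: indicator_def power_mult_distrib add_nonneg_nonneg)
  then show ?thesis using True excess_nonneg[of K "max 0 (- y)"] by simp
next
  case False
  show ?thesis
  proof (cases "y \<le> r")
    case True
    then have y: "- y > 2 * K" using False assms by auto
    then have "(- y / 2)\<^sup>2 \<le> (max 0 (max 0 (- y) - K))\<^sup>2"
      using assms by (intro power_mono) auto
    then have "y\<^sup>2 \<le> 4 * excess K (max 0 (- y))" by (simp add: excess_def power_divide)
    moreover have "1\<^sup>2 \<le> (- y)\<^sup>2" using y assms by (intro power_mono) auto
    ultimately have "1 + y\<^sup>2 \<le> 8 * excess K (max 0 (- y))" by simp
    then show ?thesis using True False by simp
  next
    case False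
    then show ?thesis by (simp add: excess_nonneg)
  qed
qed

section \<open>The Huber function: convex, of linear growth, quadratic near the origin\<close>

definition huber :: "real \<Rightarrow> real \<Rightarrow> real" where
  "huber L x = (if \<bar>x\<bar> \<le> L then x\<^sup>2 / 2 else L * \<bar>x\<bar> - L\<^sup>2 / 2)"

text \<open>This is the derivative of \<open>huber L\<close>.\<close>

definition clamp_at :: "real \<Rightarrow> real \<Rightarrow> real" where
  "clamp_at L x = max (- L) (min L x)"

lemma huber_measurable [measurable]: "huber L \<in> borel_measurable borel"
  unfolding huber_def[abs_def] by measurable

lemma clamp_at_measurable [measurable]: "clamp_at L \<in> borel_measurable borel"
  unfolding clamp_at_def[abs_def] by measurable

lemma clamp_at_le: "0 \<le> L \<Longrightarrow> \<bar>clamp_at L x\<bar> \<le> L"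
  by (auto simp: clamp_at_def)

text \<open>The Huber function is the supremum of \<open>s x - s\<^sup>2/2\<close> over \<open>\<bar>s\<bar> \<le> L\<close>, attained at the clamped value of \<open>x\<close>;
  convexity and the tangent inequality follow from this.\<close>

lemma huber_ge: "\<bar>s\<bar> \<le> L \<Longrightarrow> s * x - s\<^sup>2 / 2 \<le> huber L x"
proof -
  assume s: "\<bar>s\<bar> \<le> L"
  show ?thesis
  proof (cases "\<bar>x\<bar> \<le> L")
    case True
    have "0 \<le> (x - s)\<^sup>2" by simp
    then have "s * x - s\<^sup>2 / 2 \<le> x\<^sup>2 / 2" by (simp add: power2_eq_square algebra_simps)
    then show ?thesis using True by (simp add: huber_def)
  next
    case False
    let ?s = "\<bar>s\<bar>"
    have "0 \<le> (L - ?s) * (\<bar>x\<bar> - (L + ?s) / 2)" using False s by (intro mult_nonneg_nonneg) auto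
    moreover have "(L - ?s) * (\<bar>x\<bar> - (L + ?s) / 2) = (L * \<bar>x\<bar> - L\<^sup>2 / 2) - (?s * \<bar>x\<bar> - ?s\<^sup>2 / 2)"
      by (simp add: power2_eq_square field_simps)
    ultimately have "?s * \<bar>x\<bar> - ?s\<^sup>2 / 2 \<le> L * \<bar>x\<bar> - L\<^sup>2 / 2" by linarith
    moreover have "s * x \<le> ?s * \<bar>x\<bar>" by (metis abs_ge_self abs_mult)
    ultimately show ?thesis using False by (simp add: huber_def)
  qed
qed

lemma huber_eq_clamp: "0 \<le> L \<Longrightarrow> huber L x = clamp_at L x * x - (clamp_at L x)\<^sup>2 / 2"
proof -
  assume L: "0 \<le> L"
  consider "\<bar>x\<bar> \<le> L" | "x > L" | "x < - L" by linarith
  then show ?thesis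
  proof cases
    case 1
    then have "clamp_at L x = x" by (auto simp: clamp_at_def)
    then show ?thesis using 1 by (simp add: huber_def power2_eq_square)
  next
    case 2
    then have "clamp_at L x = L" "\<bar>x\<bar> = x" using L by (auto simp: clamp_at_def)
    then show ?thesis using 2 by (simp add: huber_def)
  next
    case 3
    then have "clamp_at L x = - L" "\<bar>x\<bar> = - x" using L by (auto simp: clamp_at_def)
    then show ?thesis using 3 by (simp add: huber_def)
  qed
qed

lemma huber_tangent: "0 \<le> L \<Longrightarrow> huber L x + clamp_at L x * h \<le> huber L (x + h)"
  using huber_ge[OF clamp_at_le, of L x "x + h"] huber_eq_clamp[of L x] by (simp add: algebra_simps)

text \<open>Everywhere there is the tangent inequality; as long as both points stay in the quadratic
  range the expansion is exact and gains h^2 / 2. The choice \<open>L = K + l\<close> makes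
  \<open>\<bar>x\<bar> \<le> K\<close> and \<open>\<bar>h\<bar> \<le> l\<close> sufficient for this.
  The gain is the strict drift behind the occupation bound.\<close>

lemma huber_second_order:
  assumes "0 \<le> K" "0 \<le> l" "L = K + l"
  shows "huber L x + clamp_at L x * h + indicat_real {-K..K} x * (indicat_real {-l..l} h * h\<^sup>2) / 2 \<le> huber L (x + h)"
proof (cases "x \<in> {-K..K} \<and> h \<in> {-l..l}")
  case True
  then have "\<bar>x\<bar> \<le> L" "\<bar>x + h\<bar> \<le> L" "clamp_at L x = x" using assms by (auto simp: clamp_at_def)
  then show ?thesis using True by (simp add: huber_def power2_eq_square field_simps)
next
  case False
  then have z: "indicat_real {-K..K} x * (indicat_real {-l..l} h * h\<^sup>2) / 2 = 0" by (auto simp: indicator_def)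
  show ?thesis unfolding z using huber_tangent[of L x h] assms by simp
qed

lemma huber_bounds: "0 \<le> L \<Longrightarrow> 0 \<le> huber L x" "0 \<le> L \<Longrightarrow> huber L x \<le> L * \<bar>x\<bar>"
proof -
  assume L: "0 \<le> L"
  show "0 \<le> huber L x" using huber_ge[of 0 L x] L by simp
  show "huber L x \<le> L * \<bar>x\<bar>"
  proof (cases "\<bar>x\<bar> \<le> L")
    case True
    then have "\<bar>x\<bar> * \<bar>x\<bar> \<le> L * \<bar>x\<bar>" by (intro mult_right_mono) auto
    moreover have "x\<^sup>2 = \<bar>x\<bar> * \<bar>x\<bar>" by (simp add: power2_eq_square)
    moreover have "0 \<le> x\<^sup>2" by simp
    ultimately have "x\<^sup>2 / 2 \<le> L * \<bar>x\<bar>" by linarith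
    then show ?thesis using True by (simp add: huber_def)
  qed (simp add: huber_def)
qed

lemma huber_minus: "huber L (- x) = huber L x"
  by (simp add: huber_def)

lemma tar_path_cong:
  assumes "\<And>j. 1 \<le> j \<Longrightarrow> j \<le> t \<Longrightarrow> e j = e' j"
  shows "tar_path a b r y e t = tar_path a b r y e' t"
  using assms by (induction t) auto

section \<open>The threshold autoregression with unit slope above the threshold\<close>

locale tar_process = prob_space M for M :: "'a measure" +
  fixes eps :: "nat \<Rightarrow> 'a \<Rightarrow> real" and Y0 :: "'a \<Rightarrow> real" and beta r :: real
  assumes indep: "indep_vars (\<lambda>_. borel) (\<lambda>i. if i = 0 then Y0 else eps i) UNIV"
    and ident: "\<And>t. t \<ge> 1 \<Longrightarrow> distr M borel (eps t) = distr M borel (eps 1)"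
    and eps_sq: "integrable M (\<lambda>\<omega>. (eps 1 \<omega>)\<^sup>2)"
    and eps_mean: "expectation (eps 1) = 0"
    and eps_var: "expectation (\<lambda>\<omega>. (eps 1 \<omega>)\<^sup>2) > 0"
    and Y0_sq: "integrable M (\<lambda>\<omega>. (Y0 \<omega>)\<^sup>2)"
    and cases: "beta < 1 \<and> r \<le> 0 \<or> beta = -1"
begin

definition Y :: "nat \<Rightarrow> 'a \<Rightarrow> real" where
  "Y t \<omega> = tar_path 1 beta r (Y0 \<omega>) (\<lambda>t. eps t \<omega>) t"

definition reg :: "real \<Rightarrow> real" where
  "reg x = (if x \<le> r then beta * x else x)"

definition var :: real where
  "var = expectation (\<lambda>\<omega>. (eps 1 \<omega>)\<^sup>2)"

lemma var_pos: "var > 0"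
  using eps_var by (simp add: var_def)

lemma Y_0: "Y 0 = Y0"
  by (simp add: Y_def fun_eq_iff)

lemma Y_Suc: "Y (Suc t) \<omega> = reg (Y t \<omega>) + eps (Suc t) \<omega>"
  by (simp add: Y_def reg_def)

lemma Y0_measurable [measurable]: "Y0 \<in> borel_measurable M"
proof -
  have "(if (0::nat) = 0 then Y0 else eps 0) \<in> borel_measurable M"
    using indep unfolding indep_vars_def by blast
  then show ?thesis by simp
qed

lemma eps_Suc_measurable [measurable]: "eps (Suc t) \<in> borel_measurable M"
proof -
  have "(if Suc t = 0 then Y0 else eps (Suc t)) \<in> borel_measurable M"
    using indep unfolding indep_vars_def by blast
  then show ?thesis by simp
qed

lemma eps_1_measurable [measurable]: "eps 1 \<in> borel_measurable M"
  using eps_Suc_measurable[of 0] by simp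

lemma reg_measurable [measurable]: "reg \<in> borel_measurable borel"
  unfolding reg_def[abs_def] by measurable

lemma Y_measurable [measurable]: "Y t \<in> borel_measurable M"
proof (induction t)
  case 0
  then show ?case by (simp add: Y_0)
next
  case (Suc t)
  note [measurable] = Suc
  show ?case unfolding Y_Suc[abs_def] by measurable
qed

text \<open>The path up to \<open>t\<close> is a measurable function of the initial value and the
  first \<open>t\<close> innovations, so independence of the two blocks \<open>{..t}\<close> and
  \<open>{Suc t}\<close> of the joint family gives the claim. The whole past is needed, since the
  weights of the Laplace argument contain all earlier squares.\<close>

lemma indep_past:
  assumes f [measurable]: "f \<in> borel_measurable (Pi\<^sub>M {..t} (\<lambda>_. borel))"
  shows "indep_var borel (\<lambda>\<omega>. f (\<lambda>i\<in>{..t}. Y i \<omega>)) borel (eps (Suc t))"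
proof -
  define X where "X i = (if i = 0 then Y0 else eps i)" for i
  have *: "indep_var (Pi\<^sub>M {..t} (\<lambda>_. borel)) (\<lambda>\<omega>. \<lambda>i\<in>{..t}. X i \<omega>) (Pi\<^sub>M {Suc t} (\<lambda>_. borel)) (\<lambda>\<omega>. \<lambda>i\<in>{Suc t}. X i \<omega>)"
    using indep unfolding X_def by (intro indep_var_restrict[where I = UNIV]) auto
  \<comment> \<open>The vector \<open>x\<close> plays both roles: its entry 0 is the initial value
    and the others are the innovations. There is no clash, because \<open>tar_path\<close> reads its
    noise argument only at positive indices.\<close>
  have pm: "(\<lambda>x. tar_path 1 beta r (x 0) x i) \<in> borel_measurable (Pi\<^sub>M {..t} (\<lambda>_. borel))" if "i \<le> t" for i
    using that
  proof (induction i)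
    case 0
    then show ?case by simp
  next
    case (Suc i)
    then have [measurable]: "(\<lambda>x. tar_path 1 beta r (x 0) x i) \<in> borel_measurable (Pi\<^sub>M {..t} (\<lambda>_. borel))" by simp
    have [measurable]: "(\<lambda>x. x (Suc i)) \<in> borel_measurable (Pi\<^sub>M {..t} (\<lambda>_. borel :: real measure))"
      using Suc.prems by (intro measurable_component_singleton) auto
    show ?case by simp
  qed
  define G where "G x = f (\<lambda>i\<in>{..t}. tar_path 1 beta r (x 0) x i)" for x
  have "G \<in> borel_measurable (Pi\<^sub>M {..t} (\<lambda>_. borel))"
    unfolding G_def[abs_def] using pm by (intro measurable_compose[OF _ f] measurable_restrict) auto
  moreover have "(\<lambda>x. x (Suc t)) \<in> borel_measurable (Pi\<^sub>M {Suc t} (\<lambda>_. borel :: real measure))"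
    by (intro measurable_component_singleton) auto
  ultimately have "indep_var borel (G \<circ> (\<lambda>\<omega>. \<lambda>i\<in>{..t}. X i \<omega>)) borel ((\<lambda>x. x (Suc t)) \<circ> (\<lambda>\<omega>. \<lambda>i\<in>{Suc t}. X i \<omega>))"
    by (rule indep_var_compose[OF *])
  moreover have "G \<circ> (\<lambda>\<omega>. \<lambda>i\<in>{..t}. X i \<omega>) = (\<lambda>\<omega>. f (\<lambda>i\<in>{..t}. Y i \<omega>))"
  proof (rule ext)
    fix \<omega>
    have "tar_path 1 beta r (X 0 \<omega>) (\<lambda>i\<in>{..t}. X i \<omega>) i = Y i \<omega>" if "i \<le> t" for i
      unfolding Y_def X_def using that by (auto intro!: tar_path_cong)
    then have "(\<lambda>i\<in>{..t}. tar_path 1 beta r ((\<lambda>i\<in>{..t}. X i \<omega>) 0) (\<lambda>i\<in>{..t}. X i \<omega>) i) = (\<lambda>i\<in>{..t}. Y i \<omega>)"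
      by (intro restrict_ext) auto
    then show "(G \<circ> (\<lambda>\<omega>. \<lambda>i\<in>{..t}. X i \<omega>)) \<omega> = f (\<lambda>i\<in>{..t}. Y i \<omega>)"
      by (simp only: G_def comp_def)
  qed
  moreover have "(\<lambda>x. x (Suc t)) \<circ> (\<lambda>\<omega>. \<lambda>i\<in>{Suc t}. X i \<omega>) = eps (Suc t)"
    by (auto simp: X_def fun_eq_iff)
  ultimately show ?thesis by simp
qed

lemma indep_Y:
  assumes [measurable]: "g \<in> borel_measurable borel"
  shows "indep_var borel (\<lambda>\<omega>. g (Y t \<omega>)) borel (eps (Suc t))"
proof -
  have "(\<lambda>p. g (p t)) \<in> borel_measurable (Pi\<^sub>M {..t} (\<lambda>_. borel))" by measurable
  from indep_past[OF this] show ?thesis by simp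
qed

lemma integrable_eps:
  fixes g :: "real \<Rightarrow> real"
  assumes [measurable]: "g \<in> borel_measurable borel" and "integrable M (\<lambda>\<omega>. g (eps 1 \<omega>))"
  shows "integrable M (\<lambda>\<omega>. g (eps (Suc t) \<omega>))"
  using integrable_distr_eq[of "eps (Suc t)" M borel g] integrable_distr_eq[of "eps 1" M borel g] ident[of "Suc t"] assms
  by simp

lemma expectation_eps:
  fixes g :: "real \<Rightarrow> real"
  assumes [measurable]: "g \<in> borel_measurable borel"
  shows "expectation (\<lambda>\<omega>. g (eps (Suc t) \<omega>)) = expectation (\<lambda>\<omega>. g (eps 1 \<omega>))"
  using integral_distr[of "eps (Suc t)" M borel g] integral_distr[of "eps 1" M borel g] ident[of "Suc t"]
  by simp

lemma eps_integrable: "integrable M (eps (Suc t))" "integrable M (\<lambda>\<omega>. (eps (Suc t) \<omega>)\<^sup>2)"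
  using integrable_eps[of "\<lambda>x. x\<^sup>2" t] eps_sq by (auto intro: integrable_of_square)

lemma eps_moments: "expectation (eps (Suc t)) = 0" "expectation (\<lambda>\<omega>. (eps (Suc t) \<omega>)\<^sup>2) = var"
  using expectation_eps[of "\<lambda>x. x" t] expectation_eps[of "\<lambda>x. x\<^sup>2" t] eps_mean by (auto simp: var_def)

lemma expectation_Y_mult_eps:
  fixes g k :: "real \<Rightarrow> real"
  assumes g: "g \<in> borel_measurable borel" and k: "k \<in> borel_measurable borel"
    and ig: "integrable M (\<lambda>\<omega>. g (Y t \<omega>))" and ik: "integrable M (\<lambda>\<omega>. k (eps 1 \<omega>))"
  shows "integrable M (\<lambda>\<omega>. g (Y t \<omega>) * k (eps (Suc t) \<omega>))"
    and "expectation (\<lambda>\<omega>. g (Y t \<omega>) * k (eps (Suc t) \<omega>)) = expectation (\<lambda>\<omega>. g (Y t \<omega>)) * expectation (\<lambda>\<omega>. k (eps 1 \<omega>))"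
  using expectation_indep_mult[OF indep_Y[OF g] k ig integrable_eps[OF k ik]] unfolding expectation_eps[OF k] .

lemma reg_square_le: "(reg x)\<^sup>2 \<le> (1 + beta\<^sup>2) * x\<^sup>2"
  by (auto simp: reg_def power_mult_distrib distrib_right)

lemma Y_sq_integrable: "integrable M (\<lambda>\<omega>. (Y t \<omega>)\<^sup>2)"
proof (induction t)
  case 0
  then show ?case using Y0_sq by (simp add: Y_0)
next
  case (Suc t)
  show ?case
  proof (rule Bochner_Integration.integrable_bound)
    show "integrable M (\<lambda>\<omega>. 2 * (1 + beta\<^sup>2) * (Y t \<omega>)\<^sup>2 + 2 * (eps (Suc t) \<omega>)\<^sup>2)"
      using Suc eps_integrable(2)[of t] by auto
    have "(Y (Suc t) \<omega>)\<^sup>2 \<le> 2 * (1 + beta\<^sup>2) * (Y t \<omega>)\<^sup>2 + 2 * (eps (Suc t) \<omega>)\<^sup>2" for \<omega>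
    proof -
      have "(u + v)\<^sup>2 \<le> 2 * u\<^sup>2 + 2 * v\<^sup>2" for u v :: real
        using zero_le_power2[of "u - v"] by (simp add: power2_eq_square algebra_simps)
      from this[of "reg (Y t \<omega>)" "eps (Suc t) \<omega>"] reg_square_le[of "Y t \<omega>"] show ?thesis
        unfolding Y_Suc mult.assoc by linarith
    qed
    from order_trans[OF this abs_ge_self]
    show "AE \<omega> in M. norm ((Y (Suc t) \<omega>)\<^sup>2) \<le> norm (2 * (1 + beta\<^sup>2) * (Y t \<omega>)\<^sup>2 + 2 * (eps (Suc t) \<omega>)\<^sup>2)"
      by (intro AE_I2) (simp only: real_norm_def abs_power2)
  qed simp
qed

lemma Y_integrable: "integrable M (Y t)"
  by (rule integrable_of_square[OF Y_measurable Y_sq_integrable])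

abbreviation below :: "nat \<Rightarrow> 'a \<Rightarrow> real" where
  "below t \<omega> \<equiv> indicat_real {..r} (Y t \<omega>) * (1 + (Y t \<omega>)\<^sup>2)"

abbreviation occ :: "real \<Rightarrow> nat \<Rightarrow> real" where
  "occ K t \<equiv> expectation (\<lambda>\<omega>. indicat_real {-K..K} (Y t \<omega>))"

section \<open>Uniform square integrability of the negative parts\<close>

definition drift_bound :: "real \<Rightarrow> real" where
  "drift_bound x = (\<bar>r\<bar> + \<bar>x\<bar>) / (1 - max 0 beta)"

lemma beta_pos_part: "0 \<le> max 0 beta" "max 0 beta < 1"
  using cases by auto

lemma drift_bound_measurable [measurable]: "drift_bound \<in> borel_measurable borel"
  unfolding drift_bound_def[abs_def] by measurable

text \<open>Above the threshold the negative part is at most \<open>\<bar>r\<bar>\<close>. Below it,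
  a nonnegative \<open>beta\<close> shrinks the negative part by the factor \<open>beta\<close>; a
  negative one gives a nonnegative value if \<open>r \<le> 0\<close>, and the value - y >= - r if
  beta = -1. Hence the factor \<open>max 0 beta\<close> < 1, however negative \<open>beta\<close>
  is. Dividing by \<open>1 - max 0 beta\<close> in \<open>drift_bound\<close> makes the right side a
  convex combination, as \<open>excess_convex\<close> requires.\<close>

lemma neg_part_step:
  "max 0 (- Y (Suc t) \<omega>) \<le> max 0 beta * max 0 (- Y t \<omega>) + (1 - max 0 beta) * drift_bound (eps (Suc t) \<omega>)"
proof -
  let ?b = "max 0 beta" and ?y = "Y t \<omega>"
  have "- reg ?y \<le> ?b * max 0 (- ?y) + \<bar>r\<bar>"
  proof (cases "?y \<le> r")
    case False
    have "0 \<le> ?b * max 0 (- ?y)" "reg ?y = ?y" using False by (simp_all add: reg_def)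
    then show ?thesis using False by linarith
  next
    case True
    show ?thesis
    proof (cases "beta \<ge> 0")
      case b: True
      have "beta * (- ?y) \<le> beta * max 0 (- ?y)" using b by (intro mult_left_mono) auto
      then show ?thesis using b True by (simp add: reg_def)
    next
      case b: False
      have "- (beta * ?y) \<le> \<bar>r\<bar>"
        using cases
      proof
        assume c: "beta < 1 \<and> r \<le> 0"
        then have "0 \<le> beta * ?y" using b True by (intro mult_nonpos_nonpos) auto
        then show ?thesis by linarith
      next
        assume "beta = -1"
        then show ?thesis using True by simp
      qed
      then show ?thesis using b True by (simp add: reg_def max_def)
    qed
  qed
  moreover have "(1 - ?b) * drift_bound (eps (Suc t) \<omega>) = \<bar>r\<bar> + \<bar>eps (Suc t) \<omega>\<bar>"
    using beta_pos_part by (simp add: drift_bound_def)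
  moreover have "0 \<le> ?b * max 0 (- ?y)" by simp
  ultimately show ?thesis unfolding Y_Suc by linarith
qed

definition tail_bound :: "real \<Rightarrow> real" where
  "tail_bound K = expectation (\<lambda>\<omega>. excess K \<bar>Y0 \<omega>\<bar>) + expectation (\<lambda>\<omega>. excess K (drift_bound (eps 1 \<omega>)))"

lemma drift_bound_sq_integrable: "integrable M (\<lambda>\<omega>. (drift_bound (eps 1 \<omega>))\<^sup>2)"
proof -
  have "integrable M (\<lambda>\<omega>. (\<bar>r\<bar> + \<bar>eps 1 \<omega>\<bar>)\<^sup>2)"
    using eps_sq eps_integrable(1)[of 0] by (simp add: power2_sum)
  then show ?thesis by (simp add: drift_bound_def power_divide)
qed

lemma tail_bound_tendsto_0: "(\<lambda>k. tail_bound (real k)) \<longlonglongrightarrow> 0"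
proof -
  have "(\<lambda>k. tail_bound (real k)) \<longlonglongrightarrow> 0 + 0"
    unfolding tail_bound_def using Y0_sq
    by (intro tendsto_add excess_tendsto_0 drift_bound_sq_integrable) auto
  then show ?thesis by simp
qed

lemma excess_integrable:
  assumes "0 \<le> K" and [measurable]: "X \<in> borel_measurable M" and "integrable M (\<lambda>\<omega>. (X \<omega>)\<^sup>2)"
  shows "integrable M (\<lambda>\<omega>. excess K (X \<omega>))"
  by (rule Bochner_Integration.integrable_bound[OF assms(3)])
    (auto simp: excess_nonneg excess_le_square[OF assms(1)])

lemma excess_neg_Y_integrable:
  assumes "0 \<le> K" shows "integrable M (\<lambda>\<omega>. excess K (max 0 (- Y t \<omega>)))"
proof (rule excess_integrable[OF assms])
  show "integrable M (\<lambda>\<omega>. (max 0 (- Y t \<omega>))\<^sup>2)"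
    by (rule Bochner_Integration.integrable_bound[OF Y_sq_integrable[of t]]) (auto simp: max_def)
qed simp

text \<open>The bound is uniform in \<open>t\<close> because each step averages, with convex
  weights, the previous value and that of \<open>drift_bound\<close>, and both are at most
  \<open>tail_bound K\<close>.\<close>

lemma excess_neg_Y_le:
  assumes K: "0 \<le> K"
  shows "expectation (\<lambda>\<omega>. excess K (max 0 (- Y t \<omega>))) \<le> tail_bound K"
proof (induction t)
  case 0
  have "expectation (\<lambda>\<omega>. excess K (max 0 (- Y 0 \<omega>))) \<le> expectation (\<lambda>\<omega>. excess K \<bar>Y0 \<omega>\<bar>)"
    using excess_neg_Y_integrable[OF K, of 0] excess_integrable[OF K, of "\<lambda>\<omega>. \<bar>Y0 \<omega>\<bar>"] Y0_sq
    by (intro integral_mono excess_mono) (auto simp: Y_0)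
  also have "\<dots> \<le> tail_bound K"
    by (simp add: tail_bound_def excess_nonneg)
  finally show ?case .
next
  case (Suc t)
  let ?b = "max 0 beta"
  let ?D = "expectation (\<lambda>\<omega>. excess K (drift_bound (eps 1 \<omega>)))"
  have i1: "integrable M (\<lambda>\<omega>. excess K (drift_bound (eps 1 \<omega>)))"
    by (rule excess_integrable[OF K _ drift_bound_sq_integrable]) simp
  have i2: "integrable M (\<lambda>\<omega>. excess K (drift_bound (eps (Suc t) \<omega>)))"
    by (rule integrable_eps[where g = "\<lambda>x. excess K (drift_bound x)", OF _ i1]) simp
  have e2: "expectation (\<lambda>\<omega>. excess K (drift_bound (eps (Suc t) \<omega>))) = ?D"
    by (rule expectation_eps[where g = "\<lambda>x. excess K (drift_bound x)"]) simp
  have i3: "integrable M (\<lambda>\<omega>. ?b * excess K (max 0 (- Y t \<omega>)) + (1 - ?b) * excess K (drift_bound (eps (Suc t) \<omega>)))"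
    by (intro Bochner_Integration.integrable_add integrable_mult_right i2 excess_neg_Y_integrable K)
  have "expectation (\<lambda>\<omega>. excess K (max 0 (- Y (Suc t) \<omega>)))
     \<le> expectation (\<lambda>\<omega>. ?b * excess K (max 0 (- Y t \<omega>)) + (1 - ?b) * excess K (drift_bound (eps (Suc t) \<omega>)))"
  proof (rule integral_mono[OF excess_neg_Y_integrable[OF K] i3])
    fix \<omega>
    have "excess K (max 0 (- Y (Suc t) \<omega>)) \<le> excess K (?b * max 0 (- Y t \<omega>) + (1 - ?b) * drift_bound (eps (Suc t) \<omega>))"
      by (rule excess_mono[OF neg_part_step])
    also have "\<dots> \<le> ?b * excess K (max 0 (- Y t \<omega>)) + (1 - ?b) * excess K (drift_bound (eps (Suc t) \<omega>))"
      using beta_pos_part by (intro excess_convex) auto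
    finally show "excess K (max 0 (- Y (Suc t) \<omega>)) \<le> ?b * excess K (max 0 (- Y t \<omega>)) + (1 - ?b) * excess K (drift_bound (eps (Suc t) \<omega>))" .
  qed
  also have "\<dots> = ?b * expectation (\<lambda>\<omega>. excess K (max 0 (- Y t \<omega>))) + (1 - ?b) * ?D"
    unfolding e2[symmetric] using i2 excess_neg_Y_integrable[OF K, of t] by simp
  also have "\<dots> \<le> ?b * tail_bound K + (1 - ?b) * tail_bound K"
  proof (intro add_mono mult_left_mono Suc)
    show "?D \<le> tail_bound K"
      by (simp add: tail_bound_def excess_nonneg)
  qed (use beta_pos_part in auto)
  also have "\<dots> = tail_bound K" by (simp add: algebra_simps)
  finally show ?case .
qed

lemma bad_Y_integrable: "integrable M (\<lambda>\<omega>. below t \<omega>)"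
proof (rule Bochner_Integration.integrable_bound)
  show "integrable M (\<lambda>\<omega>. 1 + (Y t \<omega>)\<^sup>2)" using Y_sq_integrable[of t] by simp
qed (auto simp: indicator_def)

lemma bad_Y_le:
  assumes "K \<ge> 1" "2 * K \<ge> \<bar>r\<bar>"
  shows "expectation (\<lambda>\<omega>. below t \<omega>)
    \<le> (1 + 4 * K\<^sup>2) * occ (2*K) t + 8 * tail_bound K"
proof -
  have K: "K \<ge> 0" using assms by simp
  have i1: "integrable M (\<lambda>\<omega>. indicat_real {-(2*K)..2*K} (Y t \<omega>))"
    by (rule integrable_const_bound[of _ 1]) auto
  have "expectation (\<lambda>\<omega>. below t \<omega>)
    \<le> expectation (\<lambda>\<omega>. (1 + 4 * K\<^sup>2) * indicat_real {-(2*K)..2*K} (Y t \<omega>) + 8 * excess K (max 0 (- Y t \<omega>)))"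
    using i1 excess_neg_Y_integrable[OF K]
    by (intro integral_mono bad_Y_integrable bad_region_le assms) auto
  also have "\<dots> = (1 + 4 * K\<^sup>2) * occ (2*K) t + 8 * expectation (\<lambda>\<omega>. excess K (max 0 (- Y t \<omega>)))"
    using i1 excess_neg_Y_integrable[OF K] by simp
  also have "\<dots> \<le> (1 + 4 * K\<^sup>2) * occ (2*K) t + 8 * tail_bound K"
    using excess_neg_Y_le[OF K] by simp
  finally show ?thesis .
qed

text \<open>In the squared recursion the cross term has mean zero, and \<open>reg\<close> adds at
  most \<open>beta\<^sup>2\<close> times the contribution of the times below the threshold, which
  \<open>bad_Y_le\<close> bounds uniformly in \<open>t\<close> already for one fixed
  \<open>K\<close>. Linear growth puts the mean of \<open>\<bar>Y n \<omega>\<bar>\<close> at order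
  sqrt n.\<close>

lemma Y_second_moment_linear:
  obtains C where "C \<ge> 0" "\<And>t. expectation (\<lambda>\<omega>. (Y t \<omega>)\<^sup>2) \<le> expectation (\<lambda>\<omega>. (Y0 \<omega>)\<^sup>2) + C * real t"
proof -
  define K where "K = 1 + \<bar>r\<bar>"
  define B where "B = 1 + 4 * K\<^sup>2 + 8 * tail_bound K"
  have bad: "expectation (\<lambda>\<omega>. below t \<omega>) \<le> B" for t
  proof -
    have "occ (2*K) t \<le> expectation (\<lambda>\<omega>. 1)"
      by (intro integral_mono integrable_const_bound[of _ 1]) (auto simp: indicator_def)
    then have "(1 + 4 * K\<^sup>2) * occ (2*K) t \<le> (1 + 4 * K\<^sup>2) * 1"
      by (intro mult_left_mono) (auto simp: prob_space)
    then show ?thesis using bad_Y_le[of K t] by (simp add: K_def B_def)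
  qed
  have "0 \<le> expectation (\<lambda>\<omega>. indicat_real {..r} (Y 0 \<omega>) * (1 + (Y 0 \<omega>)\<^sup>2))"
    by (intro Bochner_Integration.integral_nonneg) (simp add: add_nonneg_nonneg)
  then have B0: "B \<ge> 0" using bad[of 0] by linarith
  have step: "expectation (\<lambda>\<omega>. (Y (Suc t) \<omega>)\<^sup>2) \<le> expectation (\<lambda>\<omega>. (Y t \<omega>)\<^sup>2) + (beta\<^sup>2 * B + var)" for t
  proof -
    have ireg2: "integrable M (\<lambda>\<omega>. (reg (Y t \<omega>))\<^sup>2)"
      by (rule Bochner_Integration.integrable_bound[where f = "\<lambda>\<omega>. (1 + beta\<^sup>2) * (Y t \<omega>)\<^sup>2"])
        (use Y_sq_integrable[of t] in \<open>auto intro!: AE_I2 order_trans[OF reg_square_le] simp: abs_mult\<close>)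
    have ireg: "integrable M (\<lambda>\<omega>. reg (Y t \<omega>))"
      by (rule integrable_of_square[OF _ ireg2]) simp
    have idm: "(\<lambda>x::real. x) \<in> borel_measurable borel" and i1: "integrable M (\<lambda>\<omega>. eps 1 \<omega>)"
      using eps_integrable(1)[of 0] by simp_all
    note cross = expectation_Y_mult_eps[OF reg_measurable idm ireg i1]
    have ic: "integrable M (\<lambda>\<omega>. reg (Y t \<omega>) * eps (Suc t) \<omega>)"
      and ec: "expectation (\<lambda>\<omega>. reg (Y t \<omega>) * eps (Suc t) \<omega>) = 0"
      using cross unfolding eps_mean by simp_all
    have "expectation (\<lambda>\<omega>. (Y (Suc t) \<omega>)\<^sup>2)
       = expectation (\<lambda>\<omega>. (reg (Y t \<omega>))\<^sup>2 + (eps (Suc t) \<omega>)\<^sup>2 + 2 * (reg (Y t \<omega>) * eps (Suc t) \<omega>))"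
      unfolding Y_Suc by (simp add: power2_sum mult.assoc)
    also have "\<dots> = expectation (\<lambda>\<omega>. (reg (Y t \<omega>))\<^sup>2) + var"
      using ireg2 eps_integrable(2)[of t] ic ec eps_moments(2)[of t] by simp
    finally have sq: "expectation (\<lambda>\<omega>. (Y (Suc t) \<omega>)\<^sup>2) = expectation (\<lambda>\<omega>. (reg (Y t \<omega>))\<^sup>2) + var" .
    have "expectation (\<lambda>\<omega>. (reg (Y t \<omega>))\<^sup>2) \<le> expectation (\<lambda>\<omega>. (Y t \<omega>)\<^sup>2 + beta\<^sup>2 * below t \<omega>)"
    proof (rule integral_mono[OF ireg2])
      show "integrable M (\<lambda>\<omega>. (Y t \<omega>)\<^sup>2 + beta\<^sup>2 * below t \<omega>)"
        by (intro Bochner_Integration.integrable_add integrable_mult_right Y_sq_integrable bad_Y_integrable)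
      show "(reg (Y t \<omega>))\<^sup>2 \<le> (Y t \<omega>)\<^sup>2 + beta\<^sup>2 * below t \<omega>" for \<omega>
        by (cases "Y t \<omega> \<le> r") (simp_all add: reg_def power_mult_distrib distrib_left)
    qed
    also have "\<dots> = expectation (\<lambda>\<omega>. (Y t \<omega>)\<^sup>2) + beta\<^sup>2 * expectation (\<lambda>\<omega>. below t \<omega>)"
      unfolding integral_mult_right_zero[symmetric]
      by (intro Bochner_Integration.integral_add integrable_mult_right Y_sq_integrable bad_Y_integrable)
    also have "\<dots> \<le> expectation (\<lambda>\<omega>. (Y t \<omega>)\<^sup>2) + beta\<^sup>2 * B"
      using bad[of t] by (intro add_left_mono mult_left_mono) auto
    finally show ?thesis using sq by linarith
  qed
  show thesis
  proof (rule that)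
    show "0 \<le> beta\<^sup>2 * B + var" using B0 var_pos by simp
    show "expectation (\<lambda>\<omega>. (Y t \<omega>)\<^sup>2) \<le> expectation (\<lambda>\<omega>. (Y0 \<omega>)\<^sup>2) + (beta\<^sup>2 * B + var) * real t" for t
    proof (induction t)
      case (Suc t)
      have "(beta\<^sup>2 * B + var) * real (Suc t) = (beta\<^sup>2 * B + var) * real t + (beta\<^sup>2 * B + var)"
        by (simp add: algebra_simps)
      then show ?case using Suc step[of t] by linarith
    qed (simp add: Y_0)
  qed
qed

text \<open>If beta = -1, the map preserves absolute values and the even Huber function, with c = 0,
  is unchanged whatever \<open>r\<close> is. If beta < 1 and \<open>r \<le> 0\<close>, every point
  at or below \<open>r\<close> is moved to the right; as the slope of the Huber function is at least
  - L, adding L x makes the function nondecreasing.\<close>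

lemma lyapunov_shift:
  assumes "L \<ge> 0"
  obtains c where "\<bar>c\<bar> \<le> L" "\<And>x. huber L x + c * x \<le> huber L (reg x) + c * reg x"
  using cases
proof
  assume b: "beta = -1"
  have "huber L (reg x) = huber L x" for x unfolding reg_def using b huber_minus[of L x] by simp
  then show thesis using that[of 0] assms by simp
next
  assume c: "beta < 1 \<and> r \<le> 0"
  have "huber L x + L * x \<le> huber L (reg x) + L * reg x" for x
  proof -
    have "0 \<le> reg x - x"
    proof (cases "x \<le> r")
      case True
      then have "0 \<le> (beta - 1) * x" using c by (intro mult_nonpos_nonpos) auto
      then show ?thesis using True by (simp add: reg_def algebra_simps)
    qed (simp add: reg_def)
    moreover have "- L \<le> clamp_at L x" using clamp_at_le[OF assms, of x] by linarith
    ultimately have "- L * (reg x - x) \<le> clamp_at L x * (reg x - x)" by (intro mult_right_mono)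
    then show ?thesis using huber_tangent[OF assms, of x "reg x - x"] by (simp add: algebra_simps)
  qed
  then show thesis using that[of L] assms by simp
qed

lemma truncated_var_pos:
  obtains l where "l \<ge> 0" "expectation (\<lambda>\<omega>. indicat_real {-l..l} (eps 1 \<omega>) * (eps 1 \<omega>)\<^sup>2) > 0"
proof -
  have "(\<lambda>k. expectation (\<lambda>\<omega>. indicat_real {-real k..real k} (eps 1 \<omega>) * (eps 1 \<omega>)\<^sup>2)) \<longlonglongrightarrow> expectation (\<lambda>\<omega>. (eps 1 \<omega>)\<^sup>2)"
  proof (rule integral_dominated_convergence[OF _ _ eps_sq])
    show "AE \<omega> in M. (\<lambda>k. indicat_real {-real k..real k} (eps 1 \<omega>) * (eps 1 \<omega>)\<^sup>2) \<longlonglongrightarrow> (eps 1 \<omega>)\<^sup>2"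
    proof (intro AE_I2 tendsto_eventually)
      fix \<omega>
      show "\<forall>\<^sub>F k in sequentially. indicat_real {-real k..real k} (eps 1 \<omega>) * (eps 1 \<omega>)\<^sup>2 = (eps 1 \<omega>)\<^sup>2"
        using eventually_ge_at_top[of "nat \<lceil>\<bar>eps 1 \<omega>\<bar>\<rceil>"]
      proof eventually_elim
        case (elim k)
        then have "\<bar>eps 1 \<omega>\<bar> \<le> real k" by linarith
        then show ?case by (auto simp: indicator_def)
      qed
    qed
  qed (auto simp: indicator_def)
  then have "\<forall>\<^sub>F k in sequentially. expectation (\<lambda>\<omega>. indicat_real {-real k..real k} (eps 1 \<omega>) * (eps 1 \<omega>)\<^sup>2) > 0"
    using eps_var by (rule order_tendstoD)
  then obtain k where "expectation (\<lambda>\<omega>. indicat_real {-real k..real k} (eps 1 \<omega>) * (eps 1 \<omega>)\<^sup>2) > 0"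
    by (auto dest: eventually_happens)
  then show thesis using that[of "real k"] by simp
qed

text \<open>The mean of \<open>V (Y t)\<close> increases at each step by at least s/2 times the
  probability of \<open>\<bar>Y t \<omega>\<bar> \<le> K\<close>, where \<open>s\<close> is the
  truncated variance of an innovation. Since \<open>V\<close> has linear growth, the telescoped sum
  is paid for by first moments alone.\<close>

lemma occupation_bound:
  assumes K: "K \<ge> 0"
  obtains c where "c \<ge> 0" "\<And>n. (\<Sum>t<n. occ K t)
    \<le> c * (expectation (\<lambda>\<omega>. \<bar>Y n \<omega>\<bar>) + expectation (\<lambda>\<omega>. \<bar>Y0 \<omega>\<bar>))"
proof -
  obtain l where l: "l \<ge> 0" and s0: "expectation (\<lambda>\<omega>. indicat_real {-l..l} (eps 1 \<omega>) * (eps 1 \<omega>)\<^sup>2) > 0"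
    by (rule truncated_var_pos)
  define s where "s = expectation (\<lambda>\<omega>. indicat_real {-l..l} (eps 1 \<omega>) * (eps 1 \<omega>)\<^sup>2)"
  \<comment> \<open>The second-order gain occurs at \<open>reg (Y t)\<close> and not at
    \<open>Y t\<close>, so the quadratic range must contain the image of [-K, K] under the
    regression map.\<close>
  define K' where "K' = (1 + \<bar>beta\<bar>) * K"
  define L where "L = K' + l"
  have K': "K' \<ge> 0" and L: "L \<ge> 0" using K l by (auto simp: K'_def L_def)
  obtain c where c: "\<bar>c\<bar> \<le> L" and mono: "\<And>x. huber L x + c * x \<le> huber L (reg x) + c * reg x"
    using lyapunov_shift[OF L] by blast
  define V where "V x = huber L x + c * x" for x
  have [measurable]: "V \<in> borel_measurable borel" unfolding V_def[abs_def] by measurable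
  have Vb: "\<bar>V x\<bar> \<le> 2 * L * \<bar>x\<bar>" for x
  proof -
    have "\<bar>c * x\<bar> \<le> L * \<bar>x\<bar>" using c by (simp add: abs_mult mult_right_mono)
    then show ?thesis using huber_bounds[OF L, of x] by (simp add: V_def)
  qed
  have iV: "integrable M (\<lambda>\<omega>. V (Y t \<omega>))" for t
    by (rule Bochner_Integration.integrable_bound[where f = "\<lambda>\<omega>. 2 * L * \<bar>Y t \<omega>\<bar>"])
      (use Y_integrable[of t] Vb L in \<open>auto simp: abs_mult\<close>)
  have reg_in: "indicat_real {-K..K} x \<le> indicat_real {-K'..K'} (reg x)" for x
  proof (cases "\<bar>x\<bar> \<le> K")
    case True
    have "\<bar>beta\<bar> * \<bar>x\<bar> \<le> \<bar>beta\<bar> * K" using True by (intro mult_left_mono) auto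
    moreover have "0 \<le> \<bar>beta\<bar> * K" using K by simp
    moreover have "\<bar>reg x\<bar> = \<bar>x\<bar> \<or> \<bar>reg x\<bar> = \<bar>beta\<bar> * \<bar>x\<bar>" by (simp add: reg_def abs_mult)
    moreover have "K' = K + \<bar>beta\<bar> * K" by (simp add: K'_def distrib_right)
    ultimately have "\<bar>reg x\<bar> \<le> K'" using True K by linarith
    then have "reg x \<in> {-K'..K'}" by auto
    then show ?thesis by (simp add: indicator_def)
  next
    case False
    then have "x \<notin> {-K..K}" by auto
    then show ?thesis by simp
  qed
  \<comment> \<open>The slope of \<open>V\<close> at the point \<open>reg x\<close>. It is bounded,
    so its product with the next innovation is integrable and has mean zero.\<close>
  define g where "g x = clamp_at L (reg x) + c" for x
  have g_meas: "g \<in> borel_measurable borel" unfolding g_def[abs_def] by measurable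
  have gb: "\<bar>g x\<bar> \<le> 2 * L" for x using clamp_at_le[OF L, of "reg x"] c by (simp add: g_def)
  have step: "expectation (\<lambda>\<omega>. V (Y t \<omega>)) + s / 2 * occ K t \<le> expectation (\<lambda>\<omega>. V (Y (Suc t) \<omega>))" for t
  proof -
    have idm: "(\<lambda>x::real. x) \<in> borel_measurable borel" and i1: "integrable M (\<lambda>\<omega>. eps 1 \<omega>)"
      using eps_integrable(1)[of 0] by simp_all
    have ig: "integrable M (\<lambda>\<omega>. g (Y t \<omega>))"
      using gb g_meas by (intro integrable_const_bound[of _ "2 * L"]) auto
    note c1 = expectation_Y_mult_eps[OF g_meas idm ig i1]
    define k where "k x = indicat_real {-l..l} x * x\<^sup>2" for x
    have k_meas: "k \<in> borel_measurable borel" unfolding k_def[abs_def] by measurable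
    have ik: "integrable M (\<lambda>\<omega>. k (eps 1 \<omega>))"
      by (rule Bochner_Integration.integrable_bound[OF eps_sq]) (use k_meas in \<open>auto simp: k_def indicator_def\<close>)
    have ii_meas: "(\<lambda>x. indicat_real {-K..K} x) \<in> borel_measurable borel" by measurable
    have ii: "integrable M (\<lambda>\<omega>. indicat_real {-K..K} (Y t \<omega>))"
      by (rule integrable_const_bound[of _ 1]) auto
    note c2 = expectation_Y_mult_eps[OF ii_meas k_meas ii ik]
    have Ek: "expectation (\<lambda>\<omega>. k (eps 1 \<omega>)) = s" by (simp add: k_def s_def)
    have E1: "expectation (\<lambda>\<omega>. g (Y t \<omega>) * eps (Suc t) \<omega>) = 0" using c1(2) eps_mean by simp
    have "expectation (\<lambda>\<omega>. V (Y t \<omega>)) + s / 2 * occ K t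
       = expectation (\<lambda>\<omega>. V (Y t \<omega>) + g (Y t \<omega>) * eps (Suc t) \<omega> + indicat_real {-K..K} (Y t \<omega>) * k (eps (Suc t) \<omega>) / 2)"
      using iV[of t] c1(1) c2 E1 Ek by simp
    also have "\<dots> \<le> expectation (\<lambda>\<omega>. V (Y (Suc t) \<omega>))"
    proof (rule integral_mono[OF _ iV])
      show "integrable M (\<lambda>\<omega>. V (Y t \<omega>) + g (Y t \<omega>) * eps (Suc t) \<omega> + indicat_real {-K..K} (Y t \<omega>) * k (eps (Suc t) \<omega>) / 2)"
        using iV[of t] c1(1) c2(1) by simp
      fix \<omega>
      let ?x = "Y t \<omega>" and ?h = "eps (Suc t) \<omega>"
      have "k ?h \<ge> 0" by (simp add: k_def)
      then have "indicat_real {-K..K} ?x * k ?h \<le> indicat_real {-K'..K'} (reg ?x) * k ?h"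
        by (intro mult_right_mono reg_in)
      moreover have "huber L (reg ?x) + clamp_at L (reg ?x) * ?h + indicat_real {-K'..K'} (reg ?x) * k ?h / 2 \<le> huber L (reg ?x + ?h)"
        unfolding k_def by (rule huber_second_order[OF K' l L_def])
      moreover have "g ?x * ?h = clamp_at L (reg ?x) * ?h + c * ?h" by (simp add: g_def distrib_right)
      moreover have "c * (reg ?x + ?h) = c * reg ?x + c * ?h" by (simp add: distrib_left)
      ultimately show "V ?x + g ?x * ?h + indicat_real {-K..K} ?x * k ?h / 2 \<le> V (Y (Suc t) \<omega>)"
        using mono[of ?x] unfolding V_def Y_Suc by linarith
    qed
    finally show ?thesis .
  qed
  have tel: "expectation (\<lambda>\<omega>. V (Y 0 \<omega>)) + s / 2 * (\<Sum>t<n. occ K t) \<le> expectation (\<lambda>\<omega>. V (Y n \<omega>))" for n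
  proof (induction n)
    case (Suc n)
    then show ?case using step[of n] by (simp add: distrib_left)
  qed simp
  have EV: "\<bar>expectation (\<lambda>\<omega>. V (Y n \<omega>))\<bar> \<le> 2 * L * expectation (\<lambda>\<omega>. \<bar>Y n \<omega>\<bar>)" for n
  proof -
    have "\<bar>expectation (\<lambda>\<omega>. V (Y n \<omega>))\<bar> \<le> expectation (\<lambda>\<omega>. \<bar>V (Y n \<omega>)\<bar>)" by (rule integral_abs_bound)
    also have "\<dots> \<le> expectation (\<lambda>\<omega>. 2 * L * \<bar>Y n \<omega>\<bar>)"
      using iV[of n] Y_integrable[of n] Vb by (intro integral_mono) auto
    finally show ?thesis by simp
  qed
  have s0': "s > 0" using s0 by (simp add: s_def)
  show thesis
  proof (rule that[of "4 * L / s"])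
    show "0 \<le> 4 * L / s" using L s0' by simp
    fix n
    have "s / 2 * (\<Sum>t<n. occ K t) \<le> 2 * L * expectation (\<lambda>\<omega>. \<bar>Y n \<omega>\<bar>) + 2 * L * expectation (\<lambda>\<omega>. \<bar>Y 0 \<omega>\<bar>)"
      using tel[of n] EV[of n] EV[of 0] by linarith
    also have "\<dots> = 2 * L * (expectation (\<lambda>\<omega>. \<bar>Y n \<omega>\<bar>) + expectation (\<lambda>\<omega>. \<bar>Y0 \<omega>\<bar>))"
      by (simp add: distrib_left Y_0)
    finally show "(\<Sum>t<n. occ K t) \<le> 4 * L / s * (expectation (\<lambda>\<omega>. \<bar>Y n \<omega>\<bar>) + expectation (\<lambda>\<omega>. \<bar>Y0 \<omega>\<bar>))"
      using s0' by (simp add: field_simps)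
  qed
qed

lemma abs_Y_over_n_tendsto_0: "(\<lambda>n. expectation (\<lambda>\<omega>. \<bar>Y n \<omega>\<bar>) / n) \<longlonglongrightarrow> 0"
proof -
  obtain C where C: "C \<ge> 0" "\<And>t. expectation (\<lambda>\<omega>. (Y t \<omega>)\<^sup>2) \<le> expectation (\<lambda>\<omega>. (Y0 \<omega>)\<^sup>2) + C * real t"
    using Y_second_moment_linear by blast
  let ?E0 = "expectation (\<lambda>\<omega>. (Y0 \<omega>)\<^sup>2)"
  have bound: "expectation (\<lambda>\<omega>. \<bar>Y n \<omega>\<bar>) / n \<le> ((?E0 + C * n) / sqrt n + sqrt n) / n" if "n > 0" for n
  proof (rule divide_right_mono)
    \<comment> \<open>A square completed with weight sqrt n takes the place of the Cauchy-Schwarz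
      inequality and keeps everything linear in the second moment.\<close>
    have pw: "\<bar>x\<bar> \<le> x\<^sup>2 / sqrt n + sqrt n" for x
    proof -
      have "0 \<le> (\<bar>x\<bar> - sqrt n)\<^sup>2" by simp
      then have "\<bar>x\<bar> * sqrt n * 2 \<le> x\<^sup>2 + sqrt n * sqrt n" by (simp add: power2_diff)
      moreover have "0 \<le> \<bar>x\<bar> * sqrt n" by simp
      ultimately have "\<bar>x\<bar> * sqrt n \<le> x\<^sup>2 + sqrt n * sqrt n" by linarith
      then have "\<bar>x\<bar> \<le> (x\<^sup>2 + sqrt n * sqrt n) / sqrt n" using that by (subst pos_le_divide_eq) auto
      then show ?thesis using that by (simp add: add_divide_distrib real_div_sqrt)
    qed
    have "expectation (\<lambda>\<omega>. \<bar>Y n \<omega>\<bar>) \<le> expectation (\<lambda>\<omega>. (Y n \<omega>)\<^sup>2 / sqrt n + sqrt n)"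
      using Y_integrable[of n] Y_sq_integrable[of n] pw by (intro integral_mono) auto
    also have "\<dots> = expectation (\<lambda>\<omega>. (Y n \<omega>)\<^sup>2) / sqrt n + sqrt n"
      using Y_sq_integrable[of n] by (simp add: prob_space)
    also have "\<dots> \<le> (?E0 + C * n) / sqrt n + sqrt n"
      using C(2)[of n] by (intro add_right_mono divide_right_mono) auto
    finally show "expectation (\<lambda>\<omega>. \<bar>Y n \<omega>\<bar>) \<le> (?E0 + C * n) / sqrt n + sqrt n" .
  qed simp
  have "(\<lambda>n::nat. 1 / (sqrt n * n)) \<longlonglongrightarrow> 0" "(\<lambda>n::nat. n / (sqrt n * n)) \<longlonglongrightarrow> 0" "(\<lambda>n::nat. sqrt n / n) \<longlonglongrightarrow> 0"
    by real_asymp+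
  then have "(\<lambda>n::nat. ?E0 * (1 / (sqrt n * n)) + C * (n / (sqrt n * n)) + sqrt n / n) \<longlonglongrightarrow> ?E0 * 0 + C * 0 + 0"
    by (intro tendsto_intros)
  moreover have "((?E0 + C * n) / sqrt n + sqrt n) / n = ?E0 * (1 / (sqrt n * n)) + C * (n / (sqrt n * n)) + sqrt n / n" for n :: nat
    by (cases "n = 0") (simp_all add: add_divide_distrib)
  ultimately have "(\<lambda>n::nat. ((?E0 + C * n) / sqrt n + sqrt n) / n) \<longlonglongrightarrow> 0" by simp
  then show ?thesis
    by (rule tendsto_sandwich[rotated 2, OF tendsto_const])
      (auto intro!: eventually_mono[OF eventually_gt_at_top[of 0]] bound)
qed

lemma occupation_tendsto_0:
  assumes K: "K \<ge> 0"
  shows "(\<lambda>n. (\<Sum>t<n. occ K t) / n) \<longlonglongrightarrow> 0"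
proof -
  obtain c where c: "c \<ge> 0" "\<And>n. (\<Sum>t<n. occ K t)
    \<le> c * (expectation (\<lambda>\<omega>. \<bar>Y n \<omega>\<bar>) + expectation (\<lambda>\<omega>. \<bar>Y0 \<omega>\<bar>))"
    using occupation_bound[OF K] by blast
  let ?u = "\<lambda>n. c * (expectation (\<lambda>\<omega>. \<bar>Y n \<omega>\<bar>) / n + expectation (\<lambda>\<omega>. \<bar>Y0 \<omega>\<bar>) / n)"
  have "?u \<longlonglongrightarrow> c * (0 + 0)"
    by (intro tendsto_mult tendsto_add tendsto_const abs_Y_over_n_tendsto_0 lim_const_over_n)
  then have u: "?u \<longlonglongrightarrow> 0" by simp
  show ?thesis
  proof (rule tendsto_sandwich[OF _ _ tendsto_const u])
    show "\<forall>\<^sub>F n in sequentially. 0 \<le> (\<Sum>t<n. occ K t) / n"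
      by (intro always_eventually allI divide_nonneg_nonneg sum_nonneg Bochner_Integration.integral_nonneg) auto
    show "\<forall>\<^sub>F n in sequentially. (\<Sum>t<n. occ K t) / n \<le> ?u n"
      using divide_right_mono[OF c(2)] by (intro always_eventually allI) (simp add: add_divide_distrib[symmetric])
  qed
qed

text \<open>The order of choices matters: first \<open>K\<close>, with \<open>tail_bound K\<close>
  below e/16 so that the factor 8 of \<open>bad_Y_le\<close> gives e/2 for all times at once, then
  \<open>n\<close>, for which the occupation time of the now fixed interval is negligible.\<close>

lemma bad_average_tendsto_0:
  "(\<lambda>n. (\<Sum>t<n. expectation (\<lambda>\<omega>. below t \<omega>)) / n) \<longlonglongrightarrow> 0"
proof (rule LIMSEQ_I)
  fix e :: real assume e: "e > 0"
  let ?bad = "\<lambda>t. expectation (\<lambda>\<omega>. below t \<omega>)"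
  have "\<forall>\<^sub>F k in sequentially. tail_bound (real k) < e / 16"
    using e by (intro order_tendstoD(2)[OF tail_bound_tendsto_0]) simp
  then obtain k where k: "tail_bound (real k) < e / 16" "k \<ge> nat \<lceil>1 + \<bar>r\<bar>\<rceil>"
    using eventually_conj[OF _ eventually_ge_at_top[of "nat \<lceil>1 + \<bar>r\<bar>\<rceil>"]] eventually_happens'[OF sequentially_bot] by blast
  define K where "K = real k"
  have "K \<ge> 1 + \<bar>r\<bar>" using k(2) unfolding K_def by linarith
  then have K: "K \<ge> 1" "2 * K \<ge> \<bar>r\<bar>" by auto
  have "(\<lambda>n. (1 + 4 * K\<^sup>2) * ((\<Sum>t<n. occ (2*K) t) / n)) \<longlonglongrightarrow> (1 + 4 * K\<^sup>2) * 0"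
    using K by (intro tendsto_mult_left occupation_tendsto_0) auto
  then have "\<forall>\<^sub>F n in sequentially. (1 + 4 * K\<^sup>2) * ((\<Sum>t<n. occ (2*K) t) / n) < e / 2"
    using e by (intro order_tendstoD(2)) auto
  then obtain no where no: "\<And>n. n \<ge> no \<Longrightarrow> (1 + 4 * K\<^sup>2) * ((\<Sum>t<n. occ (2*K) t) / n) < e / 2"
    unfolding eventually_sequentially by blast
  show "\<exists>no. \<forall>n\<ge>no. norm ((\<Sum>t<n. ?bad t) / n - 0) < e"
  proof (intro exI[of _ "Suc no"] allI impI)
    fix n assume n: "n \<ge> Suc no"
    have "(\<Sum>t<n. ?bad t) \<le> (\<Sum>t<n. (1 + 4 * K\<^sup>2) * occ (2*K) t + 8 * tail_bound K)"
      by (intro sum_mono bad_Y_le K)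
    also have "\<dots> = (1 + 4 * K\<^sup>2) * (\<Sum>t<n. occ (2*K) t) + n * (8 * tail_bound K)"
      by (simp add: sum.distrib sum_distrib_left)
    finally have "(\<Sum>t<n. ?bad t) / n \<le> ((1 + 4 * K\<^sup>2) * (\<Sum>t<n. occ (2*K) t) + n * (8 * tail_bound K)) / n"
      by (rule divide_right_mono) simp
    also have "\<dots> = (1 + 4 * K\<^sup>2) * ((\<Sum>t<n. occ (2*K) t) / n) + 8 * tail_bound K"
      using n by (simp add: add_divide_distrib)
    finally have "(\<Sum>t<n. ?bad t) / n < e"
      using no[of n] n k(1) unfolding K_def by linarith
    moreover have "0 \<le> (\<Sum>t<n. ?bad t) / n"
      by (intro divide_nonneg_nonneg sum_nonneg Bochner_Integration.integral_nonneg) (auto simp: add_nonneg_nonneg)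
    ultimately show "norm ((\<Sum>t<n. ?bad t) / n - 0) < e" by simp
  qed
qed

end

section \<open>Numerator and denominator of the estimator\<close>

context tar_process
begin

text \<open>The Lindeberg condition in another form. The quadratic branch of the minimum supplies
  the dominating function eps^2 / var, the cubic branch the pointwise decay of order 1 / sqrt n; no
  third moment is assumed.\<close>

lemma scaled_third_moment_tendsto_0:
  "(\<lambda>n. n * expectation (\<lambda>\<omega>. min ((eps 1 \<omega> / sqrt (n * var))\<^sup>2) (\<bar>eps 1 \<omega> / sqrt (n * var)\<bar> ^ 3))) \<longlonglongrightarrow> 0"
proof -
  let ?f = "\<lambda>(n::nat) \<omega>. n * min ((eps 1 \<omega> / sqrt (n * var))\<^sup>2) (\<bar>eps 1 \<omega> / sqrt (n * var)\<bar> ^ 3)"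
  have "(\<lambda>n. expectation (?f n)) \<longlonglongrightarrow> expectation (\<lambda>\<omega>. 0)"
  proof (rule integral_dominated_convergence)
    show "integrable M (\<lambda>\<omega>. (eps 1 \<omega>)\<^sup>2 / var)" using eps_sq by simp
    have "norm (?f n \<omega>) \<le> (eps 1 \<omega>)\<^sup>2 / var" for n \<omega>
    proof (cases "n = 0")
      case True then show ?thesis using var_pos by simp
    next
      case False
      have "norm (?f n \<omega>) = ?f n \<omega>" by simp
      also have "\<dots> \<le> n * (eps 1 \<omega> / sqrt (n * var))\<^sup>2" by (intro mult_left_mono) auto
      also have "\<dots> = (eps 1 \<omega>)\<^sup>2 / var" using False var_pos by (simp add: power_divide)
      finally show ?thesis .
    qed
    then show "AE \<omega> in M. norm (?f n \<omega>) \<le> (eps 1 \<omega>)\<^sup>2 / var" for n by simp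
    show "AE \<omega> in M. (\<lambda>n. ?f n \<omega>) \<longlonglongrightarrow> 0"
    proof (intro AE_I2)
      fix \<omega>
      define c where "c = \<bar>eps 1 \<omega>\<bar> ^ 3"
      have v: "var > 0" by (rule var_pos)
      have "(\<lambda>n::nat. n / sqrt n ^ 3) \<longlonglongrightarrow> 0"
        by real_asymp
      from tendsto_mult_right_zero[OF this, of "c / sqrt var ^ 3"]
      have lim: "(\<lambda>n::nat. n * (c / sqrt (n * var) ^ 3)) \<longlonglongrightarrow> 0"
        by (simp add: real_sqrt_mult power_mult_distrib mult.commute)
      show "(\<lambda>n. ?f n \<omega>) \<longlonglongrightarrow> 0"
      proof (rule Lim_null_comparison[OF _ lim], intro always_eventually allI)
        fix n :: nat
        have "norm (?f n \<omega>) = ?f n \<omega>" by simp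
        also have "\<dots> \<le> n * \<bar>eps 1 \<omega> / sqrt (n * var)\<bar> ^ 3" by (intro mult_left_mono) auto
        also have "\<dots> = n * (c / sqrt (n * var) ^ 3)" using v by (simp add: c_def power_divide)
        finally show "norm (?f n \<omega>) \<le> n * (c / sqrt (n * var) ^ 3)" .
      qed
    qed
  qed auto
  then show ?thesis by simp
qed

text \<open>The general error bound is applied to the path divided by sqrt (n var), which moves the
  threshold to \<open>r / s\<close>. The initial value is divided by n, the Taylor errors vanish by
  the Lindeberg condition, and the steps below the threshold by
  \<open>bad_average_tendsto_0\<close>, since y^2 + 1/n is at most \<open>1 + 1 / var\<close> times
  (1 + Y^2) / n.\<close>

lemma tar_laplace_tendsto_0:
  assumes lam: "0 \<le> lam" and mu: "0 \<le> mu"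
  shows "(\<lambda>n. expectation (\<lambda>\<omega>. exp (- lam * ((Y n \<omega>)\<^sup>2 / (n * var)) - mu * ((\<Sum>t<n. (Y t \<omega>)\<^sup>2) / ((real n)\<^sup>2 * var))))
    - exp (- riccati_sum lam mu n n)) \<longlonglongrightarrow> 0"
proof -
  define L where "L = lam + mu + 1"
  define eta where "eta n = expectation (\<lambda>\<omega>. min ((eps 1 \<omega> / sqrt (n * var))\<^sup>2) (\<bar>eps 1 \<omega> / sqrt (n * var)\<bar> ^ 3))" for n :: nat
  define bad where "bad t = expectation (\<lambda>\<omega>. below t \<omega>)" for t
  define E0 where "E0 = expectation (\<lambda>\<omega>. (Y0 \<omega>)\<^sup>2)"
  let ?err = "\<lambda>n. L * (E0 / var / n) + 66 * L\<^sup>2 * (n * eta n + 1 / n)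
      + 4 * L * (1 + beta\<^sup>2) * ((1 + 1 / var) * ((\<Sum>t<n. bad t) / n))"
  have "?err \<longlonglongrightarrow> L * 0 + 66 * L\<^sup>2 * (0 + 0) + 4 * L * (1 + beta\<^sup>2) * ((1 + 1 / var) * 0)"
    unfolding eta_def bad_def
    by (intro tendsto_add tendsto_mult tendsto_const scaled_third_moment_tendsto_0 bad_average_tendsto_0 lim_const_over_n)
  then have err: "?err \<longlonglongrightarrow> 0" by simp
  show ?thesis
  proof (rule Lim_null_comparison[OF _ err])
    show "\<forall>\<^sub>F n in sequentially. norm (expectation (\<lambda>\<omega>. exp (- lam * ((Y n \<omega>)\<^sup>2 / (n * var)) - mu * ((\<Sum>t<n. (Y t \<omega>)\<^sup>2) / ((real n)\<^sup>2 * var))))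
      - exp (- riccati_sum lam mu n n)) \<le> ?err n"
      using eventually_ge_at_top[of "nat \<lceil>4 * L\<rceil>"]
    proof eventually_elim
      case (elim n)
      then have n: "real n \<ge> 4 * L" by linarith
      have L1: "L \<ge> 1" using lam mu by (simp add: L_def)
      have n0: "n > 0" "real n > 0" using n L1 by (auto intro!: Nat.gr0I)
      define s where "s = sqrt (n * var)"
      have s: "s > 0" "s\<^sup>2 = n * var" using n0 var_pos by (auto simp: s_def)
      define y where "y t \<omega> = Y t \<omega> / s" for t \<omega>
      define h where "h t \<omega> = eps (Suc t) \<omega> / s" for t \<omega>
      let ?b = "\<lambda>t \<omega>. indicat_real {..r / s} (y t \<omega>) * ((y t \<omega>)\<^sup>2 + 1 / n)"
      have main: "\<bar>expectation (\<lambda>\<omega>. exp (- lam * (y n \<omega>)\<^sup>2 - mu / n * (\<Sum>t<n. (y t \<omega>)\<^sup>2))) - exp (- riccati_sum lam mu n n)\<bar>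
        \<le> L * expectation (\<lambda>\<omega>. (y 0 \<omega>)\<^sup>2) + 66 * L\<^sup>2 * (n * eta n + 1 / n)
          + 4 * L * (1 + beta\<^sup>2) * (\<Sum>t<n. expectation (\<lambda>\<omega>. ?b t \<omega>))"
      proof (rule laplace_quadratic_functional_error[where h = h, OF _ _ _ _ _ _ _ _ _ lam mu L_def n])
        fix t and f :: "(nat \<Rightarrow> real) \<Rightarrow> real"
        assume f [measurable]: "f \<in> borel_measurable (Pi\<^sub>M {..t} (\<lambda>_. borel))"
        have m: "(\<lambda>p. f (\<lambda>i\<in>{..t}. p i / s)) \<in> borel_measurable (Pi\<^sub>M {..t} (\<lambda>_. borel))"
          by (intro measurable_compose[OF _ f] measurable_restrict) measurable
        have "indep_var borel ((\<lambda>x. x) \<circ> (\<lambda>\<omega>. f (\<lambda>i\<in>{..t}. (\<lambda>i\<in>{..t}. Y i \<omega>) i / s))) borel ((\<lambda>x. x / s) \<circ> eps (Suc t))"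
          by (rule indep_var_compose[OF indep_past[OF m]]) measurable
        moreover have "(\<lambda>i\<in>{..t}. (\<lambda>i\<in>{..t}. Y i \<omega>) i / s) = (\<lambda>i\<in>{..t}. y i \<omega>)" for \<omega>
          by (intro restrict_ext) (simp add: y_def)
        ultimately show "indep_var borel (\<lambda>\<omega>. f (\<lambda>i\<in>{..t}. y i \<omega>)) borel (h t)"
          by (simp add: comp_def h_def[abs_def])
      next
        show "y t \<in> borel_measurable M" for t unfolding y_def[abs_def] by measurable
        show "integrable M (\<lambda>\<omega>. (y t \<omega>)\<^sup>2)" for t
          unfolding y_def using Y_sq_integrable[of t] by (simp add: power_divide)
        show "integrable M (\<lambda>\<omega>. (h t \<omega>)\<^sup>2)" for t
          unfolding h_def using eps_integrable(2)[of t] by (simp add: power_divide)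
        show "expectation (h t) = 0" for t
          unfolding h_def[abs_def] using eps_moments(1)[of t] by simp
        show "expectation (\<lambda>\<omega>. (h t \<omega>)\<^sup>2) = 1 / n" for t
          unfolding h_def using eps_moments(2)[of t] s n0 var_pos by (simp add: power_divide)
        show "expectation (\<lambda>\<omega>. min ((h t \<omega>)\<^sup>2) (\<bar>h t \<omega>\<bar> ^ 3)) \<le> eta n" for t
          unfolding h_def eta_def s_def
          by (rule eq_refl, rule expectation_eps[where g = "\<lambda>x. min ((x / sqrt (n * var))\<^sup>2) (\<bar>x / sqrt (n * var)\<bar> ^ 3)"]) measurable
        show "y (Suc t) \<omega> = (if y t \<omega> \<in> {..r / s} then beta * y t \<omega> else y t \<omega>) + h t \<omega>" for t \<omega>
          using s by (simp add: y_def h_def Y_Suc reg_def add_divide_distrib divide_le_cancel)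
      qed simp
      have functional: "(\<lambda>\<omega>. exp (- lam * ((Y n \<omega>)\<^sup>2 / (n * var)) - mu * ((\<Sum>t<n. (Y t \<omega>)\<^sup>2) / ((real n)\<^sup>2 * var))))
         = (\<lambda>\<omega>. exp (- lam * (y n \<omega>)\<^sup>2 - mu / n * (\<Sum>t<n. (y t \<omega>)\<^sup>2)))"
        using s n0 by (simp add: y_def power_divide sum_divide_distrib[symmetric] power2_eq_square mult.assoc)
      have initial: "expectation (\<lambda>\<omega>. (y 0 \<omega>)\<^sup>2) = E0 / var / n"
        using s by (simp add: y_def Y_0 E0_def power_divide)
      have "(\<Sum>t<n. expectation (\<lambda>\<omega>. ?b t \<omega>)) \<le> (1 + 1 / var) * ((\<Sum>t<n. bad t) / n)"
      proof -
        have "expectation (\<lambda>\<omega>. ?b t \<omega>) \<le> (1 + 1 / var) / n * bad t" for t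
        proof -
          have "expectation (\<lambda>\<omega>. ?b t \<omega>)
             \<le> expectation (\<lambda>\<omega>. (1 + 1 / var) / n * below t \<omega>)"
          proof (rule integral_mono)
            have pw: "?b t \<omega> \<le> (1 + 1 / var) / n * below t \<omega>" for \<omega>
            proof -
              have i: "indicat_real {..r / s} (y t \<omega>) = indicat_real {..r} (Y t \<omega>)"
                using s by (simp add: indicator_def y_def divide_le_cancel)
              have "(1 + 1 / var) / n * (1 + (Y t \<omega>)\<^sup>2) - ((y t \<omega>)\<^sup>2 + 1 / n) = (Y t \<omega>)\<^sup>2 / n + 1 / var / n"
                using s n0 var_pos by (simp add: y_def power_divide) (simp add: field_simps)
              moreover have "0 \<le> (Y t \<omega>)\<^sup>2 / n + 1 / var / n" using var_pos by simp
              ultimately have "(y t \<omega>)\<^sup>2 + 1 / n \<le> (1 + 1 / var) / n * (1 + (Y t \<omega>)\<^sup>2)" by linarith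
              then show ?thesis unfolding i by (simp add: indicator_def)
            qed
            show "integrable M (\<lambda>\<omega>. (1 + 1 / var) / n * below t \<omega>)"
              by (intro integrable_mult_right bad_Y_integrable)
            show "?b t \<omega> \<le> (1 + 1 / var) / n * below t \<omega>" for \<omega>
              by (rule pw)
            have [measurable]: "y t \<in> borel_measurable M" unfolding y_def[abs_def] by measurable
            have "\<bar>1 + 1 / var\<bar> = 1 + 1 / var" using var_pos by simp
            note abs_var = this
            show "integrable M (\<lambda>\<omega>. ?b t \<omega>)"
            proof (rule Bochner_Integration.integrable_bound[OF integrable_mult_right[OF bad_Y_integrable[of t], of "(1 + 1 / var) / n"]])
              show "AE \<omega> in M. norm (?b t \<omega>)
                  \<le> norm ((1 + 1 / var) / n * below t \<omega>)"
                using pw abs_var by (intro AE_I2) (simp add: abs_mult)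
            qed simp
          qed
          then show ?thesis by (simp add: bad_def)
        qed
        then have "(\<Sum>t<n. expectation (\<lambda>\<omega>. ?b t \<omega>)) \<le> (\<Sum>t<n. (1 + 1 / var) / n * bad t)"
          by (intro sum_mono)
        then show ?thesis unfolding sum_distrib_left[symmetric] by simp
      qed
      then have bad_le: "4 * L * (1 + beta\<^sup>2) * (\<Sum>t<n. expectation (\<lambda>\<omega>. ?b t \<omega>))
        \<le> 4 * L * (1 + beta\<^sup>2) * ((1 + 1 / var) * ((\<Sum>t<n. bad t) / n))"
        using L1 by (intro mult_left_mono) auto
      show ?case
        unfolding real_norm_def functional
        by (rule order_trans[OF main[unfolded initial] add_left_mono[OF bad_le]])
    qed
  qed
qed

section \<open>Law of large numbers for the squared innovations\<close>

lemma truncated_sum_second_moment: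
  fixes k :: "real \<Rightarrow> real"
  assumes k [measurable]: "k \<in> borel_measurable borel" and kb: "\<And>x. \<bar>k x\<bar> \<le> C"
    and Ek: "expectation (\<lambda>\<omega>. k (eps 1 \<omega>)) = 0"
  shows "integrable M (\<lambda>\<omega>. (\<Sum>t<n. k (eps (Suc t) \<omega>))\<^sup>2) \<and> expectation (\<lambda>\<omega>. (\<Sum>t<n. k (eps (Suc t) \<omega>))\<^sup>2) \<le> n * C\<^sup>2"
proof (induction n)
  case (Suc n)
  let ?S = "\<lambda>\<omega>. \<Sum>t<n. k (eps (Suc t) \<omega>)" and ?x = "\<lambda>\<omega>. k (eps (Suc n) \<omega>)"
  have C0: "C \<ge> 0" using kb[of 0] by linarith
  have ik: "integrable M (\<lambda>\<omega>. k (eps (Suc t) \<omega>))" for t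
    using kb by (intro integrable_const_bound[of _ C]) auto
  have k2: "(k x)\<^sup>2 \<le> C\<^sup>2" for x using kb[of x] C0 by (simp add: abs_le_square_iff[symmetric])
  have ik2: "integrable M (\<lambda>\<omega>. (?x \<omega>)\<^sup>2)"
    using k2 by (intro integrable_const_bound[of _ "C\<^sup>2"]) auto
  have iS: "integrable M ?S" using ik by simp
  \<comment> \<open>The innovations are read off from the path as Y (t+1) - reg (Y t). The partial
    sum is thus a function of the path up to time \<open>n\<close>, and \<open>indep_past\<close>
    makes it independent of the next innovation.\<close>
  define f where "f p = (\<Sum>t<n. k (p (Suc t) - reg (p t)))" for p :: "nat \<Rightarrow> real"
  have "f \<in> borel_measurable (Pi\<^sub>M {..n} (\<lambda>_. borel))"
    unfolding f_def[abs_def] by measurable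
  from indep_past[OF this] have "indep_var borel ?S borel (eps (Suc n))"
    by (simp add: f_def Y_Suc)
  note c = expectation_indep_mult[OF this k iS ik]
  have "expectation ?x = 0" using expectation_eps[OF k, of n] Ek by simp
  then have Ec: "expectation (\<lambda>\<omega>. ?S \<omega> * ?x \<omega>) = 0" using c(2) by simp
  have eq: "(\<lambda>\<omega>. (\<Sum>t<Suc n. k (eps (Suc t) \<omega>))\<^sup>2) = (\<lambda>\<omega>. (?S \<omega>)\<^sup>2 + (?x \<omega>)\<^sup>2 + 2 * (?S \<omega> * ?x \<omega>))"
    by (simp add: power2_sum mult.assoc)
  have "expectation (\<lambda>\<omega>. (?x \<omega>)\<^sup>2) \<le> expectation (\<lambda>\<omega>. C\<^sup>2)"
    using ik2 k2 by (intro integral_mono) auto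
  then have "expectation (\<lambda>\<omega>. (?S \<omega>)\<^sup>2) + expectation (\<lambda>\<omega>. (?x \<omega>)\<^sup>2) \<le> Suc n * C\<^sup>2"
    using Suc by (simp add: prob_space algebra_simps)
  then show ?case unfolding eq using Suc ik2 c(1) Ec by simp
qed simp

abbreviation lln_error :: "nat \<Rightarrow> 'a \<Rightarrow> real" where
  "lln_error n \<omega> \<equiv> \<bar>(\<Sum>t<n. (eps (Suc t) \<omega>)\<^sup>2) / (n * var) - 1\<bar>"

text \<open>The squares need not have a variance, so they are truncated: the bounded centred part
  has a sum with second moment O(n), and the discarded part is small in mean, uniformly in
  \<open>n\<close>. Convergence in mean is the form required, because errors enter the transforms
  through a Lipschitz bound.\<close>

lemma weak_law_eps_sq:
  "(\<lambda>n. expectation (\<lambda>\<omega>. lln_error n \<omega>)) \<longlonglongrightarrow> 0"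
proof (rule LIMSEQ_I)
  fix e :: real assume e: "e > 0"
  define ev where "ev = e * var"
  have ev: "ev > 0" using e var_pos by (simp add: ev_def)
  define tl where "tl m x = indicat_real {real m<..} (x\<^sup>2) * x\<^sup>2" for m :: nat and x :: real
  have tl_meas [measurable]: "tl m \<in> borel_measurable borel" for m unfolding tl_def[abs_def] by measurable
  have tl_b: "0 \<le> tl m x" "tl m x \<le> x\<^sup>2" for m x by (auto simp: tl_def indicator_def)
  have itl: "integrable M (\<lambda>\<omega>. tl m (eps 1 \<omega>))" for m
    by (rule Bochner_Integration.integrable_bound[OF eps_sq]) (use tl_b in auto)
  have "(\<lambda>m. expectation (\<lambda>\<omega>. tl m (eps 1 \<omega>))) \<longlonglongrightarrow> expectation (\<lambda>\<omega>. 0)"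
  proof (rule integral_dominated_convergence[OF _ _ eps_sq])
    show "AE \<omega> in M. (\<lambda>m. tl m (eps 1 \<omega>)) \<longlonglongrightarrow> 0"
    proof (intro AE_I2 tendsto_eventually)
      fix \<omega>
      show "\<forall>\<^sub>F m in sequentially. tl m (eps 1 \<omega>) = 0"
        using eventually_ge_at_top[of "nat \<lceil>(eps 1 \<omega>)\<^sup>2\<rceil>"]
      proof eventually_elim
        case (elim m)
        then have "(eps 1 \<omega>)\<^sup>2 \<le> real m" by linarith
        then show ?case by (simp add: tl_def)
      qed
    qed
  qed (use tl_b in auto)
  then have "\<forall>\<^sub>F m in sequentially. expectation (\<lambda>\<omega>. tl m (eps 1 \<omega>)) < ev / 4"
    using ev by (intro order_tendstoD(2)) auto
  then obtain m where m: "expectation (\<lambda>\<omega>. tl m (eps 1 \<omega>)) < ev / 4"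
    using eventually_happens'[OF sequentially_bot] by blast
  define T where "T = expectation (\<lambda>\<omega>. tl m (eps 1 \<omega>))"
  \<comment> \<open>The mean of the truncated square, so that \<open>k\<close> below is centred. It
    falls short of \<open>var\<close> by \<open>T\<close>, and the discarded part has mean
    \<open>T\<close> itself; hence 2 * T in the bound.\<close>
  define a where "a = var - T"
  have T: "0 \<le> T" "T < ev / 4" using m tl_b unfolding T_def by (auto intro!: Bochner_Integration.integral_nonneg)
  define k where "k x = x\<^sup>2 - tl m x - a" for x
  have k_meas: "k \<in> borel_measurable borel" unfolding k_def[abs_def] by measurable
  define C where "C = real m + \<bar>a\<bar>"
  have kb: "\<bar>k x\<bar> \<le> C" for x
  proof -
    have "0 \<le> x\<^sup>2 - tl m x" "x\<^sup>2 - tl m x \<le> real m" by (auto simp: tl_def indicator_def)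
    then show ?thesis unfolding k_def C_def by linarith
  qed
  have Ek: "expectation (\<lambda>\<omega>. k (eps 1 \<omega>)) = 0"
    using itl[of m] eps_sq by (simp add: k_def a_def T_def var_def prob_space)
  let ?S = "\<lambda>n \<omega>. \<Sum>t<n. k (eps (Suc t) \<omega>)"
  let ?Z = "\<lambda>n \<omega>. \<Sum>t<n. tl m (eps (Suc t) \<omega>)"
  note S = truncated_sum_second_moment[OF k_meas kb Ek]
  have iS: "integrable M (\<lambda>\<omega>. ?S n \<omega>)" for n
    by (intro Bochner_Integration.integrable_sum integrable_eps[OF k_meas])
      (use itl[of m] eps_sq in \<open>simp add: k_def\<close>)
  have iZ: "integrable M (\<lambda>\<omega>. ?Z n \<omega>)" for n
    by (intro Bochner_Integration.integrable_sum integrable_eps[OF tl_meas] itl)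
  have EZ: "expectation (\<lambda>\<omega>. ?Z n \<omega>) = n * T" for n
  proof -
    have "expectation (\<lambda>\<omega>. ?Z n \<omega>) = (\<Sum>t<n. expectation (\<lambda>\<omega>. tl m (eps (Suc t) \<omega>)))"
      by (intro Bochner_Integration.integral_sum integrable_eps[OF tl_meas] itl)
    also have "\<dots> = (\<Sum>t<n. T)"
      by (simp only: expectation_eps[OF tl_meas] T_def)
    finally show ?thesis by simp
  qed
  have bound: "expectation (\<lambda>\<omega>. lln_error n \<omega>) \<le> ((C\<^sup>2 + 1) * (1 / sqrt n) + 2 * T) / var" if n: "n > 0" for n
  proof -
    have sn: "sqrt n > 0" "sqrt n * sqrt n = n" using n by auto
    have pw: "lln_error n \<omega> \<le> (((?S n \<omega>)\<^sup>2 / sqrt n + sqrt n) / n + ?Z n \<omega> / n + T) / var" for \<omega>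
    proof -
      have "(\<Sum>t<n. (eps (Suc t) \<omega>)\<^sup>2) = ?S n \<omega> + ?Z n \<omega> + n * a"
        by (simp add: k_def sum.distrib sum_subtractf)
      then have eq: "(\<Sum>t<n. (eps (Suc t) \<omega>)\<^sup>2) / (n * var) - 1 = (?S n \<omega> / n + ?Z n \<omega> / n - T) / var"
        using n var_pos by (simp add: a_def field_simps)
      have "0 \<le> (\<bar>?S n \<omega>\<bar> - sqrt n)\<^sup>2" by simp
      also have "\<dots> = (?S n \<omega>)\<^sup>2 + n - 2 * (\<bar>?S n \<omega>\<bar> * sqrt n)" by (simp add: power2_diff)
      finally have "\<bar>?S n \<omega>\<bar> * sqrt n \<le> (?S n \<omega>)\<^sup>2 + n"
      proof -
        assume "0 \<le> (?S n \<omega>)\<^sup>2 + n - 2 * (\<bar>?S n \<omega>\<bar> * sqrt n)"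
        moreover have "0 \<le> \<bar>?S n \<omega>\<bar> * sqrt n" by simp
        ultimately show ?thesis by linarith
      qed
      then have "\<bar>?S n \<omega>\<bar> \<le> ((?S n \<omega>)\<^sup>2 + n) / sqrt n" using sn by (simp add: pos_le_divide_eq)
      then have "\<bar>?S n \<omega>\<bar> \<le> (?S n \<omega>)\<^sup>2 / sqrt n + sqrt n" using n by (simp add: add_divide_distrib real_div_sqrt)
      then have "\<bar>?S n \<omega>\<bar> / n \<le> ((?S n \<omega>)\<^sup>2 / sqrt n + sqrt n) / n" by (rule divide_right_mono) simp
      moreover have "\<bar>?S n \<omega> / n\<bar> = \<bar>?S n \<omega>\<bar> / n" by simp
      moreover have "0 \<le> ?Z n \<omega> / n" using tl_b by (intro divide_nonneg_nonneg sum_nonneg) auto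
      ultimately have "\<bar>?S n \<omega> / n + ?Z n \<omega> / n - T\<bar> \<le> ((?S n \<omega>)\<^sup>2 / sqrt n + sqrt n) / n + ?Z n \<omega> / n + T"
        using T by linarith
      then show ?thesis unfolding eq using var_pos by (simp add: divide_right_mono)
    qed
    have "expectation (\<lambda>\<omega>. lln_error n \<omega>) \<le> expectation (\<lambda>\<omega>. (((?S n \<omega>)\<^sup>2 / sqrt n + sqrt n) / n + ?Z n \<omega> / n + T) / var)"
      using S[of n] iZ[of n] eps_integrable(2) pw by (intro integral_mono) auto
    also have "\<dots> = ((expectation (\<lambda>\<omega>. (?S n \<omega>)\<^sup>2) / sqrt n + sqrt n) / n + expectation (?Z n) / n + T) / var"
      using S[of n] iZ[of n] by (simp add: prob_space)
    also have "\<dots> \<le> ((n * C\<^sup>2 / sqrt n + sqrt n) / n + n * T / n + T) / var"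
      unfolding EZ using S[of n] var_pos
      by (intro divide_right_mono add_right_mono) auto
    also have "\<dots> = ((C\<^sup>2 + 1) * (1 / sqrt n) + 2 * T) / var"
    proof -
      have "sqrt n / n = 1 / sqrt n" using n by (simp add: field_simps)
      then show ?thesis using n by (simp add: add_divide_distrib algebra_simps)
    qed
    finally show ?thesis .
  qed
  have "(\<lambda>n::nat. 1 / sqrt n) \<longlonglongrightarrow> 0" by real_asymp
  from tendsto_mult_right_zero[OF this, of "C\<^sup>2 + 1"]
  have "\<forall>\<^sub>F n::nat in sequentially. (C\<^sup>2 + 1) * (1 / sqrt n) < ev / 2"
    using ev by (intro order_tendstoD(2)) auto
  then obtain no :: nat where no: "\<And>n::nat. n \<ge> no \<Longrightarrow> (C\<^sup>2 + 1) * (1 / sqrt n) < ev / 2"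
    unfolding eventually_sequentially by blast
  show "\<exists>no. \<forall>n\<ge>no. norm (expectation (\<lambda>\<omega>. lln_error n \<omega>) - 0) < e"
  proof (intro exI[of _ "Suc no"] allI impI)
    fix n assume n: "n \<ge> Suc no"
    have "(C\<^sup>2 + 1) * (1 / sqrt n) + 2 * T < ev" using no[of n] n T by linarith
    then have "((C\<^sup>2 + 1) * (1 / sqrt n) + 2 * T) / var < e" using var_pos by (simp add: pos_divide_less_eq ev_def)
    with bound[of n] n have "expectation (\<lambda>\<omega>. lln_error n \<omega>) < e" by linarith
    moreover have "0 \<le> expectation (\<lambda>\<omega>. lln_error n \<omega>)"
      by (intro Bochner_Integration.integral_nonneg) auto
    ultimately show "norm (expectation (\<lambda>\<omega>. lln_error n \<omega>) - 0) < e" by simp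
  qed
qed

section \<open>The estimator as a quotient, and the errors of its two parts\<close>

definition num :: "nat \<Rightarrow> 'a \<Rightarrow> real" where
  "num n \<omega> = (\<Sum>t=1..<n. if Y t \<omega> > r then Y t \<omega> * eps (Suc t) \<omega> else 0)"

definition den :: "nat \<Rightarrow> 'a \<Rightarrow> real" where
  "den n \<omega> = (\<Sum>t=1..<n. if Y t \<omega> > r then (Y t \<omega>)\<^sup>2 else 0)"

lemma alpha_hat_eq:
  assumes "den n \<omega> \<noteq> 0"
  shows "alpha_hat r (tar_path 1 beta r (Y0 \<omega>) (\<lambda>t. eps t \<omega>)) n - 1 = num n \<omega> / den n \<omega>"
proof -
  have "(\<Sum>t=1..<n. if Y t \<omega> > r then Y t \<omega> * Y (Suc t) \<omega> else 0)
     = (\<Sum>t=1..<n. (if Y t \<omega> > r then (Y t \<omega>)\<^sup>2 else 0) + (if Y t \<omega> > r then Y t \<omega> * eps (Suc t) \<omega> else 0))"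
    by (intro sum.cong refl) (auto simp: Y_Suc reg_def power2_eq_square algebra_simps)
  also have "\<dots> = den n \<omega> + num n \<omega>"
    by (simp add: den_def num_def sum.distrib)
  finally have "alpha_hat r (\<lambda>t. Y t \<omega>) n = (den n \<omega> + num n \<omega>) / den n \<omega>"
    by (simp add: alpha_hat_def den_def)
  then show ?thesis using assms by (simp add: Y_def[abs_def] field_simps)
qed

lemma num_measurable [measurable]: "num n \<in> borel_measurable M"
  unfolding num_def[abs_def] by measurable

lemma den_measurable [measurable]: "den n \<in> borel_measurable M"
  unfolding den_def[abs_def] by measurable

lemma den_nonneg: "0 \<le> den n \<omega>"
  unfolding den_def by (intro sum_nonneg) auto

definition rem :: "nat \<Rightarrow> 'a \<Rightarrow> real" where
  "rem t \<omega> = indicat_real {..r} (Y t \<omega>) * ((beta\<^sup>2 - 1) * (Y t \<omega>)\<^sup>2 + 2 * beta * Y t \<omega> * eps (Suc t) \<omega>)"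

lemma Y_square_step:
  "(Y (Suc t) \<omega>)\<^sup>2 = (Y t \<omega>)\<^sup>2 + 2 * (if Y t \<omega> > r then Y t \<omega> * eps (Suc t) \<omega> else 0) + (eps (Suc t) \<omega>)\<^sup>2 + rem t \<omega>"
  by (simp add: Y_Suc reg_def rem_def power2_eq_square algebra_simps)

text \<open>The identity behind the form of the limit: the cross term of the squared recursion is
  the numerator of the estimator. Twice the numerator is therefore the final square minus the sum of
  the squared innovations, up to the initial value, the summand \<open>t = 0\<close> and the terms
  \<open>rem\<close>.\<close>

lemma Y_square_eq:
  "(Y n \<omega>)\<^sup>2 = (Y0 \<omega>)\<^sup>2 + 2 * (\<Sum>t<n. if Y t \<omega> > r then Y t \<omega> * eps (Suc t) \<omega> else 0) + (\<Sum>t<n. (eps (Suc t) \<omega>)\<^sup>2) + (\<Sum>t<n. rem t \<omega>)"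
  by (induction n) (simp_all add: Y_0 Y_square_step algebra_simps)

lemma rem_measurable [measurable]: "rem t \<in> borel_measurable M"
  unfolding rem_def[abs_def] by measurable

text \<open>Pointwise, \<open>rem t\<close> is bounded by the weight \<open>below t\<close> times a
  linear function of \<open>\<bar>eps (Suc t) \<omega>\<bar>\<close>. This innovation is independent
  of \<open>Y t\<close>, so its absolute moment factors out into the constant.\<close>

lemma rem_expectation_le:
  obtains C where "C \<ge> 0" "\<And>t. integrable M (rem t)"
    "\<And>t. expectation (\<lambda>\<omega>. \<bar>rem t \<omega>\<bar>) \<le> C * expectation (\<lambda>\<omega>. below t \<omega>)"
proof -
  define g where "g x = indicat_real {..r} x * (1 + x\<^sup>2)" for x
  have g_meas: "g \<in> borel_measurable borel" unfolding g_def[abs_def] by measurable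
  have ig: "integrable M (\<lambda>\<omega>. g (Y t \<omega>))" for t unfolding g_def by (rule bad_Y_integrable)
  have g0: "0 \<le> g x" for x by (simp add: g_def add_nonneg_nonneg)
  have abs_meas: "(\<lambda>x::real. \<bar>x\<bar>) \<in> borel_measurable borel" and ia: "integrable M (\<lambda>\<omega>. \<bar>eps 1 \<omega>\<bar>)"
    using eps_integrable(1)[of 0] by simp_all
  note c = expectation_Y_mult_eps[OF g_meas abs_meas ig ia]
  define e where "e = expectation (\<lambda>\<omega>. \<bar>eps 1 \<omega>\<bar>)"
  have e0: "e \<ge> 0" by (simp add: e_def)
  have pw: "\<bar>rem t \<omega>\<bar> \<le> (beta\<^sup>2 + 1) * g (Y t \<omega>) + 2 * \<bar>beta\<bar> * (g (Y t \<omega>) * \<bar>eps (Suc t) \<omega>\<bar>)" for t \<omega>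
  proof (cases "Y t \<omega> \<le> r")
    case True
    let ?y = "Y t \<omega>" and ?e = "eps (Suc t) \<omega>"
    have ge: "g ?y = 1 + ?y\<^sup>2" using True by (simp add: g_def)
    have "0 \<le> (\<bar>?y\<bar> - 1)\<^sup>2" by simp
    then have y1: "\<bar>?y\<bar> \<le> 1 + ?y\<^sup>2" by (simp add: power2_diff)
    have "\<bar>rem t \<omega>\<bar> \<le> \<bar>(beta\<^sup>2 - 1) * ?y\<^sup>2\<bar> + \<bar>2 * beta * ?y * ?e\<bar>"
      using True by (simp add: rem_def)
    also have "\<bar>(beta\<^sup>2 - 1) * ?y\<^sup>2\<bar> = \<bar>beta\<^sup>2 - 1\<bar> * ?y\<^sup>2" by (simp add: abs_mult)
    also have "\<dots> \<le> (beta\<^sup>2 + 1) * (1 + ?y\<^sup>2)"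
      by (intro mult_mono) (auto simp: abs_le_iff)
    also have "\<bar>2 * beta * ?y * ?e\<bar> = 2 * \<bar>beta\<bar> * (\<bar>?y\<bar> * \<bar>?e\<bar>)" by (simp add: abs_mult)
    also have "\<dots> \<le> 2 * \<bar>beta\<bar> * ((1 + ?y\<^sup>2) * \<bar>?e\<bar>)"
      using y1 by (intro mult_left_mono mult_right_mono) auto
    finally show ?thesis unfolding ge by simp
  next
    case False
    then show ?thesis by (simp add: rem_def g_def)
  qed
  have ib: "integrable M (\<lambda>\<omega>. (beta\<^sup>2 + 1) * g (Y t \<omega>) + 2 * \<bar>beta\<bar> * (g (Y t \<omega>) * \<bar>eps (Suc t) \<omega>\<bar>))" for t
    by (intro Bochner_Integration.integrable_add integrable_mult_right ig c)
  have ir: "integrable M (rem t)" for t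
  proof (rule Bochner_Integration.integrable_bound[OF ib[of t]])
    show "AE \<omega> in M. norm (rem t \<omega>) \<le> norm ((beta\<^sup>2 + 1) * g (Y t \<omega>) + 2 * \<bar>beta\<bar> * (g (Y t \<omega>) * \<bar>eps (Suc t) \<omega>\<bar>))"
      unfolding real_norm_def by (intro AE_I2 order_trans[OF pw abs_ge_self])
  qed simp
  have "expectation (\<lambda>\<omega>. \<bar>rem t \<omega>\<bar>) \<le> (beta\<^sup>2 + 1 + 2 * \<bar>beta\<bar> * e) * expectation (\<lambda>\<omega>. g (Y t \<omega>))" for t
  proof -
    have "expectation (\<lambda>\<omega>. \<bar>rem t \<omega>\<bar>) \<le> expectation (\<lambda>\<omega>. (beta\<^sup>2 + 1) * g (Y t \<omega>) + 2 * \<bar>beta\<bar> * (g (Y t \<omega>) * \<bar>eps (Suc t) \<omega>\<bar>))"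
      by (rule integral_mono[OF integrable_abs[OF ir] ib pw])
    also have "\<dots> = expectation (\<lambda>\<omega>. (beta\<^sup>2 + 1) * g (Y t \<omega>)) + expectation (\<lambda>\<omega>. 2 * \<bar>beta\<bar> * (g (Y t \<omega>) * \<bar>eps (Suc t) \<omega>\<bar>))"
      by (intro Bochner_Integration.integral_add integrable_mult_right ig c)
    also have "\<dots> = (beta\<^sup>2 + 1) * expectation (\<lambda>\<omega>. g (Y t \<omega>)) + 2 * \<bar>beta\<bar> * (expectation (\<lambda>\<omega>. g (Y t \<omega>)) * e)"
      unfolding integral_mult_right_zero c(2) e_def ..
    finally show ?thesis by (simp add: algebra_simps)
  qed
  then show thesis
    using that[of "beta\<^sup>2 + 1 + 2 * \<bar>beta\<bar> * e"] ir e0 unfolding g_def by simp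
qed

abbreviation num_error :: "nat \<Rightarrow> 'a \<Rightarrow> real" where
  "num_error n \<omega> \<equiv> \<bar>1 + 2 * num n \<omega> / (n * var) - (Y n \<omega>)\<^sup>2 / (n * var)\<bar>"

text \<open>Four errors add up: the law of large numbers, the initial square, the summand
  \<open>t = 0\<close> present in \<open>Y_square_eq\<close> but not in \<open>num\<close>, and the
  terms \<open>rem\<close>, whose average vanishes by \<open>bad_average_tendsto_0\<close>.\<close>

lemma num_error_tendsto_0:
  "(\<lambda>n. expectation (\<lambda>\<omega>. num_error n \<omega>)) \<longlonglongrightarrow> 0"
proof -
  obtain C where C: "C \<ge> 0" and ir: "\<And>t. integrable M (rem t)"
    and rem_le: "\<And>t. expectation (\<lambda>\<omega>. \<bar>rem t \<omega>\<bar>) \<le> C * expectation (\<lambda>\<omega>. below t \<omega>)"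
    using rem_expectation_le by blast
  define bad where "bad t = expectation (\<lambda>\<omega>. below t \<omega>)" for t
  \<comment> \<open>This dominates the initial square together with the doubled summand
    \<open>t = 0\<close>, since 2 |u v| <= u^2 + v^2.\<close>
  define Z where "Z \<omega> = 2 * (Y0 \<omega>)\<^sup>2 + (eps 1 \<omega>)\<^sup>2" for \<omega>
  have iZ: "integrable M Z" unfolding Z_def[abs_def] using Y0_sq eps_sq by simp
  let ?Q = "\<lambda>n \<omega>. lln_error n \<omega>"
  let ?err = "\<lambda>n. expectation (?Q n) + expectation Z / var / n + C / var * ((\<Sum>t<n. bad t) / n)"
  have "?err \<longlonglongrightarrow> 0 + 0 + C / var * 0"
    unfolding bad_def
    by (intro tendsto_add tendsto_mult tendsto_const weak_law_eps_sq bad_average_tendsto_0 lim_const_over_n)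
  then have err: "?err \<longlonglongrightarrow> 0" by simp
  show ?thesis
  proof (rule Lim_null_comparison[OF _ err])
    show "\<forall>\<^sub>F n in sequentially. norm (expectation (\<lambda>\<omega>. num_error n \<omega>)) \<le> ?err n"
      using eventually_gt_at_top[of 0]
    proof eventually_elim
      case (elim n)
      have nv: "n * var > 0" using elim var_pos by simp
      let ?B = "\<lambda>\<omega>. ?Q n \<omega> + (Z \<omega> / (n * var) + (\<Sum>t<n. \<bar>rem t \<omega>\<bar>) / (n * var))"
      have iQ: "integrable M (?Q n)"
        by (intro integrable_abs Bochner_Integration.integrable_diff integrable_divide_zero Bochner_Integration.integrable_sum eps_integrable(2)) simp_all
      have iB1: "integrable M (\<lambda>\<omega>. Z \<omega> / (n * var))" "integrable M (\<lambda>\<omega>. (\<Sum>t<n. \<bar>rem t \<omega>\<bar>) / (n * var))"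
        using iZ ir by auto
      have iB: "integrable M ?B" using iQ iB1 by (intro Bochner_Integration.integrable_add)
      have pw: "num_error n \<omega> \<le> ?B \<omega>" for \<omega>
      proof -
        let ?c = "if Y 0 \<omega> > r then Y 0 \<omega> * eps (Suc 0) \<omega> else 0"
        have "(\<Sum>t<n. if Y t \<omega> > r then Y t \<omega> * eps (Suc t) \<omega> else 0) = ?c + num n \<omega>"
          unfolding num_def lessThan_atLeast0 using elim by (subst sum.atLeast_Suc_lessThan) auto
        then have "2 * num n \<omega> - (Y n \<omega>)\<^sup>2 = - (\<Sum>t<n. (eps (Suc t) \<omega>)\<^sup>2) - ((Y0 \<omega>)\<^sup>2 + 2 * ?c) - (\<Sum>t<n. rem t \<omega>)"
          using Y_square_eq[of n \<omega>] by linarith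
        then have "1 + (2 * num n \<omega> - (Y n \<omega>)\<^sup>2) / (n * var)
           = 1 + (- (\<Sum>t<n. (eps (Suc t) \<omega>)\<^sup>2) - ((Y0 \<omega>)\<^sup>2 + 2 * ?c) - (\<Sum>t<n. rem t \<omega>)) / (n * var)" by simp
        then have eq: "1 + 2 * num n \<omega> / (n * var) - (Y n \<omega>)\<^sup>2 / (n * var)
           = - ((\<Sum>t<n. (eps (Suc t) \<omega>)\<^sup>2) / (n * var) - 1) - ((Y0 \<omega>)\<^sup>2 + 2 * ?c) / (n * var) - (\<Sum>t<n. rem t \<omega>) / (n * var)"
          by (simp add: diff_divide_distrib)
        have "\<bar>(Y0 \<omega>)\<^sup>2 + 2 * ?c\<bar> \<le> Z \<omega>"
        proof -
          have "0 \<le> (Y0 \<omega> - eps 1 \<omega>)\<^sup>2" "0 \<le> (Y0 \<omega> + eps 1 \<omega>)\<^sup>2" by simp_all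
          then have "\<bar>2 * (Y0 \<omega> * eps 1 \<omega>)\<bar> \<le> (Y0 \<omega>)\<^sup>2 + (eps 1 \<omega>)\<^sup>2"
            by (simp add: power2_diff power2_sum abs_le_iff algebra_simps)
          moreover have "\<bar>2 * ?c\<bar> \<le> \<bar>2 * (Y0 \<omega> * eps 1 \<omega>)\<bar>" by (simp add: Y_0)
          moreover have "0 \<le> (Y0 \<omega>)\<^sup>2" by simp
          ultimately show ?thesis unfolding Z_def by linarith
        qed
        then have "\<bar>((Y0 \<omega>)\<^sup>2 + 2 * ?c) / (n * var)\<bar> \<le> Z \<omega> / (n * var)"
          using nv by (simp only: abs_divide) (simp add: divide_right_mono)
        moreover have "\<bar>(\<Sum>t<n. rem t \<omega>) / (n * var)\<bar> \<le> (\<Sum>t<n. \<bar>rem t \<omega>\<bar>) / (n * var)"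
          using nv by (simp only: abs_divide) (simp add: divide_right_mono)
        ultimately show ?thesis unfolding eq by linarith
      qed
      have "norm (expectation (\<lambda>\<omega>. num_error n \<omega>))
         = expectation (\<lambda>\<omega>. num_error n \<omega>)"
        by (simp add: Bochner_Integration.integral_nonneg)
      also have "\<dots> \<le> expectation ?B"
      proof (rule integral_mono[OF _ iB pw])
        show "integrable M (\<lambda>\<omega>. num_error n \<omega>)"
        proof (rule Bochner_Integration.integrable_bound[OF iB])
          show "AE \<omega> in M. norm (num_error n \<omega>) \<le> norm (?B \<omega>)"
            unfolding real_norm_def abs_idempotent by (intro AE_I2 order_trans[OF pw abs_ge_self])
        qed simp
      qed
      also have "\<dots> = expectation (?Q n) + (expectation (\<lambda>\<omega>. Z \<omega> / (n * var)) + expectation (\<lambda>\<omega>. (\<Sum>t<n. \<bar>rem t \<omega>\<bar>) / (n * var)))"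
        by (subst Bochner_Integration.integral_add[OF iQ Bochner_Integration.integrable_add[OF iB1]],
            subst Bochner_Integration.integral_add[OF iB1]) (rule refl)
      also have "expectation (\<lambda>\<omega>. Z \<omega> / (n * var)) = expectation Z / var / n" by simp
      also have "expectation (\<lambda>\<omega>. (\<Sum>t<n. \<bar>rem t \<omega>\<bar>) / (n * var)) = (\<Sum>t<n. expectation (\<lambda>\<omega>. \<bar>rem t \<omega>\<bar>)) / (n * var)"
        using ir by simp
      also have "\<dots> \<le> (\<Sum>t<n. C * bad t) / (n * var)"
        using rem_le nv unfolding bad_def by (intro divide_right_mono sum_mono) auto
      also have "\<dots> = C / var * ((\<Sum>t<n. bad t) / n)"
        by (simp add: sum_distrib_left[symmetric] mult.commute)
      finally show ?case by simp
    qed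
  qed
qed

text \<open>Compared with the full sum of squares, \<open>den\<close> lacks the times at or below
  the threshold and the summand \<open>t = 0\<close>. Both are negligible already after division by
  n var, that is, with one power of n to spare.\<close>

lemma den_error_tendsto_0:
  "(\<lambda>n. expectation (\<lambda>\<omega>. \<bar>den n \<omega> / ((real n)\<^sup>2 * var) - (\<Sum>t<n. (Y t \<omega>)\<^sup>2) / ((real n)\<^sup>2 * var)\<bar>)) \<longlonglongrightarrow> 0"
proof -
  define bad where "bad t = expectation (\<lambda>\<omega>. below t \<omega>)" for t
  define E0 where "E0 = expectation (\<lambda>\<omega>. (Y0 \<omega>)\<^sup>2)"
  have E0: "E0 \<ge> 0" by (simp add: E0_def)
  have bad0: "bad t \<ge> 0" for t
    unfolding bad_def by (intro Bochner_Integration.integral_nonneg) (simp add: add_nonneg_nonneg)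
  let ?err = "\<lambda>n. E0 / var / n + 1 / var * ((\<Sum>t<n. bad t) / n)"
  have "?err \<longlonglongrightarrow> 0 + 1 / var * 0"
    unfolding bad_def
    by (intro tendsto_add tendsto_mult tendsto_const bad_average_tendsto_0 lim_const_over_n)
  then have err: "?err \<longlonglongrightarrow> 0" by simp
  show ?thesis
  proof (rule Lim_null_comparison[OF _ err])
    show "\<forall>\<^sub>F n in sequentially. norm (expectation (\<lambda>\<omega>. \<bar>den n \<omega> / ((real n)\<^sup>2 * var) - (\<Sum>t<n. (Y t \<omega>)\<^sup>2) / ((real n)\<^sup>2 * var)\<bar>)) \<le> ?err n"
      using eventually_gt_at_top[of 0]
    proof eventually_elim
      case (elim n)
      define v where "v = (real n)\<^sup>2 * var"
      have v: "v > 0" "v \<ge> n * var"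
      proof -
        show "v > 0" using elim var_pos by (simp add: v_def)
        have "real n * 1 \<le> real n * real n" using elim by (intro mult_left_mono) auto
        then have "real n * 1 * var \<le> real n * real n * var" using var_pos by (intro mult_right_mono) auto
        then show "v \<ge> n * var" by (simp add: v_def power2_eq_square)
      qed
      have nv: "n * var > 0" using elim var_pos by simp
      let ?b = "\<lambda>t \<omega>. below t \<omega>"
      let ?d = "\<lambda>\<omega>. \<bar>den n \<omega> / v - (\<Sum>t<n. (Y t \<omega>)\<^sup>2) / v\<bar>"
      let ?B = "\<lambda>\<omega>. (Y0 \<omega>)\<^sup>2 / v + (\<Sum>t<n. ?b t \<omega>) / v"
      have iB1: "integrable M (\<lambda>\<omega>. (Y0 \<omega>)\<^sup>2 / v)" "integrable M (\<lambda>\<omega>. (\<Sum>t<n. ?b t \<omega>) / v)"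
        by (intro integrable_divide_zero Bochner_Integration.integrable_sum bad_Y_integrable Y0_sq)+
      have pw: "?d \<omega> \<le> ?B \<omega>" for \<omega>
      proof -
        let ?g = "\<lambda>t. if Y t \<omega> > r then (Y t \<omega>)\<^sup>2 else 0"
        have g0: "(\<Sum>t<n. ?g t) = ?g 0 + den n \<omega>"
          unfolding den_def lessThan_atLeast0 using elim by (subst sum.atLeast_Suc_lessThan) auto
        have "(\<Sum>t<n. (Y t \<omega>)\<^sup>2) - (\<Sum>t<n. ?g t) = (\<Sum>t<n. (Y t \<omega>)\<^sup>2 - ?g t)" by (simp add: sum_subtractf)
        moreover have "(\<Sum>t<n. (Y t \<omega>)\<^sup>2 - ?g t) \<le> (\<Sum>t<n. ?b t \<omega>)"
          by (intro sum_mono) (auto simp: indicator_def)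
        moreover have "0 \<le> (\<Sum>t<n. (Y t \<omega>)\<^sup>2 - ?g t)" by (intro sum_nonneg) auto
        moreover have "0 \<le> ?g 0" "?g 0 \<le> (Y0 \<omega>)\<^sup>2" by (auto simp: Y_0)
        ultimately have "\<bar>den n \<omega> - (\<Sum>t<n. (Y t \<omega>)\<^sup>2)\<bar> \<le> (Y0 \<omega>)\<^sup>2 + (\<Sum>t<n. ?b t \<omega>)"
          using g0 by linarith
        then have "\<bar>den n \<omega> - (\<Sum>t<n. (Y t \<omega>)\<^sup>2)\<bar> / v \<le> ((Y0 \<omega>)\<^sup>2 + (\<Sum>t<n. ?b t \<omega>)) / v"
          using v by (intro divide_right_mono) auto
        moreover have "\<bar>den n \<omega> - (\<Sum>t<n. (Y t \<omega>)\<^sup>2)\<bar> / v = \<bar>(den n \<omega> - (\<Sum>t<n. (Y t \<omega>)\<^sup>2)) / v\<bar>"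
          using v by simp
        ultimately show ?thesis by (simp only: diff_divide_distrib add_divide_distrib)
      qed
      have iB: "integrable M ?B" by (rule Bochner_Integration.integrable_add[OF iB1])
      have "norm (expectation ?d)
         = expectation ?d"
        by (simp add: Bochner_Integration.integral_nonneg)
      also have "\<dots> \<le> expectation ?B"
      proof (rule integral_mono[OF _ iB pw])
        show "integrable M ?d"
        proof (rule Bochner_Integration.integrable_bound[OF iB])
          show "AE \<omega> in M. norm (?d \<omega>) \<le> norm (?B \<omega>)"
            unfolding real_norm_def abs_idempotent by (intro AE_I2 order_trans[OF pw abs_ge_self])
        qed simp
      qed
      also have "\<dots> = E0 / v + (\<Sum>t<n. bad t) / v"
        unfolding E0_def bad_def Bochner_Integration.integral_add[OF iB1]
        by (simp only: integral_divide_zero Bochner_Integration.integral_sum[OF bad_Y_integrable])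
      also have "\<dots> \<le> E0 / (n * var) + (\<Sum>t<n. bad t) / (n * var)"
        using v nv E0 bad0 by (intro add_mono divide_left_mono sum_nonneg) auto
      also have "\<dots> = ?err n" by (simp add: mult.commute)
      finally show ?case unfolding v_def .
    qed
  qed
qed

end

section \<open>Brownian motion\<close>

lemma riemann_sum_tendsto_integral:
  fixes f :: "real \<Rightarrow> real"
  assumes f: "continuous_on {0..1} f"
  shows "(\<lambda>n. (\<Sum>t<n. f (real t / real n)) / real n) \<longlonglongrightarrow> integral {0..1} f"
proof (rule LIMSEQ_I)
  fix e :: real assume e: "e > 0"
  have "uniformly_continuous_on {0..1} f" by (rule compact_uniformly_continuous[OF f]) simp
  then obtain d where d: "d > 0" "\<And>x y. x \<in> {0..1} \<Longrightarrow> y \<in> {0..1} \<Longrightarrow> \<bar>y - x\<bar> < d \<Longrightarrow> \<bar>f y - f x\<bar> < e / 2"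
    using e unfolding uniformly_continuous_on_def dist_real_def by (metis half_gt_zero)
  obtain N :: nat where N: "real N > 1 / d" using reals_Archimedean2 by blast
  show "\<exists>no. \<forall>n\<ge>no. norm ((\<Sum>t<n. f (real t / real n)) / real n - integral {0..1} f) < e"
  proof (intro exI[of _ "Suc N"] allI impI)
    fix n assume n: "n \<ge> Suc N"
    have n0: "real n > 0" using n by simp
    have "1 / d < real n" using N n by linarith
    then have nd: "1 / real n < d" using d n0 by (simp add: field_simps)
    \<comment> \<open>Induction along the grid, with an error proportional to the length covered, so
      that the local errors add up to at most e/2.\<close>
    have piece: "\<bar>integral {0..m / n} f - (\<Sum>t<m. f (real t / real n)) / real n\<bar> \<le> e / 2 * (m / n)" if "m \<le> n" for m :: nat
      using that
    proof (induction m)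
      case (Suc m)
      let ?a = "m / n" and ?b = "Suc m / n"
      have ab: "0 \<le> ?a" "?a \<le> ?b" "?b \<le> 1" "?b - ?a = 1 / n"
        using Suc.prems n0 by (auto simp: field_simps)
      have cont: "continuous_on {?a..?b} f" by (rule continuous_on_subset[OF f]) (use ab in auto)
      have "f integrable_on {0..?b}"
        by (rule integrable_continuous_real, rule continuous_on_subset[OF f]) (use ab in auto)
      then have comb: "integral {0..?a} f + integral {?a..?b} f = integral {0..?b} f"
        using ab by (intro Henstock_Kurzweil_Integration.integral_combine) auto
      have "norm (integral {?a..?b} (\<lambda>x. f x - f ?a)) \<le> e / 2 * (?b - ?a)"
      proof (rule integral_bound[OF ab(2)])
        show "continuous_on {?a..?b} (\<lambda>x. f x - f ?a)" by (intro continuous_intros cont)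
        fix x assume x: "x \<in> {?a..?b}"
        then have "\<bar>x - ?a\<bar> < d" using ab(4) nd unfolding atLeastAtMost_iff by linarith
        moreover have "x \<in> {0..1}" "?a \<in> {0..1}" using x ab unfolding atLeastAtMost_iff by linarith+
        ultimately have "\<bar>f x - f ?a\<bar> < e / 2" by (intro d(2))
        then show "norm (f x - f ?a) \<le> e / 2" by simp
      qed
      moreover have "integral {?a..?b} (\<lambda>x. f x - f ?a) = integral {?a..?b} f - f ?a / n"
        using integrable_continuous_real[OF cont] ab by (subst Henstock_Kurzweil_Integration.integral_diff) auto
      ultimately have "\<bar>integral {?a..?b} f - f ?a / n\<bar> \<le> e / 2 * (1 / n)" using ab(4) by simp
      moreover have "(\<Sum>t<Suc m. f (real t / real n)) / real n = (\<Sum>t<m. f (real t / real n)) / real n + f ?a / n"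
        by (simp add: add_divide_distrib)
      moreover have "e / 2 * ?b = e / 2 * ?a + e / 2 * (1 / n)" by (simp add: add_divide_distrib algebra_simps)
      moreover have "\<bar>integral {0..?a} f - (\<Sum>t<m. f (real t / real n)) / real n\<bar> \<le> e / 2 * ?a" using Suc by simp
      ultimately show ?case using comb by linarith
    qed simp
    have "\<bar>integral {0..1} f - (\<Sum>t<n. f (real t / real n)) / real n\<bar> \<le> e / 2"
      using piece[of n] n0 by simp
    then show "norm ((\<Sum>t<n. f (real t / real n)) / real n - integral {0..1} f) < e"
      using e unfolding real_norm_def by linarith
  qed
qed

lemma standard_BMD:
  assumes "standard_BM N B"
  shows "prob_space N" "\<And>t. t \<ge> 0 \<Longrightarrow> B t \<in> borel_measurable N" "\<And>\<omega>. \<omega> \<in> space N \<Longrightarrow> B 0 \<omega> = 0"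
    "\<And>\<omega>. \<omega> \<in> space N \<Longrightarrow> continuous_on {0..} (\<lambda>t. B t \<omega>)"
    "\<And>s t. 0 \<le> s \<Longrightarrow> s < t \<Longrightarrow> distributed N lborel (\<lambda>\<omega>. B t \<omega> - B s \<omega>) (normal_density 0 (sqrt (t - s)))"
    "\<And>ts k. 0 \<le> ts 0 \<Longrightarrow> (\<And>i. i < k \<Longrightarrow> ts i < ts (Suc i)) \<Longrightarrow>
      prob_space.indep_vars N (\<lambda>_. borel) (\<lambda>i \<omega>. B (ts (Suc i)) \<omega> - B (ts i) \<omega>) {..<k::nat}"
  using assms unfolding standard_BM_def by blast+

lemma BM_riemann_sum:
  assumes BM: "standard_BM N B" and w: "\<omega> \<in> space N"
  shows "(\<lambda>n. (\<Sum>t<n. (B (real t / real n) \<omega>)\<^sup>2) / real n) \<longlonglongrightarrow> integral {0..1} (\<lambda>t. (B t \<omega>)\<^sup>2)"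
proof (rule riemann_sum_tendsto_integral)
  have "continuous_on {0..1} (\<lambda>t. B t \<omega>)"
    by (rule continuous_on_subset[OF standard_BMD(4)[OF BM w]]) auto
  then show "continuous_on {0..1} (\<lambda>t. (B t \<omega>)\<^sup>2)" by (intro continuous_intros)
qed

text \<open>Joint measurability of \<open>B\<close> in time and sample point is not part of
  \<open>standard_BM\<close>; continuity of the paths makes the integral a pointwise limit of grid
  sums.\<close>

lemma BM_integral_measurable:
  assumes BM: "standard_BM N B"
  shows "(\<lambda>\<omega>. integral {0..1} (\<lambda>t. (B t \<omega>)\<^sup>2)) \<in> borel_measurable N"
proof (rule borel_measurable_LIMSEQ_real[OF BM_riemann_sum[OF BM]])
  have [measurable]: "B (real t / real n) \<in> borel_measurable N" for t n
    by (rule standard_BMD(2)[OF BM]) simp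
  show "(\<lambda>\<omega>. (\<Sum>t<n. (B (real t / real n) \<omega>)\<^sup>2) / real n) \<in> borel_measurable N" for n by measurable
qed

lemma normal_third_moment:
  assumes "prob_space N" and s: "0 < s" and D: "distributed N lborel X (normal_density 0 s)"
  shows "integrable N (\<lambda>\<omega>. (X \<omega>)\<^sup>2)" "(\<integral>\<omega>. (X \<omega>)\<^sup>2 \<partial>N) = s\<^sup>2" "(\<integral>\<omega>. X \<omega> \<partial>N) = 0"
    "(\<integral>\<omega>. min ((X \<omega>)\<^sup>2) (\<bar>X \<omega>\<bar> ^ 3) \<partial>N) \<le> 4 * s ^ 3"
proof -
  interpret prob_space N by fact
  have [measurable]: "X \<in> borel_measurable N" using D by (auto simp: distributed_def)
  show i2: "integrable N (\<lambda>\<omega>. (X \<omega>)\<^sup>2)"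
    using distributed_integrable[OF D, of "\<lambda>x. x\<^sup>2"] integrable_normal_moment[OF s, of 0 2] by simp
  show e0: "(\<integral>\<omega>. X \<omega> \<partial>N) = 0" by (rule normal_distributed_expectation[OF s D])
  show "(\<integral>\<omega>. (X \<omega>)\<^sup>2 \<partial>N) = s\<^sup>2" using normal_distributed_variance[OF s D] e0 by simp
  have "has_bochner_integral lborel (\<lambda>x. normal_density 0 s x * \<bar>x - 0\<bar> ^ (2 * 1 + 1)) (2 ^ 1 * s ^ (2 * 1 + 1) * fact 1 * sqrt (2 / pi))"
    by (rule normal_moment_abs_odd[OF s])
  then have "has_bochner_integral lborel (\<lambda>x. normal_density 0 s x * \<bar>x\<bar> ^ 3) (2 * s ^ 3 * sqrt (2 / pi))"
    by (simp add: numeral_3_eq_3)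
  then have i3: "integrable N (\<lambda>\<omega>. \<bar>X \<omega>\<bar> ^ 3)" and e3: "(\<integral>\<omega>. \<bar>X \<omega>\<bar> ^ 3 \<partial>N) = 2 * s ^ 3 * sqrt (2 / pi)"
    using distributed_integrable[OF D, of "\<lambda>x. \<bar>x\<bar> ^ 3"] distributed_integral[OF D, of "\<lambda>x. \<bar>x\<bar> ^ 3"]
    by (auto simp: has_bochner_integral_iff)
  have "(\<integral>\<omega>. min ((X \<omega>)\<^sup>2) (\<bar>X \<omega>\<bar> ^ 3) \<partial>N) \<le> (\<integral>\<omega>. \<bar>X \<omega>\<bar> ^ 3 \<partial>N)"
  proof (rule integral_mono[OF _ i3])
    show "integrable N (\<lambda>\<omega>. min ((X \<omega>)\<^sup>2) (\<bar>X \<omega>\<bar> ^ 3))"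
      by (rule Bochner_Integration.integrable_bound[OF i2]) auto
  qed simp
  also have "\<dots> \<le> 2 * s ^ 3 * 1"
    unfolding e3 using s pi_gt3 by (intro mult_left_mono) (auto simp: field_simps)
  also have "\<dots> \<le> 4 * s ^ 3" using s by simp
  finally show "(\<integral>\<omega>. min ((X \<omega>)\<^sup>2) (\<bar>X \<omega>\<bar> ^ 3) \<partial>N) \<le> 4 * s ^ 3" .
qed

text \<open>On the grid, Brownian motion is a random walk with Gaussian steps of variance 1/n
  started at 0. In the general bound the exceptional set is empty and the initial term is 0; the
  third moment of a step is of order n^(-3/2), which leaves an error of order 1 / sqrt n.\<close>

lemma BM_grid_laplace:
  assumes BM: "standard_BM N B" and lam: "0 \<le> lam" and mu: "0 \<le> mu"
  shows "(\<lambda>n. (\<integral>\<omega>. exp (- lam * (B 1 \<omega>)\<^sup>2 - mu * ((\<Sum>t<n. (B (real t / real n) \<omega>)\<^sup>2) / real n)) \<partial>N) - exp (- riccati_sum lam mu n n)) \<longlonglongrightarrow> 0"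
proof -
  interpret prob_space N by (rule standard_BMD(1)[OF BM])
  define L where "L = lam + mu + 1"
  let ?err = "\<lambda>n::nat. 66 * L\<^sup>2 * (n * (4 * sqrt (1 / n) ^ 3) + 1 / n)"
  have "(\<lambda>n::nat. n * (4 * sqrt (1 / n) ^ 3) + 1 / n) \<longlonglongrightarrow> 0" by real_asymp
  from tendsto_mult_right_zero[OF this] have err: "?err \<longlonglongrightarrow> 0" by simp
  show ?thesis
  proof (rule Lim_null_comparison[OF _ err])
    show "\<forall>\<^sub>F n in sequentially. norm (expectation (\<lambda>\<omega>. exp (- lam * (B 1 \<omega>)\<^sup>2 - mu * ((\<Sum>t<n. (B (real t / real n) \<omega>)\<^sup>2) / real n))) - exp (- riccati_sum lam mu n n)) \<le> ?err n"
      using eventually_ge_at_top[of "nat \<lceil>4 * L\<rceil>"]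
    proof eventually_elim
      case (elim n)
      then have n: "real n \<ge> 4 * L" by linarith
      have "L \<ge> 1" using lam mu by (simp add: L_def)
      then have n0: "real n > 0" using n by linarith
      define h where "h t \<omega> = B (real (Suc t) / real n) \<omega> - B (real t / real n) \<omega>" for t \<omega>
      \<comment> \<open>The increments are summed rather than taking \<open>B\<close> at the grid
        points: the past is then a function of the independent increments at every
        \<open>\<omega>\<close>. The two processes agree on \<open>space N\<close>, where the path
        starts at 0.\<close>
      define y where "y t \<omega> = (\<Sum>j<t. h j \<omega>)" for t \<omega>
      have hm [measurable]: "h t \<in> borel_measurable N" for t
        unfolding h_def[abs_def] by (intro borel_measurable_diff standard_BMD(2)[OF BM]) simp_all
      have D: "distributed N lborel (h t) (normal_density 0 (sqrt (1 / n)))" for t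
      proof -
        have "real (Suc t) / n - real t / n = 1 / n" by (simp add: diff_divide_distrib[symmetric])
        moreover have "real t / n < real (Suc t) / n" using n0 by (simp add: divide_strict_right_mono)
        ultimately show ?thesis
          unfolding h_def[abs_def] using standard_BMD(5)[OF BM, of "t / n" "Suc t / n"] by simp
      qed
      have s0: "sqrt (1 / n) > 0" using n0 by simp
      note mom = normal_third_moment[OF prob_space_axioms s0 D]
      have ym [measurable]: "y t \<in> borel_measurable N" for t
        unfolding y_def[abs_def] by measurable
      have y_eq: "y t \<omega> = B (real t / real n) \<omega>" if "\<omega> \<in> space N" for t \<omega>
        using standard_BMD(3)[OF BM that] by (induction t) (simp_all add: y_def h_def)
      have y0: "y 0 \<omega> = 0" for \<omega> by (simp add: y_def)
      have iy2: "integrable N (\<lambda>\<omega>. (y t \<omega>)\<^sup>2)" for t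
      proof (cases "t = 0")
        case True
        then show ?thesis by (simp add: y0)
      next
        case False
        have Dy: "distributed N lborel (\<lambda>\<omega>. B (t / n) \<omega> - B 0 \<omega>) (normal_density 0 (sqrt (t / n)))"
          using standard_BMD(5)[OF BM, of 0 "t / n"] False n0 by simp
        have "integrable N (\<lambda>\<omega>. (B (t / n) \<omega> - B 0 \<omega>)\<^sup>2)"
          by (rule normal_third_moment(1)[OF prob_space_axioms _ Dy]) (use False n0 in simp)
        then show ?thesis
          by (subst Bochner_Integration.integrable_cong[OF refl, of _ _ "\<lambda>\<omega>. (B (t / n) \<omega> - B 0 \<omega>)\<^sup>2"])
            (auto simp: y_eq standard_BMD(3)[OF BM])
      qed
      have "\<bar>expectation (\<lambda>\<omega>. exp (- lam * (y n \<omega>)\<^sup>2 - mu / n * (\<Sum>t<n. (y t \<omega>)\<^sup>2))) - exp (- riccati_sum lam mu n n)\<bar>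
        \<le> L * expectation (\<lambda>\<omega>. (y 0 \<omega>)\<^sup>2) + 66 * L\<^sup>2 * (n * (4 * sqrt (1 / n) ^ 3) + 1 / n)
          + 4 * L * (1 + 0\<^sup>2) * (\<Sum>t<n. expectation (\<lambda>\<omega>. indicat_real {} (y t \<omega>) * ((y t \<omega>)\<^sup>2 + 1 / n)))"
      proof (rule laplace_quadratic_functional_error[where h = h, OF _ _ _ _ _ _ _ _ _ lam mu L_def n])
        fix t and f :: "(nat \<Rightarrow> real) \<Rightarrow> real"
        assume t: "t < n" and f: "f \<in> borel_measurable (Pi\<^sub>M {..t} (\<lambda>_. borel))"
        have "indep_vars (\<lambda>_. borel) (\<lambda>i \<omega>. B (real (Suc i) / n) \<omega> - B (real i / n) \<omega>) {..<n}"
          by (rule standard_BMD(6)[OF BM, of "\<lambda>i. real i / n"]) (use n0 in \<open>auto simp: divide_strict_right_mono\<close>)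
        then have "indep_vars (\<lambda>_. borel) h {..<n}" unfolding h_def[abs_def] .
        then have *: "indep_var (Pi\<^sub>M {..<t} (\<lambda>_. borel)) (\<lambda>\<omega>. \<lambda>i\<in>{..<t}. h i \<omega>) (Pi\<^sub>M {t} (\<lambda>_. borel)) (\<lambda>\<omega>. \<lambda>i\<in>{t}. h i \<omega>)"
          using t by (intro indep_var_restrict[where I = "{..<n}"]) auto
        define G where "G x = f (\<lambda>i\<in>{..t}. \<Sum>j<i. x j)" for x
        have "(\<lambda>x. \<Sum>j<i. x j) \<in> borel_measurable (Pi\<^sub>M {..<t} (\<lambda>_. borel :: real measure))" if "i \<le> t" for i
          using that by (intro borel_measurable_sum measurable_component_singleton) auto
        then have "G \<in> borel_measurable (Pi\<^sub>M {..<t} (\<lambda>_. borel))"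
          unfolding G_def[abs_def] by (intro measurable_compose[OF _ f] measurable_restrict) auto
        moreover have "(\<lambda>x. x t) \<in> borel_measurable (Pi\<^sub>M {t} (\<lambda>_. borel :: real measure))"
          by (intro measurable_component_singleton) auto
        ultimately have "indep_var borel (G \<circ> (\<lambda>\<omega>. \<lambda>i\<in>{..<t}. h i \<omega>)) borel ((\<lambda>x. x t) \<circ> (\<lambda>\<omega>. \<lambda>i\<in>{t}. h i \<omega>))"
          by (rule indep_var_compose[OF *])
        then have 1: "indep_var borel (G \<circ> (\<lambda>\<omega>. \<lambda>i\<in>{..<t}. h i \<omega>)) borel (h t)"
          by (simp add: comp_def)
        have "G \<circ> (\<lambda>\<omega>. \<lambda>i\<in>{..<t}. h i \<omega>) = (\<lambda>\<omega>. f (\<lambda>i\<in>{..t}. y i \<omega>))"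
        proof (rule ext)
          fix \<omega>
          have "(\<lambda>i\<in>{..t}. \<Sum>j<i. (\<lambda>i\<in>{..<t}. h i \<omega>) j) = (\<lambda>i\<in>{..t}. y i \<omega>)"
            unfolding y_def by (intro restrict_ext sum.cong) auto
          then show "(G \<circ> (\<lambda>\<omega>. \<lambda>i\<in>{..<t}. h i \<omega>)) \<omega> = f (\<lambda>i\<in>{..t}. y i \<omega>)"
            by (simp only: G_def comp_def)
        qed
        with 1 show "indep_var borel (\<lambda>\<omega>. f (\<lambda>i\<in>{..t}. y i \<omega>)) borel (h t)" by simp
      qed (use n0 mom iy2 in \<open>auto simp: y_def\<close>)
      moreover have "expectation (\<lambda>\<omega>. (y 0 \<omega>)\<^sup>2) = 0"
        by (simp add: y0)
      moreover have "expectation (\<lambda>\<omega>. exp (- lam * (y n \<omega>)\<^sup>2 - mu / n * (\<Sum>t<n. (y t \<omega>)\<^sup>2)))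
        = expectation (\<lambda>\<omega>. exp (- lam * (B 1 \<omega>)\<^sup>2 - mu * ((\<Sum>t<n. (B (real t / real n) \<omega>)\<^sup>2) / real n)))"
        using n0 by (intro Bochner_Integration.integral_cong) (simp_all add: y_eq)
      ultimately show ?case by simp
    qed
  qed
qed

text \<open>The grid functionals converge along every path, so their transforms converge by
  dominated convergence, and \<open>BM_grid_laplace\<close> transfers the limit to the Riccati
  sums.\<close>

lemma BM_laplace:
  assumes BM: "standard_BM N B" and lam: "0 \<le> lam" and mu: "0 \<le> mu"
  shows "(\<lambda>n. exp (- riccati_sum lam mu n n)) \<longlonglongrightarrow> (\<integral>\<omega>. exp (- lam * (B 1 \<omega>)\<^sup>2 - mu * integral {0..1} (\<lambda>t. (B t \<omega>)\<^sup>2)) \<partial>N)"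
proof -
  interpret prob_space N by (rule standard_BMD(1)[OF BM])
  have [measurable]: "B (real t / real n) \<in> borel_measurable N" "B 1 \<in> borel_measurable N" for t n
    by (rule standard_BMD(2)[OF BM], simp)+
  note [measurable] = BM_integral_measurable[OF BM]
  let ?F = "\<lambda>n \<omega>. exp (- lam * (B 1 \<omega>)\<^sup>2 - mu * ((\<Sum>t<n. (B (real t / real n) \<omega>)\<^sup>2) / real n))"
  have lim: "(\<lambda>n. expectation (?F n)) \<longlonglongrightarrow> expectation (\<lambda>\<omega>. exp (- lam * (B 1 \<omega>)\<^sup>2 - mu * integral {0..1} (\<lambda>t. (B t \<omega>)\<^sup>2)))"
  proof (rule integral_dominated_convergence[where w = "\<lambda>_. 1"])
    show "AE \<omega> in N. (\<lambda>n. ?F n \<omega>) \<longlonglongrightarrow> exp (- lam * (B 1 \<omega>)\<^sup>2 - mu * integral {0..1} (\<lambda>t. (B t \<omega>)\<^sup>2))"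
      by (intro AE_I2 tendsto_intros BM_riemann_sum[OF BM])
    show "AE \<omega> in N. norm (?F n \<omega>) \<le> 1" for n
    proof (intro AE_I2)
      fix \<omega>
      have "0 \<le> lam * (B 1 \<omega>)\<^sup>2" "0 \<le> mu * ((\<Sum>t<n. (B (real t / real n) \<omega>)\<^sup>2) / real n)"
        using lam mu by (auto intro!: mult_nonneg_nonneg divide_nonneg_nonneg sum_nonneg)
      then show "norm (?F n \<omega>) \<le> 1" by simp
    qed
  qed auto
  from tendsto_diff[OF this BM_grid_laplace[OF assms]] show ?thesis by simp
qed

text \<open>One null event settles both claims: by continuity, a vanishing integral of the squared
  path would make the path vanish on all of [0, 1], in particular at time 1, where it has a
  density.\<close>

lemma BM_nondegenerate:
  assumes BM: "standard_BM N B"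
  shows "AE \<omega> in N. B 1 \<omega> \<noteq> 0 \<and> integral {0..1} (\<lambda>t. (B t \<omega>)\<^sup>2) > 0"
proof -
  interpret prob_space N by (rule standard_BMD(1)[OF BM])
  have [measurable]: "B 1 \<in> borel_measurable N" by (rule standard_BMD(2)[OF BM]) simp
  have [measurable]: "B 0 \<in> borel_measurable N" by (rule standard_BMD(2)[OF BM]) simp
  have D: "distributed N lborel (\<lambda>\<omega>. B 1 \<omega> - B 0 \<omega>) (normal_density 0 1)"
    using standard_BMD(5)[OF BM, of 0 1] by simp
  have "emeasure N ((\<lambda>\<omega>. B 1 \<omega> - B 0 \<omega>) -` {0} \<inter> space N) = (\<integral>\<^sup>+x. ennreal (normal_density 0 1 x) * indicator {0} x \<partial>lborel)"
    by (rule distributed_emeasure[OF D]) simp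
  also have "\<dots> = 0"
    by simp
  finally have "AE \<omega> in N. B 1 \<omega> - B 0 \<omega> \<noteq> 0"
    by (intro AE_I[of _ _ "(\<lambda>\<omega>. B 1 \<omega> - B 0 \<omega>) -` {0} \<inter> space N"]) auto
  then show ?thesis
    using AE_space
  proof eventually_elim
    case (elim \<omega>)
    then have b1: "B 1 \<omega> \<noteq> 0" using standard_BMD(3)[OF BM, of \<omega>] by simp
    have cont: "continuous_on {0..1} (\<lambda>t. (B t \<omega>)\<^sup>2)"
      using continuous_on_subset[OF standard_BMD(4)[OF BM elim(2)], of "{0..1}"] by (intro continuous_intros) auto
    have int: "(\<lambda>t. (B t \<omega>)\<^sup>2) integrable_on {0..1}" by (rule integrable_continuous_real[OF cont])
    have ge: "0 \<le> integral {0..1} (\<lambda>t. (B t \<omega>)\<^sup>2)" by (intro Henstock_Kurzweil_Integration.integral_nonneg int) simp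
    have "integral {0..1} (\<lambda>t. (B t \<omega>)\<^sup>2) \<noteq> 0"
    proof
      assume "integral {0..1} (\<lambda>t. (B t \<omega>)\<^sup>2) = 0"
      then have "((\<lambda>t. (B t \<omega>)\<^sup>2) has_integral 0) (cbox 0 1)" using integrable_integral[OF int] by simp
      then have "(B 1 \<omega>)\<^sup>2 = 0"
        by (intro has_integral_0_cbox_imp_0[of 0 1 "\<lambda>t. (B t \<omega>)\<^sup>2" 1]) (use cont in auto)
      then show False using b1 by simp
    qed
    then show ?case using b1 ge by simp
  qed
qed

section \<open>The limit theorem\<close>

text \<open>The expression 1 + 2 num / (n var) approximates the nonnegative \<open>A\<close> but may
  be negative itself; the cut at 0 keeps its exponential in [0, 1]. Powers of the two exponentials
  are Laplace transforms at integer points, and convergence in mean of the exponents carries over to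
  them.\<close>

lemma (in tar_process) estimator_laplace_tendsto:
  fixes i j :: nat
  assumes lim: "(\<lambda>n. exp (- riccati_sum i j n n)) \<longlonglongrightarrow> l"
  shows "(\<lambda>n. expectation (\<lambda>\<omega>. exp (- max 0 (1 + 2 * num n \<omega> / (n * var))) ^ i
      * exp (- (den n \<omega> / ((real n)\<^sup>2 * var))) ^ j)) \<longlonglongrightarrow> l"
proof -
  define A' where "A' n \<omega> = 1 + 2 * num n \<omega> / (n * var)" for n \<omega>
  define D' where "D' n \<omega> = den n \<omega> / ((real n)\<^sup>2 * var)" for n \<omega>
  define A where "A n \<omega> = (Y n \<omega>)\<^sup>2 / (n * var)" for n \<omega>
  define D where "D n \<omega> = (\<Sum>t<n. (Y t \<omega>)\<^sup>2) / ((real n)\<^sup>2 * var)" for n \<omega>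
  have [measurable]: "A n \<in> borel_measurable M" "D n \<in> borel_measurable M"
    "A' n \<in> borel_measurable M" "D' n \<in> borel_measurable M" for n
    unfolding A_def[abs_def] D_def[abs_def] A'_def[abs_def] D'_def[abs_def] by measurable
  have A0: "0 \<le> A n \<omega>" and D0: "0 \<le> D n \<omega>" and D'0: "0 \<le> D' n \<omega>" for n \<omega>
    using var_pos den_nonneg[of n \<omega>]
    by (auto simp: A_def D_def D'_def intro!: divide_nonneg_nonneg sum_nonneg mult_nonneg_nonneg)
  let ?E' = "\<lambda>n \<omega>. exp (- (real i * max 0 (A' n \<omega>) + real j * D' n \<omega>))" and ?E = "\<lambda>n \<omega>. exp (- (real i * A n \<omega> + real j * D n \<omega>))"
  have "(\<lambda>n. expectation (\<lambda>\<omega>. exp (- real i * A n \<omega> - real j * D n \<omega>)) - exp (- riccati_sum i j n n)) \<longlonglongrightarrow> 0"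
    unfolding A_def D_def by (rule tar_laplace_tendsto_0) simp_all
  from tendsto_add[OF this lim]
  have lim1: "(\<lambda>n. expectation (\<lambda>\<omega>. ?E n \<omega>)) \<longlonglongrightarrow> l" by simp
  have int1: "integrable M (\<lambda>\<omega>. ?E n \<omega>)" for n
  proof (rule integrable_const_bound[of _ 1])
    show "AE \<omega> in M. norm (?E n \<omega>) \<le> 1"
      using A0 D0 by (intro AE_I2) (simp only: real_norm_def abs_exp_cancel exp_le_one_iff neg_le_0_iff_le, simp)
  qed simp
  have int2: "integrable M (\<lambda>\<omega>. ?E' n \<omega>)" for n
  proof (rule integrable_const_bound[of _ 1])
    show "AE \<omega> in M. norm (?E' n \<omega>) \<le> 1"
      using D'0 by (intro AE_I2) (simp only: real_norm_def abs_exp_cancel exp_le_one_iff neg_le_0_iff_le, simp)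
  qed simp
  have intD: "integrable M (D n)" for n
    unfolding D_def[abs_def] using Y_sq_integrable by simp
  have intA: "integrable M (A n)" for n
    unfolding A_def[abs_def] using Y_sq_integrable by simp
  let ?err = "\<lambda>n. real i * expectation (\<lambda>\<omega>. \<bar>A' n \<omega> - A n \<omega>\<bar>) + real j * expectation (\<lambda>\<omega>. \<bar>D' n \<omega> - D n \<omega>\<bar>)"
  have "?err \<longlonglongrightarrow> real i * 0 + real j * 0"
    unfolding A_def A'_def D_def D'_def
    by (intro tendsto_add tendsto_mult tendsto_const num_error_tendsto_0 den_error_tendsto_0)
  then have err: "?err \<longlonglongrightarrow> 0" by simp
  have lim2: "(\<lambda>n. expectation (\<lambda>\<omega>. ?E' n \<omega>)
      - expectation (\<lambda>\<omega>. ?E n \<omega>)) \<longlonglongrightarrow> 0"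
  proof (rule Lim_null_comparison[OF _ err], intro always_eventually allI)
    fix n
    have iA: "integrable M (\<lambda>\<omega>. \<bar>A' n \<omega> - A n \<omega>\<bar>)"
    proof -
      have "integrable M (num n)"
        unfolding num_def[abs_def]
      proof (intro Bochner_Integration.integrable_sum)
        fix t
        let ?g = "\<lambda>x. if x > r then x else 0"
        have "integrable M (\<lambda>\<omega>. ?g (Y t \<omega>) * eps (Suc t) \<omega>)"
        proof (rule expectation_Y_mult_eps(1)[of ?g "\<lambda>x. x"])
          show "integrable M (\<lambda>\<omega>. ?g (Y t \<omega>))"
            by (rule Bochner_Integration.integrable_bound[OF Y_integrable[of t]]) auto
        qed (use eps_integrable(1)[of 0] in simp_all)
        then show "integrable M (\<lambda>\<omega>. if Y t \<omega> > r then Y t \<omega> * eps (Suc t) \<omega> else 0)"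
          by (rule Bochner_Integration.integrable_bound) auto
      qed
      then show ?thesis unfolding A'_def[abs_def] using intA[of n] by simp
    qed
    have iD: "integrable M (\<lambda>\<omega>. \<bar>D' n \<omega> - D n \<omega>\<bar>)"
    proof -
      have "integrable M (den n)"
        unfolding den_def[abs_def]
      proof (intro Bochner_Integration.integrable_sum)
        show "integrable M (\<lambda>\<omega>. if Y t \<omega> > r then (Y t \<omega>)\<^sup>2 else 0)" for t
          by (rule Bochner_Integration.integrable_bound[OF Y_sq_integrable[of t]]) auto
      qed
      then show ?thesis unfolding D'_def[abs_def] using intD[of n] by simp
    qed
    have pw: "\<bar>?E' n \<omega> - ?E n \<omega>\<bar>
        \<le> real i * \<bar>A' n \<omega> - A n \<omega>\<bar> + real j * \<bar>D' n \<omega> - D n \<omega>\<bar>" for \<omega>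
    proof -
      have "\<bar>?E' n \<omega> - ?E n \<omega>\<bar>
        \<le> \<bar>(real i * max 0 (A' n \<omega>) + real j * D' n \<omega>) - (real i * A n \<omega> + real j * D n \<omega>)\<bar>"
        using A0 D0 D'0 by (intro exp_minus_diff_le) (auto intro!: add_nonneg_nonneg)
      also have "\<dots> = \<bar>real i * (max 0 (A' n \<omega>) - A n \<omega>) + real j * (D' n \<omega> - D n \<omega>)\<bar>"
        by (simp add: algebra_simps)
      also have "\<dots> \<le> real i * \<bar>max 0 (A' n \<omega>) - A n \<omega>\<bar> + real j * \<bar>D' n \<omega> - D n \<omega>\<bar>"
        by (intro order_trans[OF abs_triangle_ineq]) (simp add: abs_mult)
      \<comment> \<open>Since \<open>A n \<omega>\<close> is nonnegative, replacing
        \<open>A' n \<omega>\<close> by its positive part does not increase the distance to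
        it.\<close>
      also have "\<dots> \<le> real i * \<bar>A' n \<omega> - A n \<omega>\<bar> + real j * \<bar>D' n \<omega> - D n \<omega>\<bar>"
        using A0[of n \<omega>] by (intro add_right_mono mult_left_mono) auto
      finally show ?thesis .
    qed
    have "norm (expectation (\<lambda>\<omega>. ?E' n \<omega>)
      - expectation (\<lambda>\<omega>. ?E n \<omega>))
      = \<bar>expectation (\<lambda>\<omega>. ?E' n \<omega> - ?E n \<omega>)\<bar>"
      by (simp only: Bochner_Integration.integral_diff[OF int2 int1] real_norm_def)
    also have "\<dots> \<le> expectation (\<lambda>\<omega>. \<bar>?E' n \<omega> - ?E n \<omega>\<bar>)"
      by (rule integral_abs_bound)
    also have "\<dots> \<le> expectation (\<lambda>\<omega>. real i * \<bar>A' n \<omega> - A n \<omega>\<bar> + real j * \<bar>D' n \<omega> - D n \<omega>\<bar>)"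
      by (rule integral_mono[OF integrable_abs[OF Bochner_Integration.integrable_diff[OF int2 int1]] _ pw])
        (intro Bochner_Integration.integrable_add integrable_mult_right iA iD)
    also have "\<dots> = ?err n"
      by (subst Bochner_Integration.integral_add[OF integrable_mult_right[OF iA] integrable_mult_right[OF iD]])
        (simp only: integral_mult_right_zero)
    finally show "norm (expectation (\<lambda>\<omega>. ?E' n \<omega>)
      - expectation (\<lambda>\<omega>. ?E n \<omega>)) \<le> ?err n" .
  qed
  have eq: "exp (- max 0 a) ^ i * exp (- b) ^ j = exp (- (real i * max 0 a + real j * b))" for a b :: real
    by (simp add: exp_of_nat_mult[symmetric] mult_exp_exp)
  from tendsto_add[OF lim2 lim1] show ?thesis
    unfolding eq A'_def[symmetric] D'_def[symmetric] by simp
qed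

theorem theorem2p1:
  fixes M :: "'a measure" and eps :: "nat \<Rightarrow> 'a \<Rightarrow> real" and Y0 :: "'a \<Rightarrow> real"
    and alpha beta r :: real
    and N :: "'b measure" and B :: "real \<Rightarrow> 'b \<Rightarrow> real"
  assumes M: "prob_space M"
    and eps_rv: "\<And>t. t \<ge> 1 \<Longrightarrow> eps t \<in> borel_measurable M"
    and Y0_rv: "Y0 \<in> borel_measurable M"
    and indep: "prob_space.indep_vars M (\<lambda>_. borel) (\<lambda>i. if i = 0 then Y0 else eps i) UNIV"
    and ident: "\<And>t. t \<ge> 1 \<Longrightarrow> distr M borel (eps t) = distr M borel (eps 1)"
    and eps_sq: "integrable M (\<lambda>\<omega>. (eps 1 \<omega>)\<^sup>2)"
    and eps_mean: "prob_space.expectation M (eps 1) = 0"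
    and eps_var: "prob_space.expectation M (\<lambda>\<omega>. (eps 1 \<omega>)\<^sup>2) > 0"
    and Y0_sq: "integrable M (\<lambda>\<omega>. (Y0 \<omega>)\<^sup>2)"
    and cases: "(alpha = 1 \<and> beta < 1 \<and> r \<le> 0) \<or> (alpha = 1 \<and> beta = -1)"
    and BM: "standard_BM N B"
  shows "weak_conv_m
           (\<lambda>n. distr M borel
              (\<lambda>\<omega>. real n * (alpha_hat r (tar_path alpha beta r (Y0 \<omega>) (\<lambda>t. eps t \<omega>)) n - 1)))
           (distr N borel
              (\<lambda>\<omega>. ((B 1 \<omega>)\<^sup>2 - 1) / (2 * integral {0..1} (\<lambda>t. (B t \<omega>)\<^sup>2))))"
proof -
  have alpha: "alpha = 1" using cases by auto
  interpret tar_process M eps Y0 beta r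
  proof (rule tar_process.intro[OF M], unfold_locales)
    show "beta < 1 \<and> r \<le> 0 \<or> beta = -1" using cases by auto
  qed (fact indep ident eps_sq eps_mean eps_var Y0_sq)+
  interpret N: prob_space N by (rule standard_BMD(1)[OF BM])
  have B1 [measurable]: "B 1 \<in> borel_measurable N" by (rule standard_BMD(2)[OF BM]) simp
  note [measurable] = BM_integral_measurable[OF BM]
  define I where "I \<omega> = integral {0..1} (\<lambda>t. (B t \<omega>)\<^sup>2)" for \<omega>
  have [measurable]: "I \<in> borel_measurable N" unfolding I_def[abs_def] by measurable
  \<comment> \<open>Outside \<open>space N\<close> the path need not be continuous; a function that
    is not integrable has integral 0, so the bound holds for every \<open>\<omega>\<close>.\<close>
  have I0: "0 \<le> I \<omega>" for \<omega>
    unfolding I_def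
    by (cases "(\<lambda>t. (B t \<omega>)\<^sup>2) integrable_on {0..1}")
      (auto simp: not_integrable_integral intro!: Henstock_Kurzweil_Integration.integral_nonneg)
  define p where "p n \<omega> = exp (- max 0 (1 + 2 * num n \<omega> / (n * var)))" for n \<omega>
  define q where "q n \<omega> = exp (- (den n \<omega> / ((real n)\<^sup>2 * var)))" for n \<omega>
  \<comment> \<open>The quotient (A - 1) / (2 D) in the coordinates exp (- A) and exp (- D).\<close>
  define g where "g z = (- ln (fst z) - 1) / (2 * (- ln (snd z)))" for z :: "real \<times> real"
  have Dn0: "0 \<le> den n \<omega> / ((real n)\<^sup>2 * var)" for n \<omega> using den_nonneg[of n \<omega>] var_pos by simp
  show ?thesis unfolding alpha I_def[symmetric]
  proof (rule weak_conv_of_moments[where p = p and q = q and P = "\<lambda>\<omega>. exp (- (B 1 \<omega>)\<^sup>2)" and Q = "\<lambda>\<omega>. exp (- I \<omega>)" and g = g])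
    show "prob_space M" "prob_space N" by unfold_locales
    show "p n \<in> borel_measurable M" "q n \<in> borel_measurable M" for n
      unfolding p_def[abs_def] q_def[abs_def] by measurable
    show "(\<lambda>\<omega>. real n * (alpha_hat r (tar_path 1 beta r (Y0 \<omega>) (\<lambda>t. eps t \<omega>)) n - 1)) \<in> borel_measurable M" for n
      unfolding alpha_hat_def Y_def[symmetric] by measurable
    show "(p n \<omega>, q n \<omega>) \<in> {0..1} \<times> {0..1}" for n \<omega>
      using Dn0[of n \<omega>] by (simp add: p_def q_def)
    show "(exp (- (B 1 \<omega>)\<^sup>2), exp (- I \<omega>)) \<in> {0..1} \<times> {0..1}" for \<omega>
      using I0[of \<omega>] by simp
    show "AE \<omega> in N. 0 < exp (- (B 1 \<omega>)\<^sup>2) \<and> exp (- (B 1 \<omega>)\<^sup>2) < 1 \<and> 0 < exp (- I \<omega>) \<and> exp (- I \<omega>) < 1"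
      using BM_nondegenerate[OF BM] by eventually_elim (simp add: I_def)
    show "(\<lambda>n. \<integral>\<omega>. p n \<omega> ^ i * q n \<omega> ^ j \<partial>M) \<longlonglongrightarrow> (\<integral>\<omega>. exp (- (B 1 \<omega>)\<^sup>2) ^ i * exp (- I \<omega>) ^ j \<partial>N)" for i j
      unfolding p_def q_def
    proof (rule estimator_laplace_tendsto)
      have "exp (- (B 1 \<omega>)\<^sup>2) ^ i * exp (- I \<omega>) ^ j = exp (- real i * (B 1 \<omega>)\<^sup>2 - real j * I \<omega>)" for \<omega>
        by (simp add: exp_of_nat_mult[symmetric] mult_exp_exp)
      then show "(\<lambda>n. exp (- riccati_sum (real i) (real j) n n)) \<longlonglongrightarrow> (\<integral>\<omega>. exp (- (B 1 \<omega>)\<^sup>2) ^ i * exp (- I \<omega>) ^ j \<partial>N)"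
        using BM_laplace[OF BM, of "real i" "real j"] by (simp add: I_def)
    qed
    show "continuous_on ({0<..<1} \<times> {0<..<1}) g"
      unfolding g_def[abs_def] by (intro continuous_intros) auto
    \<comment> \<open>The degenerate cases sit on the boundary of the square:
      \<open>q n \<omega> < 1\<close> excludes \<open>n = 0\<close> and a vanishing denominator,
      where \<open>alpha_hat\<close> has its default value, and \<open>p n \<omega> < 1\<close>
      means that the cut at 0 is inactive.\<close>
    show "real n * (alpha_hat r (tar_path 1 beta r (Y0 \<omega>) (\<lambda>t. eps t \<omega>)) n - 1) = g (p n \<omega>, q n \<omega>)"
      if "p n \<omega> < 1" "q n \<omega> < 1" for n \<omega>
    proof -
      have "den n \<omega> / ((real n)\<^sup>2 * var) > 0" using that(2) by (simp add: q_def)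
      then have den: "den n \<omega> \<noteq> 0" and n: "real n > 0" by (auto intro!: Nat.gr0I)
      have "max 0 (1 + 2 * num n \<omega> / (n * var)) > 0" using that(1) by (simp add: p_def)
      then have "- ln (p n \<omega>) = 1 + 2 * num n \<omega> / (n * var)" by (simp add: p_def)
      then have "g (p n \<omega>, q n \<omega>) = (2 * num n \<omega> / (n * var)) / (2 * (den n \<omega> / ((real n)\<^sup>2 * var)))"
        by (simp add: g_def q_def)
      also have "\<dots> = real n * (num n \<omega> / den n \<omega>)"
        using den n var_pos by (simp add: field_simps power2_eq_square)
      finally show ?thesis using alpha_hat_eq[OF den] by simp
    qed
    show "((B 1 \<omega>)\<^sup>2 - 1) / (2 * I \<omega>) = g (exp (- (B 1 \<omega>)\<^sup>2), exp (- I \<omega>))" for \<omega>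
      by (simp add: g_def)
  qed measurable
qed

end
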